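(* There exists a unique solution $(u_h,\hat u_h,\tilde u_h)\in\mathbb V_h^\Omega\times\mathbb V_h^{\mathcal G}\times\mathbb V_h^{\mathcal B}$ of the dG formulation of the 3D-1D network model: for all $(w_h,\hat w_h,\tilde w_h)\in\mathbb V_h^\Omega\times\mathbb V_h^{\mathcal G}\times\mathbb V_h^{\mathcal B}$, $$a_h(u_h,w_h)+\sum_{e\in\mathcal E}b_e(\overline u_{e,h}-\hat u_{e,h},\overline w_{e,h})=(f,w_h)_\Omega,$$ $$\sum_{e\in\mathcal E}a_{e,h}(\hat u_{e,h},\hat w_{e,h})+\sum_{e\in\mathcal E}b_e(\hat u_{e,h}-\overline u_{e,h},\hat w_{e,h})+\sum_{\mathsf v\in\mathcal B}b_{\mathsf v}\big((u_h,\hat u_h,\tilde u_h),(w_h,\hat w_h,\tilde w_h)\big)=\sum_{e\in\mathcal E}(\hat f_e,\hat w_{e,h})_{L^2_{A_e}(e)}.$$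
   Context: Notation. $(f,g)_O$ is the $L^2(O)$ inner product; for a weight $w>0$, $(f,g)_{L^2_w(O)}=(f,wg)_O$. Network. $\mathcal G(\mathcal V,\mathcal E)$ is a finite, directed, connected oriented graph with vertices $\mathcal V$ and edges $\mathcal E$ (one-dimensional, embedded in a bounded domain $\Omega\subset\mathbb R^3$, each with arc-length variable $s$). $\mathcal E(\mathsf v)$ is the set of edges sharing the vertex $\mathsf v$. For $e=(\mathsf v_{\mathrm{in}}^e,\mathsf v_{\mathrm{out}}^e)$, $n_e:\mathcal V\to\{-1,0,1\}$ is $n_e(\mathsf v_{\mathrm{in}}^e)=1$, $n_e(\mathsf v_{\mathrm{out}}^e)=-1$, $n_e(\mathsf v)=0$ otherwise. Bifurcation points: $\mathcal B=\{\mathsf v\in\mathcal V:\mathrm{card}(\mathcal E(\mathsf v))\ge3\}$. Each edge $e$ is surrounded by a cylinder $B_e$, strictly included in $\Omega$, with cross-section $\Theta_e$ of area $A_e>0$ and perimeter $P_e>0$ (satisfying $a_0\le A_e+P_e\le a_1$ for positive constants $a_0,a_1$, and $A_e\in\mathcal C^1$). For a function $u$ on $\Omega$, $\overline u_e=\frac1{P_e}\int_{\partial\Theta_e}u$; $\overline u_{e,h}$ and $\overline w_{e,h}$ denote these averages for $u_h$ and $w_h$. $\xi$ is a positive constant $\xi_e$ on each edge. Data: $f\in L^2(\Omega)$, $\hat f_e\in L^2_{A_e}(e)$. 3D discretization. $\mathcal T_\Omega^h$ is a regular partition of $\Omega$ into tetrahedra $K$ such that, for every $e$ and every $K$ meeting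 $B_e$, $\partial K\cap\partial B_e$ has zero two-dimensional measure. $\mathbb V_h^\Omega=\{v_h\in L^2(\Omega):v_h|_K\in\mathbb P_{k_1}(K)\ \forall K\in\mathcal T_\Omega^h\}$. $\Gamma_h$ is the set of interior faces; each face $F$ has area $|F|$ and unit normal $\boldsymbol n_F$ pointing from $K_F^1$ to $K_F^2$ (the two elements sharing $F$), $\{v\}=\frac12(v|_{K_F^1}+v|_{K_F^2})$, $[v]=v|_{K_F^1}-v|_{K_F^2}$; on boundary faces $[v]=\{v\}=v|_{K_F^1}$ and $\boldsymbol n_F$ is the outward normal; "$F\in\Gamma_h\cup\partial\Omega$" ranges over all interior and boundary faces. With $\epsilon_1\in\{-1,0,1\}$ and penalty parameter $\sigma_\Omega>0$, $a_h(u,v)=\sum_K\int_K\nabla u\cdot\nabla v-\sum_{F\in\Gamma_h\cup\partial\Omega}\int_F\{\nabla u\}\cdot\boldsymbol n_F[v]+\epsilon_1\sum_{F\in\Gamma_h\cup\partial\Omega}\int_F\{\nabla v\}\cdot\boldsymbol n_F[u]+\sum_{F\in\Gamma_h\cup\partial\Omega}\frac{\sigma_\Omega}{|F|^{1/2}}\int_F[u][v]$. 1D discretization. $h_e$ is the length of the edge $e$. Each edge $e$ carries a uniform mesh with nodes $s_0<\dots<s_{N_e}$ and mesh size $\delta_e$; $\mathbb V_h^e$ is the space of discontinuous piecewise polynomials of degree at most $k_e$ on it, and $\mathbb V_h^{\mathcal G}=\{\hat v_h:\hat v_h|_e=\hat v_{e,h}\in\mathbb V_h^e\ \forall e\in\mathcal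 E\}$. With $[\hat v]_{s_i}=\hat v(s_i^-)-\hat v(s_i^+)$, $\{\hat v\}_{s_i}=\frac12(\hat v(s_i^-)+\hat v(s_i^+))$ at interior nodes, $\epsilon_2\in\{-1,0,1\}$ and penalty parameter $\sigma_e>0$, $a_{e,h}(\hat u,\hat v)=\sum_{i=1}^{N_e}\int_{s_{i-1}}^{s_i}A_e\,\mathrm d_s\hat u\,\mathrm d_s\hat v-\sum_{i=1}^{N_e-1}\{A_e\mathrm d_s\hat u\}_{s_i}[\hat v]_{s_i}+\epsilon_2\sum_{i=1}^{N_e-1}\{A_e\mathrm d_s\hat v\}_{s_i}[\hat u]_{s_i}+\sum_{i=1}^{N_e-1}\frac{\sigma_e}{\delta_e}[\hat u]_{s_i}[\hat v]_{s_i}$, and $b_e(\hat v,\hat w)=(\xi_e\hat v,\hat w)_{L^2_{P_e}(e)}$. Bifurcation unknowns. $\mathbb V_h^{\mathcal B}=\{\tilde w_h=(\tilde w_{\mathsf v,h})_{\mathsf v\in\mathcal B}:\sum_{\mathsf v\in\mathcal B}\tilde w_{\mathsf v,h}^2<\infty\}$ (real values). For $\mathsf v\in\mathcal B$, with penalty parameter $\sigma_{\mathsf v}>0$, $b_{\mathsf v}((u_h,\hat u_h,\tilde u_h),(w_h,\hat w_h,\tilde w_h))=\sum_{e\in\mathcal E(\mathsf v)}A_e\mathrm d_s\hat u_{e,h}(\mathsf v)n_e(\mathsf v)(\hat w_{e,h}(\mathsf v)-\tilde w_{\mathsf v,h})+\sum_{e\in\mathcal E(\mathsf v)}A_e\mathrm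 d_s\hat w_{e,h}(\mathsf v)n_e(\mathsf v)(\hat u_{e,h}(\mathsf v)-\tilde u_{\mathsf v,h})+\sum_{e\in\mathcal E(\mathsf v)}\frac{\sigma_{\mathsf v}}{h_e}(\hat u_{e,h}(\mathsf v)-\tilde u_{\mathsf v,h})(\hat w_{e,h}(\mathsf v)-\tilde w_{\mathsf v,h})$.
   Formalization: Penalties must be sufficiently large: all σ_v, also σ_Ω if ε1≠1 and σ_e if ε2≠1, must exceed a bound depending only on network, meshes and degrees; for arbitrary positive penalties uniqueness can fail. *)

theory Defs
  imports "HOL-Analysis.Analysis" "HOL-Computational_Algebra.Polynomial" "Graph_Theory.Digraph_Component"
begin

section \<open>Weighted square-integrable functions\<close>

definition weighted_L2 :: "'a::euclidean_space set \<Rightarrow> ('a \<Rightarrow> real) \<Rightarrow> ('a \<Rightarrow> real) set" where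
  "weighted_L2 S w = {f. f \<in> borel_measurable (lebesgue_on S) \<and>
                         integrable (lebesgue_on S) (\<lambda>x. w x * (f x)\<^sup>2)}"

definition weighted_inner ::
    "'a::euclidean_space set \<Rightarrow> ('a \<Rightarrow> real) \<Rightarrow> ('a \<Rightarrow> real) \<Rightarrow> ('a \<Rightarrow> real) \<Rightarrow> real" where
  "weighted_inner S w f g = (LINT x|lebesgue_on S. f x * (w x * g x))"


section \<open>The network and the surrounding cylinders\<close>

text \<open>
  Vertices are points of space. The edge \<open>e\<close> is the curve \<open>curve N e\<close>, parametrised by arc length
  on \<open>{0..edge_len N e}\<close>, running from \<open>tail (net N) e\<close> (the vertex called v-in) to
  \<open>head (net N) e\<close> (called v-out).
  The cross-section at arc length \<open>s\<close> lies in the plane normal to the curve; it is described in the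
  coordinates of that plane given by the orthonormal frame \<open>(frame1, frame2)\<close> by the planar set
  \<open>cross_section N e s\<close>, whose boundary is parametrised on \<open>{0..1}\<close> by the closed path
  \<open>rim N e s\<close>.
\<close>

record 'e network =
  net :: "(real^3, 'e) pre_digraph"
  edge_len :: "'e \<Rightarrow> real"
  curve :: "'e \<Rightarrow> real \<Rightarrow> real^3"
  frame1 :: "'e \<Rightarrow> real \<Rightarrow> real^3"
  frame2 :: "'e \<Rightarrow> real \<Rightarrow> real^3"
  cross_section :: "'e \<Rightarrow> real \<Rightarrow> (real^2) set"
  rim :: "'e \<Rightarrow> real \<Rightarrow> real \<Rightarrow> real^2"

definition edges_at :: "'e network \<Rightarrow> real^3 \<Rightarrow> 'e set" where
  "edges_at N v = {e \<in> arcs (net N). tail (net N) e = v \<or> head (net N) e = v}"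

definition bifurcations :: "'e network \<Rightarrow> (real^3) set" where
  "bifurcations N = {v \<in> verts (net N). card (edges_at N v) \<ge> 3}"

definition edge_sign :: "'e network \<Rightarrow> 'e \<Rightarrow> real^3 \<Rightarrow> real" where
  "edge_sign N e v =
     (if v = tail (net N) e then 1 else if v = head (net N) e then -1 else 0)"

definition place :: "'e network \<Rightarrow> 'e \<Rightarrow> real \<Rightarrow> real^2 \<Rightarrow> real^3" where
  "place N e s z = curve N e s + z$1 *\<^sub>R frame1 N e s + z$2 *\<^sub>R frame2 N e s"

definition cylinder :: "'e network \<Rightarrow> 'e \<Rightarrow> (real^3) set" where
  "cylinder N e = (\<Union>s\<in>{0<..<edge_len N e}. place N e s ` cross_section N e s)"

definition area :: "'e network \<Rightarrow> 'e \<Rightarrow> real \<Rightarrow> real" where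
  "area N e s = measure lebesgue (cross_section N e s)"

definition rim_speed :: "'e network \<Rightarrow> 'e \<Rightarrow> real \<Rightarrow> real \<Rightarrow> real" where
  "rim_speed N e s t = norm (vector_derivative (rim N e s) (at t))"

definition perimeter :: "'e network \<Rightarrow> 'e \<Rightarrow> real \<Rightarrow> real" where
  "perimeter N e s = (LINT t|lebesgue_on {0..1}. rim_speed N e s t)"

text \<open>The frame is orthonormal, so \<open>rim_speed\<close> is also the speed of the rim in space.\<close>

definition rim_average :: "'e network \<Rightarrow> (real^3 \<Rightarrow> real) \<Rightarrow> 'e \<Rightarrow> real \<Rightarrow> real" where
  "rim_average N u e s =
     (1 / perimeter N e s) *
     (LINT t|lebesgue_on {0..1}. u (place N e s (rim N e s t)) * rim_speed N e s t)"

text \<open>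
  Covers by small sets need not be required here: a set is null for the two-dimensional Hausdorff
  measure if and only if it is null for the two-dimensional Hausdorff content.
\<close>

definition two_dim_null :: "(real^3) set \<Rightarrow> bool" where
  "two_dim_null S \<longleftrightarrow> (\<forall>\<epsilon>>0. \<exists>U :: nat \<Rightarrow> (real^3) set.
     S \<subseteq> (\<Union>i. U i) \<and> (\<forall>i. bounded (U i)) \<and>
     summable (\<lambda>i. (diameter (U i))\<^sup>2) \<and> (\<Sum>i. (diameter (U i))\<^sup>2) < \<epsilon>)"

definition C1_on_interval :: "(real \<Rightarrow> 'a::real_normed_vector) \<Rightarrow> real \<Rightarrow> real \<Rightarrow> bool" where
  "C1_on_interval g a b \<longleftrightarrow> (\<exists>g'. continuous_on {a..b} g' \<and>
     (\<forall>s\<in>{a..b}. (g has_vector_derivative g' s) (at s within {a..b})))"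

definition embedded_graph :: "(real^3) set \<Rightarrow> 'e network \<Rightarrow> bool" where
  "embedded_graph \<Omega> N \<longleftrightarrow>
     fin_digraph (net N) \<and> loopfree_digraph (net N) \<and> Digraph_Component.connected (net N) \<and>
     verts (net N) \<subseteq> \<Omega> \<and>
     (\<forall>e\<in>arcs (net N).
        edge_len N e > 0 \<and>
        C1_on_interval (curve N e) 0 (edge_len N e) \<and>
        (\<forall>s\<in>{0..edge_len N e}.
           norm (vector_derivative (curve N e) (at s within {0..edge_len N e})) = 1) \<and>
        inj_on (curve N e) {0..edge_len N e} \<and>
        curve N e 0 = tail (net N) e \<and> curve N e (edge_len N e) = head (net N) e \<and>
        curve N e ` {0..edge_len N e} \<subseteq> \<Omega> \<and>
        curve N e ` {0..edge_len N e} \<inter> verts (net N) = {tail (net N) e, head (net N) e}) \<and>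
     (\<forall>e\<in>arcs (net N). \<forall>e'\<in>arcs (net N). e \<noteq> e' \<longrightarrow>
        curve N e ` {0..edge_len N e} \<inter> curve N e' ` {0..edge_len N e'} \<subseteq> verts (net N))"

definition surrounding_cylinders :: "(real^3) set \<Rightarrow> 'e network \<Rightarrow> bool" where
  "surrounding_cylinders \<Omega> N \<longleftrightarrow>
     (\<forall>e\<in>arcs (net N).
        continuous_on {0..edge_len N e} (frame1 N e) \<and>
        continuous_on {0..edge_len N e} (frame2 N e) \<and>
        continuous_on ({0..edge_len N e} \<times> {0..1}) (\<lambda>(s, t). rim N e s t) \<and>
        (\<forall>s\<in>{0..edge_len N e}.
           (let \<tau> = vector_derivative (curve N e) (at s within {0..edge_len N e}) in
              norm (frame1 N e s) = 1 \<and> norm (frame2 N e s) = 1 \<and>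
              frame1 N e s \<bullet> frame2 N e s = 0 \<and>
              frame1 N e s \<bullet> \<tau> = 0 \<and> frame2 N e s \<bullet> \<tau> = 0) \<and>
           0 \<in> cross_section N e s \<and>
           open (cross_section N e s) \<and> bounded (cross_section N e s) \<and>
           simple_path (rim N e s) \<and> valid_path (rim N e s) \<and>
           pathfinish (rim N e s) = pathstart (rim N e s) \<and>
           path_image (rim N e s) = frontier (cross_section N e s) \<and>
           area N e s > 0 \<and> perimeter N e s > 0) \<and>
        C1_on_interval (area N e) 0 (edge_len N e) \<and>
        closure (cylinder N e) \<subseteq> \<Omega>) \<and>
     (\<exists>a0>0. \<exists>a1>0. \<forall>e\<in>arcs (net N). \<forall>s\<in>{0..edge_len N e}.
        a0 \<le> area N e s + perimeter N e s \<and> area N e s + perimeter N e s \<le> a1)"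


section \<open>The discretisation\<close>

text \<open>
  \<open>side1 D F\<close> and \<open>side2 D F\<close> are the elements on the two sides of the face \<open>F\<close>; for a boundary
  face only \<open>side1 D F\<close> is used.
\<close>

record 'e discretization =
  tets :: "(real^3) set set"
  side1 :: "(real^3) set \<Rightarrow> (real^3) set"
  side2 :: "(real^3) set \<Rightarrow> (real^3) set"
  deg3 :: nat
  cells :: "'e \<Rightarrow> nat"
  deg1 :: "'e \<Rightarrow> nat"

definition faces :: "'e discretization \<Rightarrow> (real^3) set set" where
  "faces D = {F. \<exists>K\<in>tets D. F facet_of K}"

definition interior_face :: "'e discretization \<Rightarrow> (real^3) set \<Rightarrow> bool" where
  "interior_face D F \<longleftrightarrow> (\<exists>K\<in>tets D. \<exists>K'\<in>tets D. K \<noteq> K' \<and> F facet_of K \<and> F facet_of K')"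

text \<open>
  \<open>\<Omega> = interior (\<Union>(tets D))\<close> says that the closed tetrahedra tile the closure of \<open>\<Omega>\<close> and that
  \<open>\<Omega>\<close> has no slits, so that a face of the mesh lies on the boundary of \<open>\<Omega>\<close> exactly if it
  belongs to a single element.
\<close>

definition tetrahedral_mesh :: "(real^3) set \<Rightarrow> 'e network \<Rightarrow> 'e discretization \<Rightarrow> bool" where
  "tetrahedral_mesh \<Omega> N D \<longleftrightarrow>
     triangulation (tets D) \<and> (\<forall>K\<in>tets D. 3 simplex K) \<and> \<Omega> = interior (\<Union>(tets D)) \<and>
     (\<forall>F\<in>faces D. side1 D F \<in> tets D \<and> F facet_of side1 D F) \<and>
     (\<forall>F. interior_face D F \<longrightarrow>
        side2 D F \<in> tets D \<and> F facet_of side2 D F \<and> side2 D F \<noteq> side1 D F) \<and>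
     (\<forall>e\<in>arcs (net N). \<forall>K\<in>tets D. K \<inter> cylinder N e \<noteq> {} \<longrightarrow>
        two_dim_null (frontier K \<inter> frontier (cylinder N e)))"

subsection \<open>Discontinuous piecewise polynomials on the tetrahedra\<close>

definition poly_functions :: "nat \<Rightarrow> (real^3 \<Rightarrow> real) set" where
  "poly_functions k = {p. \<exists>c :: nat^3 \<Rightarrow> real.
     p = (\<lambda>x. \<Sum>\<alpha> | (\<Sum>i\<in>UNIV. \<alpha>$i) \<le> k. c \<alpha> * (\<Prod>i\<in>UNIV. (x$i) ^ (\<alpha>$i)))}"

text \<open>
  An element of \<open>L\<^sup>2(\<Omega>)\<close> is represented by the function that is a polynomial on the interior of every
  tetrahedron and \<open>0\<close> on the null set of all remaining points of \<open>\<Omega>\<close> (and outside \<open>\<Omega>\<close>). Hence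
  equality of functions is equality in \<open>L\<^sup>2(\<Omega>)\<close>. Averages over the rims do not
  depend on the choice of the values on the boundaries of the tetrahedra, for almost every \<open>s\<close>,
  since these boundaries meet the boundaries of the cylinders in null sets.
\<close>

definition V3 :: "'e discretization \<Rightarrow> (real^3 \<Rightarrow> real) set" where
  "V3 D = {v. (\<forall>K\<in>tets D. \<exists>p\<in>poly_functions (deg3 D). \<forall>x\<in>interior K. v x = p x) \<and>
              (\<forall>x. x \<notin> (\<Union>K\<in>tets D. interior K) \<longrightarrow> v x = 0)}"

definition grad :: "(real^3 \<Rightarrow> real) \<Rightarrow> real^3 \<Rightarrow> real^3" where
  "grad u x = (THE g. GDERIV u x :> g)"

definition trace_from :: "(real^3) set \<Rightarrow> (real^3 \<Rightarrow> 'a::t2_space) \<Rightarrow> real^3 \<Rightarrow> 'a" where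
  "trace_from K g x = Lim (at x within interior K) g"

definition face_jump :: "'e discretization \<Rightarrow> (real^3) set \<Rightarrow> (real^3 \<Rightarrow> real) \<Rightarrow> real^3 \<Rightarrow> real" where
  "face_jump D F v x =
     (if interior_face D F then trace_from (side1 D F) v x - trace_from (side2 D F) v x
      else trace_from (side1 D F) v x)"

definition face_mean ::
    "'e discretization \<Rightarrow> (real^3) set \<Rightarrow> (real^3 \<Rightarrow> real^3) \<Rightarrow> real^3 \<Rightarrow> real^3" where
  "face_mean D F g x =
     (if interior_face D F
      then (1/2) *\<^sub>R (trace_from (side1 D F) g x + trace_from (side2 D F) g x)
      else trace_from (side1 D F) g x)"

text \<open>
  The condition forces \<open>n\<close> to be orthogonal to \<open>F\<close> (take \<open>x\<close> and \<open>y\<close> in \<open>F\<close>) and to point out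
  of \<open>side1 D F\<close>, thus into \<open>side2 D F\<close> or out of \<open>\<Omega>\<close>.
\<close>

definition face_normal :: "'e discretization \<Rightarrow> (real^3) set \<Rightarrow> real^3" where
  "face_normal D F =
     (THE n. norm n = 1 \<and> (\<forall>x\<in>F. \<forall>y\<in>side1 D F. n \<bullet> (y - x) \<le> 0))"

text \<open>
  Surface integral over a triangle, by the affine parametrisation over the unit triangle of the
  plane. The value does not depend on the order in which the vertices are chosen.
\<close>

definition face_integral :: "(real^3) set \<Rightarrow> (real^3 \<Rightarrow> real) \<Rightarrow> real" where
  "face_integral F g =
     (case (SOME (a, b, c). \<not> collinear {a, b, c} \<and> F = convex hull {a, b, c}) of (a, b, c) \<Rightarrow>
        norm (cross3 (b - a) (c - a)) *
        (LINT z|lebesgue_on {z :: real^2. 0 \<le> z$1 \<and> 0 \<le> z$2 \<and> z$1 + z$2 \<le> 1}.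
           g (a + z$1 *\<^sub>R (b - a) + z$2 *\<^sub>R (c - a))))"

definition face_area :: "(real^3) set \<Rightarrow> real" where
  "face_area F = face_integral F (\<lambda>x. 1)"

definition a_form ::
    "'e discretization \<Rightarrow> real \<Rightarrow> real \<Rightarrow> (real^3 \<Rightarrow> real) \<Rightarrow> (real^3 \<Rightarrow> real) \<Rightarrow> real" where
  "a_form D \<epsilon>1 \<sigma>\<Omega> u v =
     (\<Sum>K\<in>tets D. LINT x|lebesgue_on K. grad u x \<bullet> grad v x)
     - (\<Sum>F\<in>faces D. face_integral F
          (\<lambda>x. (face_mean D F (grad u) x \<bullet> face_normal D F) * face_jump D F v x))
     + \<epsilon>1 * (\<Sum>F\<in>faces D. face_integral F
          (\<lambda>x. (face_mean D F (grad v) x \<bullet> face_normal D F) * face_jump D F u x))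
     + (\<Sum>F\<in>faces D. \<sigma>\<Omega> / sqrt (face_area F) *
          face_integral F (\<lambda>x. face_jump D F u x * face_jump D F v x))"

subsection \<open>Discontinuous piecewise polynomials on the network\<close>

definition cell_size :: "'e network \<Rightarrow> 'e discretization \<Rightarrow> 'e \<Rightarrow> real" where
  "cell_size N D e = edge_len N e / real (cells D e)"

definition node :: "'e network \<Rightarrow> 'e discretization \<Rightarrow> 'e \<Rightarrow> nat \<Rightarrow> real" where
  "node N D e i = real i * cell_size N D e"

text \<open>As for \<open>V3\<close>, the immaterial values at the nodes and outside the edge are set to \<open>0\<close>.\<close>

definition V1 :: "'e network \<Rightarrow> 'e discretization \<Rightarrow> 'e \<Rightarrow> (real \<Rightarrow> real) set" where
  "V1 N D e = {v.
     (\<forall>i\<in>{1..cells D e}. \<exists>p :: real poly. degree p \<le> deg1 D e \<and>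
        (\<forall>s\<in>{node N D e (i-1)<..<node N D e i}. v s = poly p s)) \<and>
     (\<forall>s. s \<notin> (\<Union>i\<in>{1..cells D e}. {node N D e (i-1)<..<node N D e i}) \<longrightarrow> v s = 0)}"

definition VG :: "'e network \<Rightarrow> 'e discretization \<Rightarrow> ('e \<Rightarrow> real \<Rightarrow> real) set" where
  "VG N D = (\<Pi>\<^sub>E e\<in>arcs (net N). V1 N D e)"

definition VB :: "'e network \<Rightarrow> (real^3 \<Rightarrow> real) set" where
  "VB N = {w \<in> extensional (bifurcations N). (\<lambda>v. (w v)\<^sup>2) summable_on bifurcations N}"

definition node_jump :: "(real \<Rightarrow> real) \<Rightarrow> real \<Rightarrow> real" where
  "node_jump g s = Lim (at_left s) g - Lim (at_right s) g"

definition node_mean :: "(real \<Rightarrow> real) \<Rightarrow> real \<Rightarrow> real" where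
  "node_mean g s = (Lim (at_left s) g + Lim (at_right s) g) / 2"

definition flux :: "'e network \<Rightarrow> 'e \<Rightarrow> (real \<Rightarrow> real) \<Rightarrow> real \<Rightarrow> real" where
  "flux N e g s = area N e s * deriv g s"

text \<open>Meaningful only if \<open>v\<close> is an end point of \<open>e\<close>.\<close>

definition at_vertex :: "'e network \<Rightarrow> 'e \<Rightarrow> real^3 \<Rightarrow> (real \<Rightarrow> real) \<Rightarrow> real" where
  "at_vertex N e v g =
     (if v = tail (net N) e then Lim (at_right 0) g else Lim (at_left (edge_len N e)) g)"

definition ae_form ::
    "'e network \<Rightarrow> 'e discretization \<Rightarrow> real \<Rightarrow> ('e \<Rightarrow> real) \<Rightarrow> 'e \<Rightarrow> (real \<Rightarrow> real) \<Rightarrow> (real \<Rightarrow> real) \<Rightarrow> real"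
  where
  "ae_form N D \<epsilon>2 \<sigma>E e u v =
     (\<Sum>i=1..cells D e. LINT s|lebesgue_on {node N D e (i-1)..node N D e i}.
        area N e s * deriv u s * deriv v s)
     - (\<Sum>i=1..cells D e - 1.
          node_mean (flux N e u) (node N D e i) * node_jump v (node N D e i))
     + \<epsilon>2 * (\<Sum>i=1..cells D e - 1.
          node_mean (flux N e v) (node N D e i) * node_jump u (node N D e i))
     + (\<Sum>i=1..cells D e - 1. \<sigma>E e / cell_size N D e *
          node_jump u (node N D e i) * node_jump v (node N D e i))"

definition be_form :: "'e network \<Rightarrow> ('e \<Rightarrow> real) \<Rightarrow> 'e \<Rightarrow> (real \<Rightarrow> real) \<Rightarrow> (real \<Rightarrow> real) \<Rightarrow> real" where
  "be_form N \<xi> e v w = weighted_inner {0..edge_len N e} (perimeter N e) (\<lambda>s. \<xi> e * v s) w"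

text \<open>The arguments in three dimensions do not enter this form and are left out.\<close>

definition bv_form ::
    "'e network \<Rightarrow> (real^3 \<Rightarrow> real) \<Rightarrow> real^3 \<Rightarrow>
     ('e \<Rightarrow> real \<Rightarrow> real) \<Rightarrow> (real^3 \<Rightarrow> real) \<Rightarrow> ('e \<Rightarrow> real \<Rightarrow> real) \<Rightarrow> (real^3 \<Rightarrow> real) \<Rightarrow> real"
  where
  "bv_form N \<sigma>V v uh ut wh wt =
     (\<Sum>e\<in>edges_at N v.
        at_vertex N e v (flux N e (uh e)) * edge_sign N e v * (at_vertex N e v (wh e) - wt v))
     + (\<Sum>e\<in>edges_at N v.
        at_vertex N e v (flux N e (wh e)) * edge_sign N e v * (at_vertex N e v (uh e) - ut v))
     + (\<Sum>e\<in>edges_at N v. \<sigma>V v / edge_len N e *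
          (at_vertex N e v (uh e) - ut v) * (at_vertex N e v (wh e) - wt v))"

end

theory Submission
  imports Defs "HOL-Library.Function_Algebras"
begin

text \<open>
  The scheme is a linear system on a finite-dimensional space, so existence and uniqueness both
  follow once the bilinear form of the system is positive definite
  (\<open>positive_definite_unique_solution\<close>). Adding the two equations, with independent test functions,
  gives one form \<open>total_form\<close>. On the diagonal it is the sum of three parts.

  \<^item> The form on the tetrahedra. If \<open>\<epsilon>1 = 1\<close>, its consistency terms cancel. Otherwise they are
    absorbed by the Dirichlet form and the penalty, since the normal fluxes through the faces are
    bounded by the Dirichlet form (\<open>flux_form_dominated\<close>). So this part is nonnegative, and if it is
    \<open>0\<close>, then \<open>u\<close> is constant on each tetrahedron, without jumps inside the domain and with
    zero trace on its boundary. Such a function is \<open>0\<close> (\<open>cell_values_vanish\<close>): a generic segment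
    that leaves the set where the value is some \<open>c \<noteq> 0\<close> would have to do so through the relative
    interior of a face, but the value beyond that face is again \<open>c\<close>.

  \<^item> The exchange term: the sum over the edges of \<open>\<xi> e\<close> times the squared norm of the difference
    between the average of \<open>u\<close> over the rim and the network function.

  \<^item> The form on the edges and bifurcations. It is nonnegative for large penalties by the same
    absorption argument (\<open>network_forms_nonneg\<close>), but it does not control constants.

  If the sum is \<open>0\<close>, the first part gives \<open>u = 0\<close>, the second then gives that the network function
  is \<open>0\<close>, and the penalty at the bifurcations gives that the bifurcation unknowns are \<open>0\<close>
  (\<open>total_form_definite\<close>).

  The lower bound \<open>\<sigma>0\<close> for the penalties has to depend only on the geometry, the meshes and the
  degrees. Instead of inverse inequalities with explicit constants, it is obtained from the fact
  that on a finite-dimensional space one semidefinite quadratic form bounds another as soon as its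
  kernel is contained in the kernel of the other (\<open>psd_form_dominated\<close>).

  The remaining work is to show that the terms are linear at all: the traces and one-sided limits
  exist, and the integrands are integrable. The delicate case is the average over the rim as
  a function of the arc length, where the perimeter and the average have to be measurable although the
  rims are piecewise smooth only individually (\<open>rim_integral_measurable\<close>).
\<close>

section \<open>Forms on finite-dimensional spaces of functions\<close>

text \<open>
  The discrete functions are elements of function types, so these types are made real vector spaces
  with the pointwise operations; spans and subspaces are then those of the library.
\<close>

instantiation "fun" :: (type, real_vector) real_vector
begin

definition scaleR_fun :: "real \<Rightarrow> ('a \<Rightarrow> 'b) \<Rightarrow> 'a \<Rightarrow> 'b"
  where "scaleR_fun c f = (\<lambda>x. c *\<^sub>R f x)"

instance
  by standard (auto simp: scaleR_fun_def fun_eq_iff scaleR_add_right scaleR_add_left)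

end

lemma scaleR_fun_apply [simp]: "(c *\<^sub>R f) x = c *\<^sub>R f x"
  by (simp add: scaleR_fun_def)

text \<open>
  The forms of the problem are linear only on the discrete spaces: outside them, the integrals and
  one-sided limits need not exist. Hence linearity is relative to a set.
\<close>

definition linear_form_on :: "'a::real_vector set \<Rightarrow> ('a \<Rightarrow> real) \<Rightarrow> bool" where
  "linear_form_on S l \<longleftrightarrow> (\<forall>x\<in>S. \<forall>y\<in>S. \<forall>c. l (x + c *\<^sub>R y) = l x + c * l y)"

definition bilinear_form_on :: "'a::real_vector set \<Rightarrow> ('a \<Rightarrow> 'a \<Rightarrow> real) \<Rightarrow> bool" where
  "bilinear_form_on S B \<longleftrightarrow>
     (\<forall>y\<in>S. linear_form_on S (\<lambda>x. B x y)) \<and> (\<forall>x\<in>S. linear_form_on S (B x))"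

definition psd_form_on :: "'a::real_vector set \<Rightarrow> ('a \<Rightarrow> 'a \<Rightarrow> real) \<Rightarrow> bool" where
  "psd_form_on S B \<longleftrightarrow>
     bilinear_form_on S B \<and> (\<forall>x\<in>S. \<forall>y\<in>S. B x y = B y x) \<and> (\<forall>x\<in>S. 0 \<le> B x x)"

lemma linear_form_onD:
  "linear_form_on S l \<Longrightarrow> x \<in> S \<Longrightarrow> y \<in> S \<Longrightarrow> l (x + c *\<^sub>R y) = l x + c * l y"
  by (simp add: linear_form_on_def)

lemma linear_form_on_subset: "linear_form_on S l \<Longrightarrow> T \<subseteq> S \<Longrightarrow> linear_form_on T l"
  by (auto simp: linear_form_on_def)

lemma bilinear_form_onD:
  assumes "bilinear_form_on S B" "x \<in> S" "y \<in> S" "z \<in> S"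
  shows "B (x + c *\<^sub>R y) z = B x z + c * B y z"
    and "B z (x + c *\<^sub>R y) = B z x + c * B z y"
  using assms by (auto simp: bilinear_form_on_def linear_form_on_def)

lemma bilinear_form_onI:
  assumes "\<And>x y z c. x \<in> S \<Longrightarrow> y \<in> S \<Longrightarrow> z \<in> S \<Longrightarrow> B (x + c *\<^sub>R y) z = B x z + c * B y z"
    and "\<And>x y z c. x \<in> S \<Longrightarrow> y \<in> S \<Longrightarrow> z \<in> S \<Longrightarrow> B z (x + c *\<^sub>R y) = B z x + c * B z y"
  shows "bilinear_form_on S B"
  using assms by (auto simp: bilinear_form_on_def linear_form_on_def)

lemma bilinear_form_on_subset: "bilinear_form_on S B \<Longrightarrow> T \<subseteq> S \<Longrightarrow> bilinear_form_on T B"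
  unfolding bilinear_form_on_def by (meson linear_form_on_subset subsetD)

lemma linear_form_on_zero:
  assumes "linear_form_on S l" "subspace S"
  shows "l 0 = 0"
  using linear_form_onD[OF assms(1), of 0 0 1] subspace_0[OF assms(2)] by simp

lemma linear_form_on_sum:
  assumes "\<And>i. i \<in> I \<Longrightarrow> linear_form_on S (l i)"
  shows "linear_form_on S (\<lambda>x. \<Sum>i\<in>I. l i x)"
  using assms by (simp add: linear_form_on_def sum.distrib sum_distrib_left)

lemma linear_form_on_add:
  "linear_form_on S l \<Longrightarrow> linear_form_on S m \<Longrightarrow> linear_form_on S (\<lambda>x. l x + m x)"
  by (simp add: linear_form_on_def algebra_simps)

lemma linear_form_on_diff:
  "linear_form_on S l \<Longrightarrow> linear_form_on S m \<Longrightarrow> linear_form_on S (\<lambda>x. l x - m x)"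
  by (simp add: linear_form_on_def algebra_simps)

lemma linear_form_on_cmult:
  "linear_form_on S l \<Longrightarrow> linear_form_on S (\<lambda>x. c * l x)"
  by (simp add: linear_form_on_def algebra_simps)

lemma bilinear_form_on_sum:
  assumes "\<And>i. i \<in> I \<Longrightarrow> bilinear_form_on S (B i)"
  shows "bilinear_form_on S (\<lambda>x y. \<Sum>i\<in>I. B i x y)"
  using assms by (simp add: bilinear_form_on_def linear_form_on_sum)

lemma bilinear_form_on_add:
  "bilinear_form_on S A \<Longrightarrow> bilinear_form_on S B \<Longrightarrow> bilinear_form_on S (\<lambda>x y. A x y + B x y)"
  by (simp add: bilinear_form_on_def linear_form_on_add)

lemma bilinear_form_on_diff:
  "bilinear_form_on S A \<Longrightarrow> bilinear_form_on S B \<Longrightarrow> bilinear_form_on S (\<lambda>x y. A x y - B x y)"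
  by (simp add: bilinear_form_on_def linear_form_on_diff)

lemma bilinear_form_on_cmult:
  "bilinear_form_on S A \<Longrightarrow> bilinear_form_on S (\<lambda>x y. c * A x y)"
  by (simp add: bilinear_form_on_def linear_form_on_cmult)

lemma bilinear_form_on_swap:
  "bilinear_form_on S A \<Longrightarrow> bilinear_form_on S (\<lambda>x y. A y x)"
  by (simp add: bilinear_form_on_def)

lemma bilinear_form_on_mult:
  "linear_form_on S l \<Longrightarrow> linear_form_on S m \<Longrightarrow> bilinear_form_on S (\<lambda>x y. l x * m y)"
  by (simp add: bilinear_form_on_def linear_form_on_def algebra_simps)

text \<open>
  Gaussian elimination, by induction on the spanning set. If \<open>c\<close> in the smaller span represents
  \<open>B b\<close> there, then \<open>b' = b - c\<close> is annihilated by all old test vectors, so a solution on the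
  smaller span is corrected by the right multiple of \<open>b'\<close> without disturbing the old equations. The
  last two hypotheses are what is needed when \<open>B b' b' = 0\<close>. They hold for positive definite
  forms, symmetric or not, and for symmetric semidefinite forms, which are the two uses below.
\<close>

lemma solvable_on_span:
  assumes "finite A" "bilinear_form_on (span A) B" "linear_form_on (span A) l"
    and "\<And>w. w \<in> span A \<Longrightarrow> 0 \<le> B w w"
    and "\<And>v w. v \<in> span A \<Longrightarrow> w \<in> span A \<Longrightarrow> B w w = 0 \<Longrightarrow> B v w = 0"
    and "\<And>w. w \<in> span A \<Longrightarrow> B w w = 0 \<Longrightarrow> l w = 0"
  shows "\<exists>u\<in>span A. \<forall>w\<in>span A. B u w = l w"
  using assms
proof (induction A arbitrary: l rule: finite_induct)
  case empty
  have "B 0 0 = 0" "l 0 = 0"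
    using bilinear_form_onD(1)[OF empty(1), of 0 0 0 1] linear_form_onD[OF empty(2), of 0 0 1]
    by simp_all
  then show ?case by simp
next
  case (insert b A)
  let ?S = "span A" and ?T = "span (insert b A)"
  have sub: "?S \<subseteq> ?T" by (simp add: span_mono subset_insertI)
  have b: "b \<in> ?T" by (simp add: span_base)
  have IH: "\<exists>u\<in>?S. \<forall>w\<in>?S. B u w = m w"
    if "linear_form_on ?S m" "\<And>w. w \<in> ?S \<Longrightarrow> B w w = 0 \<Longrightarrow> m w = 0" for m
    using insert.IH[OF bilinear_form_on_subset[OF insert.prems(1) sub] that(1)] insert.prems(3,4)
      that(2) sub by blast
  have "linear_form_on ?S (B b)"
    using insert.prems(1) b linear_form_on_subset[OF _ sub] by (simp add: bilinear_form_on_def)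
  then obtain c where c: "c \<in> ?S" "\<And>w. w \<in> ?S \<Longrightarrow> B c w = B b w"
    using IH[of "B b"] insert.prems(4) b sub by blast
  define b' where "b' = b + (-1) *\<^sub>R c"
  have b': "b' \<in> ?T" unfolding b'_def using b c sub by (meson span_add span_scale subsetD)
  have orth: "B b' w = 0" if "w \<in> ?S" for w
    unfolding b'_def using bilinear_form_onD(1)[OF insert.prems(1) b, of c w "-1"] c that sub by auto
  have dec: "\<exists>s\<in>?S. \<exists>t. w = s + t *\<^sub>R b'" if "w \<in> ?T" for w
  proof -
    obtain k where "w - k *\<^sub>R b \<in> ?S" using \<open>w \<in> ?T\<close> span_breakdown_eq[of w b A] by blast
    then have "w - k *\<^sub>R b + k *\<^sub>R c \<in> ?S" using c by (meson span_add span_scale)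
    moreover have "w = (w - k *\<^sub>R b + k *\<^sub>R c) + k *\<^sub>R b'"
      by (simp add: b'_def algebra_simps)
    ultimately show ?thesis by blast
  qed
  obtain u where u: "u \<in> ?S" "\<And>w. w \<in> ?S \<Longrightarrow> B u w = l w"
    using IH[of l] linear_form_on_subset[OF insert.prems(2) sub] insert.prems(5) sub by blast
  have solve: ?case if "v \<in> ?T" "\<And>w. w \<in> ?S \<Longrightarrow> B v w = l w" "B v b' = l b'" for v
  proof (intro bexI[of _ v] ballI)
    fix w assume "w \<in> ?T"
    then obtain s t where st: "s \<in> ?S" "w = s + t *\<^sub>R b'" using dec by blast
    have sT: "s \<in> ?T" using st(1) sub by blast
    show "B v w = l w"
      unfolding st(2) bilinear_form_onD(2)[OF insert.prems(1) sT b' that(1)]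
        linear_form_onD[OF insert.prems(2) sT b'] using that(2)[OF st(1)] that(3) by simp
  qed (fact that)
  show ?case
  proof (cases "B b' b' = 0")
    case True
    have uT: "u \<in> ?T" using u(1) sub by blast
    have "B u b' = l b'"
      using insert.prems(4)[OF uT b' True] insert.prems(5)[OF b' True] by simp
    then show ?thesis using solve[OF uT u(2)] by blast
  next
    case False
    define t where "t = (l b' - B u b') / B b' b'"
    have e: "B (u + t *\<^sub>R b') w = B u w + t * B b' w" if "w \<in> ?T" for w
      using bilinear_form_onD(1)[OF insert.prems(1), of u b' w t] u sub b' that by auto
    show ?thesis
    proof (rule solve[of "u + t *\<^sub>R b'"])
      show "u + t *\<^sub>R b' \<in> ?T" using u sub b' by (meson span_add span_scale subsetD)
      show "B (u + t *\<^sub>R b') w = l w" if "w \<in> ?S" for w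
        using e[of w] u orth that sub by auto
      show "B (u + t *\<^sub>R b') b' = l b'" using e[OF b'] False by (simp add: t_def)
    qed
  qed
qed

definition finite_dim :: "'a::real_vector set \<Rightarrow> bool" where
  "finite_dim S \<longleftrightarrow> (\<exists>A. finite A \<and> S \<subseteq> span A)"

lemma finite_dim_basis:
  assumes "finite_dim S" "subspace S"
  obtains A where "finite A" "S = span A"
proof -
  obtain T where T: "finite T" "S \<subseteq> span T" using assms by (auto simp: finite_dim_def)
  obtain A where A: "A \<subseteq> S" "independent A" "S \<subseteq> span A"
    using maximal_independent_subset by blast
  have "finite A" using independent_span_bound[OF T(1) A(2)] A(1) T(2) by auto
  moreover have "S = span A" using A assms(2) by (simp add: span_minimal subset_antisym)
  ultimately show ?thesis using that by blast
qed

text \<open>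
  Lax-Milgram in finite dimension, for forms that may be nonsymmetric, as the one of the scheme is
  unless \<open>\<epsilon>1 = \<epsilon>2 = -1\<close>.
\<close>

lemma positive_definite_unique_solution:
  assumes S: "finite_dim S" "subspace S"
    and B: "bilinear_form_on S B" and l: "linear_form_on S l"
    and pos: "\<And>w. w \<in> S \<Longrightarrow> 0 \<le> B w w"
    and def: "\<And>w. w \<in> S \<Longrightarrow> B w w = 0 \<Longrightarrow> w = 0"
  shows "\<exists>!u. u \<in> S \<and> (\<forall>w\<in>S. B u w = l w)"
proof -
  obtain A where A: "finite A" "S = span A" using finite_dim_basis[OF S] .
  have z: "B v 0 = 0" if "v \<in> S" for v
    using linear_form_on_zero[OF _ S(2)] B that by (simp add: bilinear_form_on_def)
  have "\<exists>u\<in>S. \<forall>w\<in>S. B u w = l w"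
    using solvable_on_span[OF A(1), folded A(2), OF B l pos]
      def z linear_form_on_zero[OF l S(2)] by metis
  moreover have "u = v"
    if "u \<in> S" "\<forall>w\<in>S. B u w = l w" "v \<in> S" "\<forall>w\<in>S. B v w = l w" for u v
  proof -
    have d: "u + (-1) *\<^sub>R v \<in> S" using that S(2) by (meson subspace_add subspace_scale)
    have "B (u + (-1) *\<^sub>R v) (u + (-1) *\<^sub>R v) = 0"
      using bilinear_form_onD(1)[OF B that(1,3) d, of "-1"] that(2,4) d by simp
    then have "u + (-1) *\<^sub>R v = 0" using def d by blast
    then show ?thesis by simp
  qed
  ultimately show ?thesis by blast
qed

lemma psd_form_onI:
  assumes lin: "\<And>x y z c. x \<in> S \<Longrightarrow> y \<in> S \<Longrightarrow> z \<in> S \<Longrightarrow> B (x + c *\<^sub>R y) z = B x z + c * B y z"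
    and sym: "\<And>x y. B x y = B y x" and "\<And>x. x \<in> S \<Longrightarrow> 0 \<le> B x x"
  shows "psd_form_on S B"
proof -
  have "B z (x + c *\<^sub>R y) = B z x + c * B z y" if "x \<in> S" "y \<in> S" "z \<in> S" for x y z c
    using lin[OF that] by (simp add: sym)
  then have "bilinear_form_on S B" using lin by (intro bilinear_form_onI)
  then show ?thesis using assms by (simp add: psd_form_on_def)
qed

lemma psd_form_square:
  assumes "psd_form_on S B" "x \<in> S" "y \<in> S" "subspace S"
  shows "B (x + c *\<^sub>R y) (x + c *\<^sub>R y) = B x x + 2 * c * B x y + c\<^sup>2 * B y y"
proof -
  have B: "bilinear_form_on S B" using assms(1) by (simp add: psd_form_on_def)
  have "x + c *\<^sub>R y \<in> S" using assms by (meson subspace_add subspace_scale)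
  moreover have "B y x = B x y" using assms by (simp add: psd_form_on_def)
  ultimately show ?thesis
    using bilinear_form_onD(1)[OF B assms(2,3), of "x + c *\<^sub>R y" c]
      bilinear_form_onD(2)[OF B assms(2,3) assms(2), of c]
      bilinear_form_onD(2)[OF B assms(2,3) assms(3), of c]
    by (simp add: algebra_simps power2_eq_square)
qed

text \<open>
  The Cauchy-Schwarz inequality in its degenerate case.
\<close>

lemma psd_form_kernel:
  assumes B: "psd_form_on S B" and S: "subspace S" and v: "v \<in> S" and w: "w \<in> S" "B w w = 0"
  shows "B v w = 0"
proof (rule ccontr)
  assume ne: "B v w \<noteq> 0"
  \<comment> \<open>the parameter at which the affine function \<open>t \<mapsto> B (v + t w) (v + t w)\<close> equals \<open>-1\<close>\<close>
  define t where "t = - (B v v + 1) / (2 * B v w)"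
  have "v + t *\<^sub>R w \<in> S" using S v w by (meson subspace_add subspace_scale)
  then have "0 \<le> B (v + t *\<^sub>R w) (v + t *\<^sub>R w)" using B by (simp add: psd_form_on_def)
  also have "\<dots> = B v v + 2 * t * B v w" using psd_form_square[OF B v w(1) S] w by simp
  also have "\<dots> = -1" using ne by (simp add: t_def field_simps)
  finally show False by simp
qed

text \<open>
  An inverse inequality without scaling arguments: on a finite-dimensional space a semidefinite
  form is bounded by every other one whose kernel it respects. The basis is made \<open>Q\<close>-orthogonal one
  vector at a time, so that \<open>Q\<close> of a sum splits, while \<open>T\<close> of a sum is at most twice the sum of the
  \<open>T\<close>-values.
\<close>

lemma psd_form_dominated:
  assumes S: "finite_dim S" "subspace S"
    and Q: "psd_form_on S Q" and T: "psd_form_on S T"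
    and ker: "\<And>u. u \<in> S \<Longrightarrow> Q u u = 0 \<Longrightarrow> T u u = 0"
  shows "\<exists>C>0. \<forall>u\<in>S. T u u \<le> C * Q u u"
proof -
  obtain A where A: "finite A" "S = span A" using finite_dim_basis[OF S] .
  have "\<exists>C>0. \<forall>u\<in>span A'. T u u \<le> C * Q u u" if "finite A'" "A' \<subseteq> S" for A'
    using that
  proof (induction A' rule: finite_induct)
    case empty
    have "T 0 0 = 0"
      using linear_form_on_zero[OF _ S(2), of "T 0"] T subspace_0[OF S(2)]
      by (simp add: bilinear_form_on_def psd_form_on_def)
    moreover have "0 \<le> Q 0 0" using Q subspace_0[OF S(2)] by (simp add: psd_form_on_def)
    ultimately show ?case by (intro exI[of _ 1]) simp
  next
    case (insert b A')
    have sub: "span A' \<subseteq> S" "b \<in> S" using insert S(2) by (simp_all add: span_minimal)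
    obtain C where C: "C > 0" "\<And>u. u \<in> span A' \<Longrightarrow> T u u \<le> C * Q u u"
      using insert.IH insert.prems by blast
    have Qb: "bilinear_form_on S Q" using Q by (simp add: psd_form_on_def)
    have "\<exists>c\<in>span A'. \<forall>w\<in>span A'. Q c w = Q b w"
    proof (rule solvable_on_span[OF insert(1)])
      show "linear_form_on (span A') (Q b)"
        using Qb sub linear_form_on_subset[of S "Q b" "span A'"] by (simp add: bilinear_form_on_def)
      show "bilinear_form_on (span A') Q" by (rule bilinear_form_on_subset[OF Qb sub(1)])
      show "0 \<le> Q w w" if "w \<in> span A'" for w
        using that sub(1) Q by (auto simp: psd_form_on_def)
      show "Q v w = 0" if "v \<in> span A'" "w \<in> span A'" "Q w w = 0" for v w
        using psd_form_kernel[OF Q S(2)] that sub(1) by blast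
      show "Q b w = 0" if "w \<in> span A'" "Q w w = 0" for w
        using psd_form_kernel[OF Q S(2) sub(2)] that sub(1) by blast
    qed
    then obtain c where c: "c \<in> span A'" "\<And>w. w \<in> span A' \<Longrightarrow> Q c w = Q b w" by blast
    define b' where "b' = b + (-1) *\<^sub>R c"
    have b': "b' \<in> S" unfolding b'_def using sub c S(2) by (meson subspace_add subspace_scale subsetD)
    have orth: "Q s b' = 0" if "s \<in> span A'" for s
    proof -
      have "Q b' s = 0"
        unfolding b'_def using bilinear_form_onD(1)[OF Qb sub(2), of c s "-1"] c that sub by auto
      then show ?thesis using Q b' sub that by (auto simp: psd_form_on_def)
    qed
    \<comment> \<open>the second constant covers the new direction; if \<open>Q b' b' = 0\<close>, that direction is free\<close>
    define C' where "C' = (if Q b' b' = 0 then 2 * C else max (2 * C) (2 * T b' b' / Q b' b'))"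
    have C': "2 * C \<le> C'" "2 * T b' b' \<le> C' * Q b' b'"
    proof -
      show "2 * C \<le> C'" by (simp add: C'_def)
      have "0 \<le> Q b' b'" using Q b' by (simp add: psd_form_on_def)
      then show "2 * T b' b' \<le> C' * Q b' b'"
      proof (cases "Q b' b' = 0")
        case False
        with \<open>0 \<le> Q b' b'\<close> have "2 * T b' b' / Q b' b' * Q b' b' \<le> C' * Q b' b'"
          unfolding C'_def by (intro mult_right_mono) auto
        with False show ?thesis by simp
      qed (use ker[OF b'] in simp)
    qed
    have "T u u \<le> C' * Q u u" if u: "u \<in> span (insert b A')" for u
    proof -
      obtain k where "u - k *\<^sub>R b \<in> span A'" using u span_breakdown_eq[of u b A'] by blast
      then have s: "u - k *\<^sub>R b + k *\<^sub>R c \<in> span A'" using c by (meson span_add span_scale)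
      define s where "s = u - k *\<^sub>R b + k *\<^sub>R c"
      have u_eq: "u = s + k *\<^sub>R b'" by (simp add: b'_def s_def algebra_simps)
      have sS: "s \<in> span A'" "s \<in> S" using s sub by (auto simp: s_def)
      have "s + (-k) *\<^sub>R b' \<in> S" using sS b' S(2) by (meson subspace_add subspace_scale)
      then have "0 \<le> T (s + (-k) *\<^sub>R b') (s + (-k) *\<^sub>R b')" using T by (simp add: psd_form_on_def)
      then have "T u u \<le> 2 * T s s + k\<^sup>2 * (2 * T b' b')"
        unfolding u_eq psd_form_square[OF T sS(2) b' S(2)] by (simp add: algebra_simps)
      also have "\<dots> \<le> 2 * (C * Q s s) + k\<^sup>2 * (C' * Q b' b')"
        using C(2)[OF sS(1)] C' by (intro add_mono mult_left_mono) auto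
      also have "\<dots> \<le> C' * Q s s + k\<^sup>2 * (C' * Q b' b')"
        using mult_right_mono[OF C'(1), of "Q s s"] Q sS by (simp add: psd_form_on_def)
      also have "\<dots> = C' * Q u u"
        unfolding u_eq psd_form_square[OF Q sS(2) b' S(2)] using orth[OF sS(1)]
        by (simp add: algebra_simps)
      finally show ?thesis .
    qed
    moreover have "C' > 0" using C C' by linarith
    ultimately show ?case by blast
  qed
  from this[OF A(1)] show ?thesis using A(2) span_superset[of A] by simp
qed

lemma finite_dim_Times:
  assumes "finite_dim S" "finite_dim T"
  shows "finite_dim (S \<times> T)"
proof -
  obtain A B where A: "finite A" "S \<subseteq> span A" and B: "finite B" "T \<subseteq> span B"
    using assms by (auto simp: finite_dim_def)
  let ?f = "\<lambda>x. (x, 0)" and ?g = "\<lambda>y. (0, y)"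
  have f: "span (?f ` A) = ?f ` span A"
    by (rule linear_span_image) (auto intro!: linearI)
  have g: "span (?g ` B) = ?g ` span B"
    by (rule linear_span_image) (auto intro!: linearI)
  have "(x, y) \<in> span (?f ` A \<union> ?g ` B)" if "x \<in> S" "y \<in> T" for x y
  proof -
    have "(x, 0) \<in> span (?f ` A)" "(0, y) \<in> span (?g ` B)"
      unfolding f g using that A B by auto
    then have "(x, 0) \<in> span (?f ` A \<union> ?g ` B)" "(0, y) \<in> span (?f ` A \<union> ?g ` B)"
      using span_mono[of "?f ` A" "?f ` A \<union> ?g ` B"] span_mono[of "?g ` B" "?f ` A \<union> ?g ` B"]
      by blast+
    from span_add[OF this] show ?thesis by simp
  qed
  then show ?thesis
    unfolding finite_dim_def using A(1) B(1) by (intro exI[of _ "?f ` A \<union> ?g ` B"]) auto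
qed

section \<open>Meshes of polytopes\<close>

text \<open>
  Near a point \<open>z\<close> of the relative interior of a facet \<open>F\<close>, the frontier of \<open>K\<close> lies in the hyperplane
  of \<open>F\<close>, because \<open>z\<close> belongs to no other facet. An open half ball at \<open>z\<close> is connected and misses
  the frontier, so it lies in \<open>K\<close> as soon as it meets \<open>K\<close>. The hyperplane is given in advance, so
  that the sides of two polytopes sharing \<open>F\<close> can be compared.
\<close>

lemma facet_half_ball:
  fixes K :: "'a::euclidean_space set"
  assumes K: "polytope K" "interior K \<noteq> {}" and F: "F facet_of K" and z: "z \<in> rel_interior F"
    and H: "affine hull F = {x. a \<bullet> x = b}" and a: "a \<noteq> 0"
  shows "\<exists>r>0. ball z r \<inter> {x. a \<bullet> x < b} \<subseteq> interior K \<or> ball z r \<inter> {x. a \<bullet> x > b} \<subseteq> interior K"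
proof -
  have poly: "polyhedron K" using polytope_imp_polyhedron[OF K(1)] .
  have cl: "closed K" "convex K"
    using polyhedron_imp_closed[OF poly] polyhedron_imp_convex[OF poly] by simp_all
  have "z \<in> F" using z rel_interior_subset by blast
  define G where "G = \<Union>({G. G facet_of K} - {F})"
  have "finite {G. G facet_of K}" using finite_polyhedron_facets[OF poly] .
  moreover have "closed G'" if "G' facet_of K" for G'
    using face_of_imp_closed[OF cl(2,1) facet_of_imp_face_of[OF that]] .
  ultimately have "closed G" unfolding G_def by (intro closed_Union) blast+
  moreover have "z \<notin> G"
  proof
    assume "z \<in> G"
    then obtain G' where G': "G' facet_of K" "G' \<noteq> F" "z \<in> G'" by (auto simp: G_def)
    have "F \<subseteq> K" using F facet_of_imp_subset by blast
    then have "F \<subseteq> G'"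
      using subset_of_face_of[OF facet_of_imp_face_of[OF G'(1)]] G'(3) z by blast
    moreover have "F face_of G'"
      using face_of_subset[OF facet_of_imp_face_of[OF F] \<open>F \<subseteq> G'\<close>]
        facet_of_imp_subset[OF G'(1)] by simp
    ultimately have "aff_dim F < aff_dim G'"
      using face_of_aff_dim_lt[of G' F] G'(2) face_of_imp_convex[OF facet_of_imp_face_of[OF G'(1)]]
      by blast
    then show False using G'(1) F by (simp add: facet_of_def)
  qed
  ultimately obtain r where r: "r > 0" "ball z r \<subseteq> - G"
    using openE[of "- G" z] open_Compl[of G] by blast
  have fr: "frontier K = \<Union>{G. G facet_of K}"
    using rel_frontier_of_polyhedron[OF poly] K(2) by (simp add: rel_frontier_nonempty_interior)
  have frF: "frontier K \<inter> ball z r \<subseteq> {x. a \<bullet> x = b}"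
  proof
    fix x assume x: "x \<in> frontier K \<inter> ball z r"
    then have "x \<in> F" using r(2) unfolding fr G_def by auto
    then have "x \<in> affine hull F" by (rule hull_inc)
    then show "x \<in> {x. a \<bullet> x = b}" using H by simp
  qed
  have zK: "z \<in> closure (interior K)"
    using convex_closure_interior[OF cl(2) K(2)] cl \<open>z \<in> F\<close> facet_of_imp_subset[OF F] by auto
  have "z \<in> ball z r \<inter> closure (interior K)" using zK r(1) by simp
  then have "interior K \<inter> ball z r \<noteq> {}"
    using open_Int_closure_eq_empty[OF open_ball, of z r "interior K"] by blast
  moreover have "interior {x. a \<bullet> x = b} = {}" using interior_hyperplane[OF a] .
  ultimately have "\<not> interior K \<inter> ball z r \<subseteq> {x. a \<bullet> x = b}"
    using interior_maximal[of "interior K \<inter> ball z r" "{x. a \<bullet> x = b}"] by (auto simp: open_Int)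
  \<comment> \<open>interior points of \<open>K\<close> near \<open>z\<close> cannot all lie in a hyperplane; the side of \<open>q\<close> is the side of \<open>K\<close>\<close>
  then obtain q where q: "q \<in> interior K" "q \<in> ball z r" "a \<bullet> q < b \<or> a \<bullet> q > b"
    using neq_iff by blast
  have half: "S \<subseteq> interior K" if "convex S" "S \<subseteq> ball z r" "q \<in> S" "S \<inter> {x. a \<bullet> x = b} = {}" for S
  proof -
    have dis: "S \<inter> frontier K = {}" using frF that(2,4) by blast
    have "S \<inter> K \<noteq> {}" using q(1) that(3) interior_subset[of K] by blast
    then have "S - K = {}"
      using connected_Int_frontier[OF convex_connected[OF that(1)], of K] dis by blast
    then show ?thesis using dis cl(1) by (simp add: frontier_def) blast
  qed
  from q(3) show ?thesis
  proof
    assume "a \<bullet> q < b"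
    then have "ball z r \<inter> {x. a \<bullet> x < b} \<subseteq> interior K"
      using q(2) by (intro half) (auto simp: convex_Int convex_halfspace_lt)
    then show ?thesis using r by blast
  next
    assume "a \<bullet> q > b"
    then have "ball z r \<inter> {x. a \<bullet> x > b} \<subseteq> interior K"
      using q(2) by (intro half) (auto simp: convex_Int convex_halfspace_gt)
    then show ?thesis using r by blast
  qed
qed

lemma affine_hull_facet_hyperplane:
  fixes K :: "'a::euclidean_space set"
  assumes "interior K \<noteq> {}" "F facet_of K"
  obtains a b where "a \<noteq> 0" "affine hull F = {x. a \<bullet> x = b}"
proof -
  have "aff_dim F = DIM('a) - 1"
    using assms aff_dim_nonempty_interior[of K] by (simp add: facet_of_def)
  then show ?thesis using aff_dim_eq_hyperplane[of F] that by auto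
qed

text \<open>
  The common face contains a point of the relative interior of each of the two sets, and the only
  such face is the whole set.
\<close>

lemma interiors_overlap_imp_eq:
  fixes K K' :: "'a::euclidean_space set"
  assumes "convex K" "convex K'" "(K \<inter> K') face_of K" "(K \<inter> K') face_of K'"
    "interior K \<inter> interior K' \<noteq> {}"
  shows "K = K'"
proof -
  have "K \<inter> K' = L" if "L = K \<or> L = K'" for L
  proof (rule face_of_eq)
    show "(K \<inter> K') face_of L" "L face_of L" using that assms face_of_refl by auto
    have "interior K \<inter> interior K' = interior (K \<inter> K')" by simp
    then have ne: "interior (K \<inter> K') \<noteq> {}" "interior L \<noteq> {}" using that assms(5) by auto
    show "rel_interior (K \<inter> K') \<inter> rel_interior L \<noteq> {}"
      using that assms(5) ne by (auto simp: rel_interior_nonempty_interior)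
  qed
  then show ?thesis by metis
qed

locale polytopal_mesh =
  fixes T :: "'a::euclidean_space set set"
  assumes fin: "finite T"
    and polytope: "K \<in> T \<Longrightarrow> polytope K"
    and interior_ne: "K \<in> T \<Longrightarrow> interior K \<noteq> {}"
    and inter_face: "K \<in> T \<Longrightarrow> K' \<in> T \<Longrightarrow> (K \<inter> K') face_of K"
begin

lemma overlap_eq:
  assumes "K \<in> T" "K' \<in> T" "interior K \<inter> interior K' \<noteq> {}"
  shows "K = K'"
  using assms interiors_overlap_imp_eq[of K K'] inter_face[of K K'] inter_face[of K' K]
    polytope polytope_imp_convex by (auto simp: Int_commute)

lemma facet_two_sides:
  assumes K: "K \<in> T" and F: "F facet_of K" and z: "z \<in> rel_interior F"
  obtains a b where "a \<noteq> 0"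
    "\<And>L. L \<in> T \<Longrightarrow> F facet_of L \<Longrightarrow>
       \<exists>r>0. ball z r \<inter> {x. a \<bullet> x < b} \<subseteq> interior L \<or> ball z r \<inter> {x. a \<bullet> x > b} \<subseteq> interior L"
    "a \<bullet> z = b"
proof -
  obtain a b where ab: "a \<noteq> 0" "affine hull F = {x. a \<bullet> x = b}"
    using affine_hull_facet_hyperplane[OF interior_ne[OF K] F] .
  have "a \<bullet> z = b" using z ab(2) rel_interior_subset hull_subset[of F affine] by blast
  then show ?thesis
    using that[OF ab(1)] facet_half_ball[OF polytope interior_ne _ z ab(2,1)] by blast
qed

lemma half_balls_meet:
  fixes a z :: 'a
  assumes "a \<noteq> 0" "a \<bullet> z = b" "r > 0" "r' > 0"
    "ball z r \<inter> {x. a \<bullet> x < b} \<subseteq> A" "ball z r' \<inter> {x. a \<bullet> x < b} \<subseteq> A'"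
  shows "A \<inter> A' \<noteq> {}"
proof -
  define t where "t = min r r' / (2 * norm a)"
  have t: "t > 0" using assms by (simp add: t_def)
  define x where "x = z - t *\<^sub>R a"
  have "dist z x = min r r' / 2" using assms t by (simp add: x_def dist_norm t_def)
  moreover have "a \<bullet> x < b" using assms t by (simp add: x_def inner_diff_right)
  ultimately have "x \<in> ball z r \<inter> {x. a \<bullet> x < b}" "x \<in> ball z r' \<inter> {x. a \<bullet> x < b}"
    using assms by auto
  then show ?thesis using assms by blast
qed

lemma half_balls_meet':
  fixes a z :: 'a
  assumes "a \<noteq> 0" "a \<bullet> z = b" "r > 0" "r' > 0"
    "ball z r \<inter> {x. a \<bullet> x > b} \<subseteq> A" "ball z r' \<inter> {x. a \<bullet> x > b} \<subseteq> A'"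
  shows "A \<inter> A' \<noteq> {}"
  using half_balls_meet[of "-a" z "-b" r r' A A'] assms by simp

text \<open>
  Each cell at the facet contains one of the two half balls, and cells on the same side overlap.
\<close>

lemma at_most_two_cells_at_facet:
  assumes "K \<in> T" "F facet_of K" "L \<in> T" "F facet_of L" "M \<in> T" "F facet_of M" "L \<noteq> M"
  shows "K = L \<or> K = M"
proof -
  have "convex F" using assms face_of_imp_convex facet_of_imp_face_of polytope polytope_imp_convex by blast
  then obtain z where z: "z \<in> rel_interior F"
    using assms(2) rel_interior_eq_empty by (auto simp: facet_of_def)
  obtain a b where a: "a \<noteq> 0" "a \<bullet> z = b" and ab:
    "\<And>L. L \<in> T \<Longrightarrow> F facet_of L \<Longrightarrow>
       \<exists>r>0. ball z r \<inter> {x. a \<bullet> x < b} \<subseteq> interior L \<or> ball z r \<inter> {x. a \<bullet> x > b} \<subseteq> interior L"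
    using facet_two_sides[OF assms(1,2) z] by metis
  have eq1: "A = B" if "A \<in> T" "B \<in> T" "r > 0" "r' > 0"
    "ball z r \<inter> {x. a \<bullet> x < b} \<subseteq> interior A" "ball z r' \<inter> {x. a \<bullet> x < b} \<subseteq> interior B" for A B r r'
    using half_balls_meet[OF a that(3-6)] overlap_eq[OF that(1,2)] by blast
  have eq2: "A = B" if "A \<in> T" "B \<in> T" "r > 0" "r' > 0"
    "ball z r \<inter> {x. a \<bullet> x > b} \<subseteq> interior A" "ball z r' \<inter> {x. a \<bullet> x > b} \<subseteq> interior B" for A B r r'
    using half_balls_meet'[OF a that(3-6)] overlap_eq[OF that(1,2)] by blast
  from ab[OF assms(1,2)] ab[OF assms(3,4)] ab[OF assms(5,6)]
  show ?thesis using eq1 eq2 assms(1,3,5,7) by meson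
qed

lemma two_cells_cover_facet:
  assumes "L \<in> T" "F facet_of L" "M \<in> T" "F facet_of M" "L \<noteq> M" and z: "z \<in> rel_interior F"
  shows "z \<in> interior (L \<union> M)"
proof -
  obtain a b where a: "a \<noteq> 0" "a \<bullet> z = b" and ab:
    "\<And>L. L \<in> T \<Longrightarrow> F facet_of L \<Longrightarrow>
       \<exists>r>0. ball z r \<inter> {x. a \<bullet> x < b} \<subseteq> interior L \<or> ball z r \<inter> {x. a \<bullet> x > b} \<subseteq> interior L"
    using facet_two_sides[OF assms(1,2) z] by metis
  obtain r where r: "r > 0"
    "ball z r \<inter> {x. a \<bullet> x < b} \<subseteq> interior L \<or> ball z r \<inter> {x. a \<bullet> x > b} \<subseteq> interior L"
    using ab[OF assms(1,2)] by blast
  obtain s where s: "s > 0"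
    "ball z s \<inter> {x. a \<bullet> x < b} \<subseteq> interior M \<or> ball z s \<inter> {x. a \<bullet> x > b} \<subseteq> interior M"
    using ab[OF assms(3,4)] by blast
  have no: "interior L \<inter> interior M = {}" using overlap_eq assms by blast
  define t where "t = min r s"
  have t: "t > 0" "ball z t \<subseteq> ball z r" "ball z t \<subseteq> ball z s" using r s by (auto simp: t_def)
  have "ball z t \<inter> {x. a \<bullet> x < b} \<subseteq> L \<union> M \<and> ball z t \<inter> {x. a \<bullet> x > b} \<subseteq> L \<union> M"
    using r(2) s(2) half_balls_meet[OF a r(1) s(1), of "interior L" "interior M"]
      half_balls_meet'[OF a r(1) s(1), of "interior L" "interior M"] no t
      interior_subset[of L] interior_subset[of M] by blast
  moreover have "ball z t - {x. a \<bullet> x = b} =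
      ball z t \<inter> {x. a \<bullet> x < b} \<union> ball z t \<inter> {x. a \<bullet> x > b}"
    by (auto simp: neq_iff)
  ultimately have "ball z t - {x. a \<bullet> x = b} \<subseteq> L \<union> M" by blast
  moreover have "closed (L \<union> M)" using assms polytope polytope_imp_closed by blast
  ultimately have "closure (ball z t - {x. a \<bullet> x = b}) \<subseteq> L \<union> M" by (simp add: closure_minimal)
  moreover have "ball z t \<subseteq> closure (ball z t - {x. a \<bullet> x = b})"
  proof -
    have "closure (- {x. a \<bullet> x = b}) = UNIV"
      using interior_hyperplane[OF a(1)] by (simp add: closure_complement)
    then show ?thesis
      using open_Int_closure_subset[of "ball z t" "- {x. a \<bullet> x = b}"] by (simp add: Diff_eq)
  qed
  ultimately have "ball z t \<subseteq> L \<union> M" by blast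
  then show ?thesis using t(1) by (meson centre_in_ball interior_maximal open_ball subsetD)
qed

text \<open>
  The points that a segment from \<open>x\<close> reaches through a set of codimension two lie in an affine
  subspace of codimension one. Finitely many of these are negligible, so almost every end point
  outside \<open>P\<close> is suitable.
\<close>

lemma segment_avoiding_ridges:
  fixes x :: 'a
  assumes x: "x \<in> interior P" and P: "bounded P"
    and E: "finite E" "\<And>A. A \<in> E \<Longrightarrow> aff_dim A \<le> int (DIM('a)) - 2"
  obtains y where "y \<notin> P" "\<And>z. z \<in> closed_segment x y \<Longrightarrow> z \<noteq> x \<Longrightarrow> z \<notin> \<Union>E"
proof -
  define B where "B = (\<Union>A\<in>E. affine hull (insert x A))"
  have neg: "negligible (affine hull (insert x A))" if "A \<in> E" for A
  proof -
    have "aff_dim (affine hull (insert x A)) < int (DIM('a))"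
      using E(2)[OF that] aff_dim_insert[of x A] by auto
    then obtain a b where ab: "a \<noteq> 0" "affine hull (insert x A) \<subseteq> {x. a \<bullet> x = b}"
      by (rule aff_lowdim_subset_hyperplane)
    show ?thesis
      by (rule negligible_subset[OF negligible_hyperplane ab(2)]) (use ab in simp)
  qed
  then have "negligible B" unfolding B_def using E(1) by (intro negligible_Union) auto
  obtain R where R: "P \<subseteq> ball 0 R" "R > 0" using bounded_subset_ballD[OF P, of 0] by auto
  have "cball (0::'a) R \<noteq> UNIV"
    using bounded_cball[of "0::'a" R] not_bounded_UNIV[where 'a='a] by metis
  then have nn: "\<not> negligible (- cball (0::'a) R)"
    by (intro open_not_negligible) (auto simp: open_Compl)
  obtain y where y: "y \<notin> cball (0::'a) R" "y \<notin> B"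
  proof (cases "- cball (0::'a) R \<subseteq> B")
    case True
    with nn show ?thesis using negligible_subset[OF \<open>negligible B\<close>] by blast
  next
    case False
    then obtain y where "y \<in> - cball (0::'a) R" "y \<notin> B" by blast
    then show ?thesis using that by simp
  qed
  show ?thesis
  proof (rule that)
    show "y \<notin> P" using y R by (auto simp: subset_eq)
    fix z assume z: "z \<in> closed_segment x y" "z \<noteq> x"
    show "z \<notin> \<Union>E"
    proof
      assume "z \<in> \<Union>E"
      then obtain A where A: "A \<in> E" "z \<in> A" by blast
      obtain u where u: "z = (1 - u) *\<^sub>R x + u *\<^sub>R y" using z by (auto simp: closed_segment_def)
      with z have "u \<noteq> 0" by auto
      have "(1/u) *\<^sub>R z = (1/u - 1) *\<^sub>R x + y"
        using \<open>u \<noteq> 0\<close> by (simp add: u scaleR_add_right diff_divide_distrib)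
      then have "y = (1 - 1/u) *\<^sub>R x + (1/u) *\<^sub>R z"
        by (simp add: algebra_simps)
      moreover have "x \<in> affine hull (insert x A)" "z \<in> affine hull (insert x A)"
        using A by (auto simp: hull_inc)
      ultimately have "y \<in> affine hull (insert x A)"
        using mem_affine[OF affine_affine_hull, of x "insert x A" z "1 - 1/u" "1/u"] by auto
      then show False using y A by (auto simp: B_def)
    qed
  qed
qed

text \<open>
  Uniqueness for the discrete Poisson problem with piecewise constant functions. If the value at
  \<open>K0\<close> were nonzero, let \<open>P\<close> be the union of the cells carrying that value. Leave \<open>P\<close> from an interior
  point along a segment that avoids all faces of codimension two. Where the segment meets the
  frontier of \<open>P\<close>, it crosses the relative interior of a facet. The cell on the other side carries
  the same value, so the point would be interior to \<open>P\<close>; and if there is no other cell, the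
  boundary condition forces the value \<open>0\<close>.
\<close>

lemma cell_values_vanish:
  assumes interior_eq: "\<And>K L F. K \<in> T \<Longrightarrow> L \<in> T \<Longrightarrow> F facet_of K \<Longrightarrow> F facet_of L \<Longrightarrow> c K = c L"
    and boundary: "\<And>K F. K \<in> T \<Longrightarrow> F facet_of K \<Longrightarrow>
        (\<And>L. L \<in> T \<Longrightarrow> F facet_of L \<Longrightarrow> L = K) \<Longrightarrow> c K = (0::real)"
    and K0: "K0 \<in> T"
  shows "c K0 = 0"
proof (rule ccontr)
  assume ne: "c K0 \<noteq> 0"
  define G where "G = {K \<in> T. c K = c K0}"
  define P where "P = \<Union>G"
  have finG: "finite G" using fin by (simp add: G_def)
  have P: "bounded P" "closed P"
    unfolding P_def using finG polytope polytope_imp_bounded polytope_imp_closed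
    by (auto simp: G_def intro!: bounded_Union closed_Union)
  obtain x where "x \<in> interior K0" using interior_ne[OF K0] by blast
  moreover have "interior K0 \<subseteq> interior P"
    unfolding P_def by (intro interior_mono) (use K0 in \<open>auto simp: G_def\<close>)
  ultimately have x: "x \<in> interior P" by blast
  define E where "E = (\<Union>K\<in>T. \<Union>F\<in>{F. F facet_of K}. {A. A facet_of F})"
  have facet_polytope: "polytope F" if "K \<in> T" "F facet_of K" for K F
    using that face_of_polytope_polytope polytope facet_of_imp_face_of by blast
  have finE: "finite E"
    unfolding E_def using fin
  proof (intro finite_UN_I)
    show "finite {F. F facet_of K}" if "K \<in> T" for K
      using finite_polytope_facets[OF polytope[OF that]] .
    show "finite {A. A facet_of F}" if "K \<in> T" "F \<in> {F. F facet_of K}" for K F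
      using finite_polytope_facets[OF facet_polytope[of K F]] that by simp
  qed
  have dimE: "aff_dim A \<le> int (DIM('a)) - 2" if A: "A \<in> E" for A
  proof -
    obtain K F where "K \<in> T" "F facet_of K" "A facet_of F" using A unfolding E_def by blast
    then show ?thesis using aff_dim_le_DIM[of K] by (simp add: facet_of_def)
  qed
  obtain y where y: "y \<notin> P" "\<And>z. z \<in> closed_segment x y \<Longrightarrow> z \<noteq> x \<Longrightarrow> z \<notin> \<Union>E"
    using segment_avoiding_ridges[OF x P(1) finE dimE] by blast
  have "closed_segment x y \<inter> frontier P \<noteq> {}"
    using x y(1) interior_subset[of P] by (intro connected_Int_frontier) auto
  then obtain z where z: "z \<in> closed_segment x y" "z \<in> frontier P" by blast
  have zni: "z \<notin> interior P" and "z \<in> P" using z(2) P(2) by (auto simp: frontier_def)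
  then obtain K where K: "K \<in> G" "z \<in> K" by (auto simp: P_def)
  then have KT: "K \<in> T" "c K = c K0" by (auto simp: G_def)
  have "interior K \<subseteq> interior P" unfolding P_def by (intro interior_mono) (use K in auto)
  then have "z \<in> frontier K"
    using zni K closure_subset[of K] by (auto simp: frontier_def)
  then obtain F where F: "F facet_of K" "z \<in> F"
    using rel_frontier_of_polyhedron[OF polytope_imp_polyhedron[OF polytope[OF KT(1)]]]
      interior_ne[OF KT(1)] by (auto simp: rel_frontier_nonempty_interior)
  have "z \<noteq> x" using x zni by blast
  then have "z \<notin> \<Union>{A. A facet_of F}" using y(2)[OF z(1)] KT F by (auto simp: E_def)
  then have "z \<notin> rel_frontier F"
    using rel_frontier_of_polyhedron[OF polytope_imp_polyhedron[OF facet_polytope[OF KT(1) F(1)]]] by simp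
  then have zF: "z \<in> rel_interior F"
    using F(2) closure_subset[of F] by (auto simp: rel_frontier_def)
  show False
  proof (cases "\<exists>L\<in>T. F facet_of L \<and> L \<noteq> K")
    case True
    then obtain L where L: "L \<in> T" "F facet_of L" "L \<noteq> K" by blast
    then have "L \<in> G" using interior_eq[OF KT(1) L(1) F(1) L(2)] KT by (simp add: G_def)
    then have "interior (K \<union> L) \<subseteq> interior P"
      unfolding P_def by (intro interior_mono) (use K in auto)
    then show False
      using two_cells_cover_facet[OF KT(1) F(1) L(1,2) _ zF] L(3) zni by blast
  next
    case False
    then have "c K = 0" using boundary[OF KT(1) F(1)] by blast
    then show False using KT(2) ne by simp
  qed
qed

end

section \<open>Integrals and gradients\<close>

text \<open>
  The discrete functions and their derivatives are controlled only off a null set, so integrability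
  is part of the conclusion.
\<close>

lemma integral_lebesgue_on_spike:
  fixes f g :: "'a::euclidean_space \<Rightarrow> real"
  assumes S: "S \<in> sets lebesgue" and N: "negligible N"
    and eq: "\<And>x. x \<in> S - N \<Longrightarrow> f x = g x" and g: "integrable (lebesgue_on S) g"
  shows "integrable (lebesgue_on S) f \<and> (LINT x|lebesgue_on S. f x) = (LINT x|lebesgue_on S. g x)"
proof -
  let ?f = "\<lambda>x. indicator S x *\<^sub>R f x" and ?g = "\<lambda>x. indicator S x *\<^sub>R g x"
  have S': "S \<inter> space lebesgue \<in> sets lebesgue" using S by simp
  have gi: "integrable lebesgue ?g" using g unfolding integrable_restrict_space[OF S'] .
  have "N \<in> null_sets lebesgue" using N negligible_iff_null_sets by blast
  then have ae: "AE x in lebesgue. ?g x = ?f x"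
    by (rule AE_I') (use eq in \<open>force simp: indicator_def\<close>)
  have gm: "?g \<in> borel_measurable lebesgue" using gi by (rule borel_measurable_integrable)
  then have fm: "?f \<in> borel_measurable lebesgue" using ae by (rule borel_measurable_AE)
  show ?thesis
    unfolding integrable_restrict_space[OF S'] integral_restrict_space[OF S']
    using integrable_cong_AE[OF gm fm ae] integral_cong_AE[OF gm fm ae] gi by simp
qed

lemma integrable_lebesgue_on_compact:
  fixes f :: "'a::euclidean_space \<Rightarrow> real"
  assumes "compact K" "continuous_on K f"
  shows "integrable (lebesgue_on K) f"
proof -
  have "K \<in> sets borel" using assms(1) by (rule borel_compact)
  then have K: "K \<inter> space lebesgue \<in> sets lebesgue" by simp
  have i: "integrable lborel (\<lambda>x. indicator K x *\<^sub>R f x)"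
    using assms by (rule borel_integrable_compact)
  then show ?thesis
    unfolding integrable_restrict_space[OF K]
    by (subst integrable_completion) (auto dest: borel_measurable_integrable)
qed

text \<open>
  A continuous function that vanishes almost everywhere on an open set vanishes there. The set \<open>U\<close>
  is separate from \<open>S\<close> because derivatives of piecewise polynomials have arbitrary values at
  the interfaces.
\<close>

lemma integral_zero_imp_zero:
  fixes f p :: "'a::euclidean_space \<Rightarrow> real"
  assumes S: "S \<in> sets lebesgue" and f: "integrable (lebesgue_on S) f"
    and nn: "\<And>x. x \<in> S \<Longrightarrow> 0 \<le> f x" and zero: "(LINT x|lebesgue_on S. f x) = 0"
    and U: "open U" "U \<subseteq> S" "\<And>x. x \<in> U \<Longrightarrow> f x = p x" "continuous_on U p" and x: "x \<in> U"
  shows "p x = 0"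
proof (rule ccontr)
  assume ne: "p x \<noteq> 0"
  have "AE x in lebesgue_on S. f x = 0"
    using integral_nonneg_eq_0_iff_AE[OF f] nn zero by (auto simp: AE_restrict_space_iff S)
  then have "AE x in lebesgue. x \<in> S \<longrightarrow> f x = 0"
    by (simp add: AE_restrict_space_iff S)
  then obtain N where N: "N \<in> null_sets lebesgue" "{x. \<not> (x \<in> S \<longrightarrow> f x = 0)} \<subseteq> N"
    unfolding completion.AE_iff_null_sets by auto
  have "open (U \<inter> p -` (- {0}))"
    using continuous_on_open_vimage[OF U(1)] U(4) by (metis inf_commute open_Compl closed_singleton)
  moreover have "U \<inter> p -` (- {0}) \<noteq> {}" using x ne by blast
  moreover have "U \<inter> p -` (- {0}) \<subseteq> N" using N(2) U(2,3) by auto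
  then have "negligible (U \<inter> p -` (- {0}))"
    using N(1) negligible_iff_null_sets negligible_subset by blast
  ultimately show False using open_not_negligible by blast
qed

lemma sum_fun_apply: "(\<Sum>i\<in>I. f i) x = (\<Sum>i\<in>I. f i x)"
  by (induction I rule: infinite_finite_induct) auto

text \<open>
  Only three properties of polynomials enter the analysis: they are \<open>C1\<close>, closed under linear
  combinations, and finite-dimensional for bounded degree.
\<close>

definition C1_gradient :: "('a::real_inner \<Rightarrow> real) \<Rightarrow> ('a \<Rightarrow> 'a) \<Rightarrow> bool" where
  "C1_gradient p g \<longleftrightarrow> (\<forall>x. GDERIV p x :> g x) \<and> continuous_on UNIV g"

lemma C1_gradient_continuous:
  assumes "C1_gradient p g"
  shows "continuous_on A p" "continuous_on A g"
proof -
  have "continuous (at x) p" for x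
    using assms has_derivative_continuous unfolding C1_gradient_def gderiv_def by blast
  then show "continuous_on A p" by (simp add: continuous_at_imp_continuous_on)
  show "continuous_on A g" using assms continuous_on_subset[of UNIV g A] by (simp add: C1_gradient_def)
qed

lemma C1_gradient_const: "C1_gradient (\<lambda>x. c) (\<lambda>x. 0)"
  by (auto simp: C1_gradient_def GDERIV_const)

lemma C1_gradient_add:
  "C1_gradient p g \<Longrightarrow> C1_gradient q h \<Longrightarrow> C1_gradient (\<lambda>x. p x + q x) (\<lambda>x. g x + h x)"
  by (auto simp: C1_gradient_def GDERIV_add intro!: continuous_intros)

lemma C1_gradient_mult:
  assumes "C1_gradient p g" "C1_gradient q h"
  shows "C1_gradient (\<lambda>x. p x * q x) (\<lambda>x. p x *\<^sub>R h x + q x *\<^sub>R g x)"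
  using assms C1_gradient_continuous[OF assms(1)] C1_gradient_continuous[OF assms(2)]
  by (auto simp: C1_gradient_def GDERIV_mult intro!: continuous_intros)

lemma C1_gradient_cmult:
  assumes "C1_gradient p g"
  shows "C1_gradient (\<lambda>x. c * p x) (\<lambda>x. c *\<^sub>R g x)"
  using C1_gradient_mult[OF C1_gradient_const[of c] assms] by simp

lemma C1_gradient_prod:
  assumes "finite I" "\<And>i. i \<in> I \<Longrightarrow> \<exists>g. C1_gradient (p i) g"
  shows "\<exists>g. C1_gradient (\<lambda>x. \<Prod>i\<in>I. p i x) g"
  using assms
proof (induction I rule: finite_induct)
  case empty
  show ?case using C1_gradient_const[of 1] by auto
next
  case (insert i I)
  then obtain g h where "C1_gradient (p i) g" "C1_gradient (\<lambda>x. \<Prod>i\<in>I. p i x) h" by blast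
  from C1_gradient_mult[OF this] show ?case using insert(1,2) by auto
qed

lemma C1_gradient_sum:
  assumes "finite I" "\<And>i. i \<in> I \<Longrightarrow> \<exists>g. C1_gradient (p i) g"
  shows "\<exists>g. C1_gradient (\<lambda>x. \<Sum>i\<in>I. p i x) g"
  using assms
proof (induction I rule: finite_induct)
  case empty
  show ?case using C1_gradient_const[of 0] by auto
next
  case (insert i I)
  then obtain g h where "C1_gradient (p i) g" "C1_gradient (\<lambda>x. \<Sum>i\<in>I. p i x) h" by blast
  from C1_gradient_add[OF this] show ?case using insert(1,2) by auto
qed

lemma C1_gradient_coordinate_power: "\<exists>g. C1_gradient (\<lambda>x::real^'n. (x $ i) ^ k) g"
proof -
  have "C1_gradient (\<lambda>x::real^'n. x $ i) (\<lambda>x. axis i 1)"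
    unfolding C1_gradient_def gderiv_def inner_axis
    by (auto intro!: bounded_linear_imp_has_derivative bounded_linear_vec_nth)
  then have "\<exists>g. C1_gradient (\<lambda>x::real^'n. \<Prod>j\<in>{..<k}. x $ i) g"
    by (intro C1_gradient_prod) auto
  then show ?thesis by simp
qed

definition multi_indices :: "nat \<Rightarrow> (nat^3) set" where
  "multi_indices k = {\<alpha>. (\<Sum>i\<in>UNIV. \<alpha> $ i) \<le> k}"

definition monomial :: "nat^3 \<Rightarrow> real^3 \<Rightarrow> real" where
  "monomial \<alpha> x = (\<Prod>i\<in>UNIV. (x $ i) ^ (\<alpha> $ i))"

lemma finite_multi_indices: "finite (multi_indices k)"
proof -
  have "multi_indices k \<subseteq> (\<lambda>f. \<chi> i. f i) ` (UNIV \<rightarrow>\<^sub>E {..k})"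
  proof
    fix \<alpha> assume "\<alpha> \<in> multi_indices k"
    then have "\<alpha> $ i \<le> k" for i
      using member_le_sum[of i UNIV "\<lambda>i. \<alpha> $ i"] by (simp add: multi_indices_def)
    then have "(\<lambda>i. \<alpha> $ i) \<in> UNIV \<rightarrow>\<^sub>E {..k}" by auto
    moreover have "\<alpha> = (\<chi> i. \<alpha> $ i)" by (simp add: vec_eq_iff)
    ultimately show "\<alpha> \<in> (\<lambda>f. \<chi> i. f i) ` (UNIV \<rightarrow>\<^sub>E {..k})" by blast
  qed
  moreover have "finite ((UNIV :: 3 set) \<rightarrow>\<^sub>E {..k})" by (intro finite_PiE) auto
  ultimately show ?thesis using finite_subset by blast
qed

lemma poly_functions_iff:
  "p \<in> poly_functions k \<longleftrightarrow> (\<exists>c. p = (\<lambda>x. \<Sum>\<alpha>\<in>multi_indices k. c \<alpha> * monomial \<alpha> x))"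
  by (simp add: poly_functions_def multi_indices_def monomial_def)

lemma poly_functions_C1:
  assumes "p \<in> poly_functions k"
  shows "\<exists>g. C1_gradient p g"
proof -
  obtain c where p: "p = (\<lambda>x. \<Sum>\<alpha>\<in>multi_indices k. c \<alpha> * monomial \<alpha> x)"
    using assms poly_functions_iff by blast
  have "\<exists>g. C1_gradient (\<lambda>x. c \<alpha> * monomial \<alpha> x) g" for \<alpha>
  proof -
    obtain g where "C1_gradient (monomial \<alpha>) g"
      using C1_gradient_prod[of UNIV "\<lambda>i x. (x $ i) ^ (\<alpha> $ i)"] C1_gradient_coordinate_power
      unfolding monomial_def[abs_def] by auto
    then show ?thesis using C1_gradient_cmult by blast
  qed
  then show ?thesis unfolding p by (intro C1_gradient_sum finite_multi_indices)
qed

lemma poly_functions_zero: "(\<lambda>x. 0) \<in> poly_functions k"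
  unfolding poly_functions_iff by (intro exI[of _ "\<lambda>_. 0"]) simp

lemma poly_functions_lincomb:
  assumes "p \<in> poly_functions k" "q \<in> poly_functions k"
  shows "(\<lambda>x. p x + c * q x) \<in> poly_functions k"
proof -
  obtain a b where "p = (\<lambda>x. \<Sum>\<alpha>\<in>multi_indices k. a \<alpha> * monomial \<alpha> x)"
    "q = (\<lambda>x. \<Sum>\<alpha>\<in>multi_indices k. b \<alpha> * monomial \<alpha> x)"
    using assms poly_functions_iff by blast
  then have "(\<lambda>x. p x + c * q x) = (\<lambda>x. \<Sum>\<alpha>\<in>multi_indices k. (a \<alpha> + c * b \<alpha>) * monomial \<alpha> x)"
    by (simp add: sum_distrib_left sum.distrib algebra_simps)
  then show ?thesis unfolding poly_functions_iff by (rule exI[of _ "\<lambda>\<alpha>. a \<alpha> + c * b \<alpha>"])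
qed

lemma grad_eqI:
  assumes "GDERIV u x :> g"
  shows "grad u x = g"
  unfolding grad_def
proof (rule the_equality, rule assms)
  fix h assume "GDERIV u x :> h"
  then have "(\<lambda>y. y \<bullet> h) = (\<lambda>y. y \<bullet> g)"
    using assms has_derivative_unique unfolding gderiv_def by blast
  then show "h = g" by (metis inner_commute vector_eq_rdot)
qed

definition piece :: "(real^3) set \<Rightarrow> (real^3 \<Rightarrow> real) \<Rightarrow> (real^3 \<Rightarrow> real) \<Rightarrow> (real^3 \<Rightarrow> real^3) \<Rightarrow> bool" where
  "piece K u p g \<longleftrightarrow> C1_gradient p g \<and> (\<forall>x\<in>interior K. u x = p x)"

lemma piece_lincomb:
  assumes "piece K u p g" "piece K v q h"
  shows "piece K (u + c *\<^sub>R v) (\<lambda>x. p x + c * q x) (\<lambda>x. g x + c *\<^sub>R h x)"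
  using assms C1_gradient_add[OF _ C1_gradient_cmult, of p g q h c] by (auto simp: piece_def)

lemma piece_grad:
  assumes "piece K u p g" "x \<in> interior K"
  shows "grad u x = g x"
proof (rule grad_eqI)
  have "GDERIV p x :> g x" using assms by (simp add: piece_def C1_gradient_def)
  then show "GDERIV u x :> g x"
    using has_derivative_transform_within_open[OF _ open_interior assms(2), of p _ UNIV u] assms(1)
    by (auto simp: gderiv_def piece_def)
qed

text \<open>
  Points of the closure of the interior are limit points of the interior, so the limit that defines
  the trace is unique.
\<close>

lemma trace_from_eq:
  fixes f :: "real^3 \<Rightarrow> 'b::t2_space"
  assumes "\<And>x. x \<in> interior K \<Longrightarrow> f x = p x" "continuous_on UNIV p" "x \<in> closure (interior K)"
  shows "trace_from K f x = p x"
  unfolding trace_from_def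
proof (rule tendsto_Lim)
  show "\<not> trivial_limit (at x within interior K)"
  proof (cases "x \<in> interior K")
    case True
    then show ?thesis using at_within_open[OF True open_interior] trivial_limit_at[of x] by metis
  next
    case False
    then show ?thesis using assms(3) by (simp add: at_within_eq_bot_iff)
  qed
  have "(p \<longlongrightarrow> p x) (at x within interior K)"
    using continuous_on_imp_continuous_within[OF assms(2) subset_UNIV UNIV_I]
      continuous_within_subset[of x UNIV p "interior K"] by (simp add: continuous_within)
  then show "(f \<longlongrightarrow> p x) (at x within interior K)"
    by (rule Lim_transform_eventually) (auto simp: eventually_at_filter assms(1))
qed

lemma piece_traces:
  assumes "piece K u p g" "x \<in> closure (interior K)"
  shows "trace_from K u x = p x" "trace_from K (grad u) x = g x"
  using assms trace_from_eq[of K u p x] trace_from_eq[of K "grad u" g x] piece_grad[OF assms(1)]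
    C1_gradient_continuous[of p g UNIV] by (auto simp: piece_def)


section \<open>Integrals over triangular faces\<close>

definition unit_triangle :: "(real^2) set" where
  "unit_triangle = {z. 0 \<le> z$1 \<and> 0 \<le> z$2 \<and> z$1 + z$2 \<le> 1}"

lemma compact_unit_triangle: "compact unit_triangle"
proof -
  have "closed unit_triangle"
    unfolding unit_triangle_def
    by (intro closed_Collect_conj closed_Collect_le continuous_intros)
  moreover have "unit_triangle \<subseteq> cbox 0 1"
    by (auto simp: unit_triangle_def mem_box_cart forall_2)
  then have "bounded unit_triangle" using bounded_subset bounded_cbox by blast
  ultimately show ?thesis by (simp add: compact_eq_bounded_closed)
qed

lemma measure_unit_triangle_pos: "(LINT z|lebesgue_on unit_triangle. (1::real)) > 0"
proof -
  have S: "unit_triangle \<in> sets lebesgue"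
    using borel_compact[OF compact_unit_triangle] by simp
  have i: "integrable (lebesgue_on unit_triangle) (\<lambda>z. 1 :: real)"
    by (rule integrable_lebesgue_on_compact[OF compact_unit_triangle]) simp
  define U :: "(real^2) set" where "U = {z. 0 < z$1 \<and> 0 < z$2 \<and> z$1 + z$2 < 1}"
  have "open U" unfolding U_def
    by (intro open_Collect_conj open_Collect_less continuous_intros)
  moreover have "U \<subseteq> unit_triangle" by (auto simp: U_def unit_triangle_def)
  moreover have "(\<chi> i. 1/4) \<in> U" by (simp add: U_def)
  ultimately have "(LINT z|lebesgue_on unit_triangle. (1::real)) \<noteq> 0"
    using integral_zero_imp_zero[OF S i, of U "\<lambda>z. 1" "\<chi> i. 1/4"] by auto
  moreover have "(LINT z|lebesgue_on unit_triangle. (1::real)) \<ge> 0" by simp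
  ultimately show ?thesis by linarith
qed

definition triangular_face :: "(real^3) set \<Rightarrow> bool" where
  "triangular_face F \<longleftrightarrow> (\<exists>a b c. \<not> collinear {a, b, c} \<and> F = convex hull {a, b, c})"

text \<open>
  A parametrisation of \<open>F\<close> is fixed by a choice in the definition of the face integral; the facts used
  below depend only on these properties of it.
\<close>

lemma face_integral_parametrized:
  assumes "triangular_face F"
  obtains J \<phi> where "J > 0" "\<phi> ` unit_triangle \<subseteq> F"
    "\<And>g. face_integral F g = J * (LINT z|lebesgue_on unit_triangle. g (\<phi> z))"
    "\<And>h :: real^3 \<Rightarrow> real. continuous_on F h \<Longrightarrow>
       integrable (lebesgue_on unit_triangle) (\<lambda>z. h (\<phi> z))"
proof -
  define t where "t = (SOME (a, b, c). \<not> collinear {a, b, c} \<and> F = convex hull {a, b, c})"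
  obtain a b c where t: "t = (a, b, c)" by (cases t) auto
  note abc = t[unfolded t_def]
  have "\<exists>t. case t of (a, b, c) \<Rightarrow> \<not> collinear {a, b, c} \<and> F = convex hull {a, b, c}"
    using assms by (auto simp: triangular_face_def)
  from someI_ex[OF this] have F: "\<not> collinear {a, b, c}" "F = convex hull {a, b, c}"
    unfolding abc by auto
  define J where "J = norm (cross3 (b - a) (c - a))"
  define \<phi> where "\<phi> z = a + z$1 *\<^sub>R (b - a) + z$2 *\<^sub>R (c - a)" for z :: "real^2"
  have "\<not> collinear {b, a, c}" using F(1) by (simp add: insert_commute)
  then have "\<not> collinear {0, b - a, c - a}" using collinear_3[of b a c] by simp
  then have "J > 0" by (simp add: J_def cross_eq_0)
  moreover have sub: "\<phi> ` unit_triangle \<subseteq> F"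
  proof safe
    fix z assume z: "z \<in> unit_triangle"
    have "\<phi> z = (1 - z$1 - z$2) *\<^sub>R a + z$1 *\<^sub>R b + z$2 *\<^sub>R c"
      by (simp add: \<phi>_def algebra_simps)
    moreover have "0 \<le> 1 - z$1 - z$2" "0 \<le> z$1" "0 \<le> z$2" "(1 - z$1 - z$2) + z$1 + z$2 = 1"
      using z by (auto simp: unit_triangle_def)
    ultimately show "\<phi> z \<in> F" unfolding F(2) convex_hull_3 by blast
  qed
  moreover have "face_integral F g = J * (LINT z|lebesgue_on unit_triangle. g (\<phi> z))" for g
    unfolding face_integral_def abc by (simp add: J_def \<phi>_def unit_triangle_def)
  moreover have "integrable (lebesgue_on unit_triangle) (\<lambda>z. h (\<phi> z))" if "continuous_on F h" for h :: "real^3 \<Rightarrow> real"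
  proof (rule integrable_lebesgue_on_compact[OF compact_unit_triangle])
    have "continuous_on unit_triangle \<phi>" unfolding \<phi>_def by (intro continuous_intros)
    then show "continuous_on unit_triangle (\<lambda>z. h (\<phi> z))" using continuous_on_compose2[OF that _ sub] by blast
  qed
  ultimately show ?thesis by (rule that)
qed

lemma face_integral_lincomb:
  assumes "triangular_face F" "continuous_on F f" "continuous_on F g"
  shows "face_integral F (\<lambda>x. f x + c * g x) = face_integral F f + c * face_integral F g"
proof -
  obtain J \<phi> where J: "J > 0" "\<phi> ` unit_triangle \<subseteq> F"
    "\<And>g. face_integral F g = J * (LINT z|lebesgue_on unit_triangle. g (\<phi> z))"
    "\<And>h :: real^3 \<Rightarrow> real. continuous_on F h \<Longrightarrow>
       integrable (lebesgue_on unit_triangle) (\<lambda>z. h (\<phi> z))"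
    using face_integral_parametrized[OF assms(1)] by blast
  show ?thesis unfolding J(3) using J(4)[OF assms(2)] J(4)[OF assms(3)] by (simp add: algebra_simps)
qed

lemma face_integral_mono:
  assumes "triangular_face F" "continuous_on F f" "continuous_on F g" "\<And>x. x \<in> F \<Longrightarrow> f x \<le> g x"
  shows "face_integral F f \<le> face_integral F g"
proof -
  obtain J \<phi> where J: "J > 0" "\<phi> ` unit_triangle \<subseteq> F"
    "\<And>g. face_integral F g = J * (LINT z|lebesgue_on unit_triangle. g (\<phi> z))"
    "\<And>h :: real^3 \<Rightarrow> real. continuous_on F h \<Longrightarrow>
       integrable (lebesgue_on unit_triangle) (\<lambda>z. h (\<phi> z))"
    using face_integral_parametrized[OF assms(1)] by blast
  have "(LINT z|lebesgue_on unit_triangle. f (\<phi> z)) \<le> (LINT z|lebesgue_on unit_triangle. g (\<phi> z))"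
    by (intro integral_mono J(4) assms) (use J(2) assms(4) in auto)
  then show ?thesis unfolding J(3) using J(1) by simp
qed

lemma face_integral_cong:
  assumes "triangular_face F" "\<And>x. x \<in> F \<Longrightarrow> f x = g x"
  shows "face_integral F f = face_integral F g"
proof -
  obtain J \<phi> where J: "J > 0" "\<phi> ` unit_triangle \<subseteq> F"
    "\<And>g. face_integral F g = J * (LINT z|lebesgue_on unit_triangle. g (\<phi> z))"
    "\<And>h :: real^3 \<Rightarrow> real. continuous_on F h \<Longrightarrow>
       integrable (lebesgue_on unit_triangle) (\<lambda>z. h (\<phi> z))"
    using face_integral_parametrized[OF assms(1)] by blast
  have "(LINT z|lebesgue_on unit_triangle. f (\<phi> z)) = (LINT z|lebesgue_on unit_triangle. g (\<phi> z))"
    by (intro Bochner_Integration.integral_cong) (use J(2) assms(2) in auto)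
  then show ?thesis unfolding J(3) by simp
qed

lemma face_integral_const:
  assumes "triangular_face F"
  shows "face_integral F (\<lambda>x. k) = k * face_area F" "face_area F > 0"
proof -
  obtain J \<phi> where J: "J > 0" "\<phi> ` unit_triangle \<subseteq> F"
    "\<And>g. face_integral F g = J * (LINT z|lebesgue_on unit_triangle. g (\<phi> z))"
    "\<And>h :: real^3 \<Rightarrow> real. continuous_on F h \<Longrightarrow>
       integrable (lebesgue_on unit_triangle) (\<lambda>z. h (\<phi> z))"
    using face_integral_parametrized[OF assms(1)] by blast
  have a: "face_area F = J * (LINT z|lebesgue_on unit_triangle. (1::real))"
    unfolding face_area_def J(3) ..
  show "face_area F > 0" unfolding a using J(1) measure_unit_triangle_pos by simp
  have "(LINT z|lebesgue_on unit_triangle. k) = k * (LINT z|lebesgue_on unit_triangle. (1::real))"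
    by simp
  then show "face_integral F (\<lambda>x. k) = k * face_area F" unfolding J(3) a by simp
qed

lemma bilinear_face_integral:
  assumes F: "triangular_face F" and S: "subspace S"
    and l: "\<And>x. x \<in> F \<Longrightarrow> linear_form_on S (\<lambda>u. l u x)" "\<And>u. u \<in> S \<Longrightarrow> continuous_on F (l u)"
    and m: "\<And>x. x \<in> F \<Longrightarrow> linear_form_on S (\<lambda>u. m u x)" "\<And>u. u \<in> S \<Longrightarrow> continuous_on F (m u)"
  shows "bilinear_form_on S (\<lambda>u v. face_integral F (\<lambda>x. l u x * m v x))"
proof (rule bilinear_form_onI)
  fix u v w c assume S: "u \<in> S" "v \<in> S" "w \<in> S"
  have "face_integral F (\<lambda>x. l (u + c *\<^sub>R v) x * m w x) =
      face_integral F (\<lambda>x. l u x * m w x + c * (l v x * m w x))"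
    using linear_form_onD[OF l(1) S(1,2)] by (intro face_integral_cong[OF F]) (simp add: algebra_simps)
  also have "\<dots> = face_integral F (\<lambda>x. l u x * m w x) + c * face_integral F (\<lambda>x. l v x * m w x)"
    by (intro face_integral_lincomb[OF F] continuous_on_mult l m S)
  finally show "face_integral F (\<lambda>x. l (u + c *\<^sub>R v) x * m w x) = \<dots>" .
  have "face_integral F (\<lambda>x. l w x * m (u + c *\<^sub>R v) x) =
      face_integral F (\<lambda>x. l w x * m u x + c * (l w x * m v x))"
    using linear_form_onD[OF m(1) S(1,2)] by (intro face_integral_cong[OF F]) (simp add: algebra_simps)
  also have "\<dots> = face_integral F (\<lambda>x. l w x * m u x) + c * face_integral F (\<lambda>x. l w x * m v x)"
    by (intro face_integral_lincomb[OF F] continuous_on_mult l m S)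
  finally show "face_integral F (\<lambda>x. l w x * m (u + c *\<^sub>R v) x) = \<dots>" .
qed

section \<open>Piecewise polynomials on the tetrahedra\<close>

locale tet_mesh =
  fixes \<Omega> :: "(real^3) set" and N :: "'e network" and D :: "'e discretization"
  assumes mesh: "tetrahedral_mesh \<Omega> N D"
begin

lemma simplex_cell: "K \<in> tets D \<Longrightarrow> 3 simplex K"
  using mesh by (simp add: tetrahedral_mesh_def)

lemma finite_tets: "finite (tets D)"
  using mesh by (simp add: tetrahedral_mesh_def triangulation_def)

lemma interior_cell_nonempty:
  assumes "K \<in> tets D"
  shows "interior K \<noteq> {}"
proof -
  have K: "3 simplex K" using simplex_cell assms .
  then have d: "aff_dim K = int DIM(real^3)" using aff_dim_simplex by simp
  then have "K \<noteq> {}" by auto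
  then have "rel_interior K \<noteq> {}" using rel_interior_eq_empty[OF convex_simplex[OF K]] by simp
  moreover have "affine hull K = UNIV" using d aff_dim_eq_full by blast
  ultimately show ?thesis using rel_interior_interior[of K] by simp
qed

sublocale polytopal_mesh "tets D"
proof
  show "finite (tets D)" by (rule finite_tets)
  show "polytope K" if "K \<in> tets D" for K using simplex_cell[OF that] simplex_imp_polytope by blast
  show "interior K \<noteq> {}" if "K \<in> tets D" for K using interior_cell_nonempty that .
  show "(K \<inter> K') face_of K" if "K \<in> tets D" "K' \<in> tets D" for K K'
    using mesh that by (simp add: tetrahedral_mesh_def triangulation_def)
qed

lemma cell_closure_interior: "K \<in> tets D \<Longrightarrow> closure (interior K) = K"
  using simplex_cell[of K] convex_simplex closed_simplex convex_closure_interior[of K]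
    interior_cell_nonempty[of K] by (metis closure_closed)

lemma compact_cell: "K \<in> tets D \<Longrightarrow> compact K"
  using simplex_cell compact_simplex by blast

lemma finite_faces: "finite (faces D)"
proof -
  have "faces D = (\<Union>K\<in>tets D. {F. F facet_of K})" by (auto simp: faces_def)
  moreover have "finite {F. F facet_of K}" if "K \<in> tets D" for K
    using finite_polytope_facets[OF polytope[OF that]] .
  ultimately show ?thesis using finite_tets by simp
qed

lemma face_side1: "F \<in> faces D \<Longrightarrow> side1 D F \<in> tets D \<and> F facet_of side1 D F"
  using mesh by (simp add: tetrahedral_mesh_def)

lemma face_side2:
  "interior_face D F \<Longrightarrow> side2 D F \<in> tets D \<and> F facet_of side2 D F \<and> side2 D F \<noteq> side1 D F"
  using mesh by (simp add: tetrahedral_mesh_def)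

lemma triangular_faces:
  assumes "F \<in> faces D"
  shows "triangular_face F"
proof -
  obtain K where K: "K \<in> tets D" "F facet_of K" using assms by (auto simp: faces_def)
  obtain C where C: "\<not> affine_dependent C" "int (card C) = 3 + 1" "K = convex hull C"
    using simplex_cell[OF K(1)] by (auto simp: simplex_def)
  obtain u where u: "u \<in> C" "F = convex hull (C - {u})"
    using K(2) C by (auto simp: facet_of_convex_hull_affine_independent)
  have "card (C - {u}) = 3" using C(2) u(1) by simp
  then obtain a b c where abc: "C - {u} = {a, b, c}" "a \<noteq> b" "b \<noteq> c" "a \<noteq> c"
    by (auto simp: card_3_iff)
  have "\<not> affine_dependent {a, b, c}"
    using affine_independent_subset[OF C(1), of "C - {u}"] abc(1) by auto
  then have "\<not> collinear {a, b, c}" using collinear_3_eq_affine_dependent abc by blast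
  then show ?thesis unfolding triangular_face_def using u abc by metis
qed

lemma V3_piece:
  assumes "u \<in> V3 D" "K \<in> tets D"
  obtains p g where "piece K u p g"
  using assms poly_functions_C1 unfolding V3_def piece_def by blast

lemma interior_disjoint:
  "K \<in> tets D \<Longrightarrow> L \<in> tets D \<Longrightarrow> x \<in> interior K \<Longrightarrow> x \<in> interior L \<Longrightarrow> K = L"
  using overlap_eq by blast

lemma subspace_V3: "subspace (V3 D)"
proof (rule subspaceI)
  show "0 \<in> V3 D" using poly_functions_zero by (auto simp: V3_def)
  have lc: "u + c *\<^sub>R v \<in> V3 D" if u: "u \<in> V3 D" and v: "v \<in> V3 D" for u v c
  proof -
    have "\<exists>r\<in>poly_functions (deg3 D). \<forall>x\<in>interior K. (u + c *\<^sub>R v) x = r x" if K: "K \<in> tets D" for K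
    proof -
      obtain p q where p: "p \<in> poly_functions (deg3 D)" "\<forall>x\<in>interior K. u x = p x"
        and q: "q \<in> poly_functions (deg3 D)" "\<forall>x\<in>interior K. v x = q x"
        using u v K unfolding V3_def by blast
      then show ?thesis using poly_functions_lincomb[OF p(1) q(1), of c]
        by (intro bexI[of _ "\<lambda>x. p x + c * q x"]) auto
    qed
    then show ?thesis using u v by (auto simp: V3_def)
  qed
  show "u + v \<in> V3 D" if "u \<in> V3 D" "v \<in> V3 D" for u v using lc[OF that, of 1] by simp
  show "c *\<^sub>R u \<in> V3 D" if "u \<in> V3 D" for c u
    using lc[OF \<open>0 \<in> V3 D\<close> that, of c] by simp
qed

lemma V3_expansion:
  assumes "u \<in> V3 D"
  obtains c where "\<And>x. u x = (\<Sum>K\<in>tets D. \<Sum>\<alpha>\<in>multi_indices (deg3 D).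
      c K \<alpha> * (indicator (interior K) x * monomial \<alpha> x))"
proof -
  have "\<forall>K\<in>tets D. \<exists>a. \<forall>x\<in>interior K. u x = (\<Sum>\<alpha>\<in>multi_indices (deg3 D). a \<alpha> * monomial \<alpha> x)"
  proof
    fix K assume "K \<in> tets D"
    then obtain p where "p \<in> poly_functions (deg3 D)" "\<forall>x\<in>interior K. u x = p x"
      using assms unfolding V3_def by blast
    then show "\<exists>a. \<forall>x\<in>interior K. u x = (\<Sum>\<alpha>\<in>multi_indices (deg3 D). a \<alpha> * monomial \<alpha> x)"
      unfolding poly_functions_iff by metis
  qed
  then obtain c where c: "\<And>K x. K \<in> tets D \<Longrightarrow> x \<in> interior K \<Longrightarrow>
      u x = (\<Sum>\<alpha>\<in>multi_indices (deg3 D). c K \<alpha> * monomial \<alpha> x)"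
    by metis
  have "u x = (\<Sum>K\<in>tets D. \<Sum>\<alpha>\<in>multi_indices (deg3 D).
      c K \<alpha> * (indicator (interior K) x * monomial \<alpha> x))" (is "_ = (\<Sum>K\<in>_. ?s K)") for x
  proof (cases "\<exists>K\<in>tets D. x \<in> interior K")
    case True
    then obtain K where K: "K \<in> tets D" "x \<in> interior K" by blast
    have "?s L = 0" if "L \<in> tets D - {K}" for L
    proof -
      have "x \<notin> interior L" using interior_disjoint[OF K(1) _ K(2), of L] that by blast
      then show ?thesis by simp
    qed
    then have "(\<Sum>K\<in>tets D. ?s K) = ?s K"
      using sum.mono_neutral_right[OF finite_tets, of "{K}" ?s] K(1) by simp
    then show ?thesis using c[OF K] K(2) by simp
  next
    case False
    then have "u x = 0" using assms unfolding V3_def by blast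
    moreover have "?s K = 0" if "K \<in> tets D" for K using False that by simp
    ultimately show ?thesis by simp
  qed
  then show ?thesis using that by blast
qed

lemma finite_dim_V3: "finite_dim (V3 D)"
proof -
  define b where "b = (\<lambda>K \<alpha> x. indicator (interior K) x * monomial \<alpha> x :: real)"
  define B where "B = (\<lambda>(K, \<alpha>). b K \<alpha>) ` (tets D \<times> multi_indices (deg3 D))"
  have "u \<in> span B" if u: "u \<in> V3 D" for u
  proof -
    obtain c where c: "\<And>x. u x = (\<Sum>K\<in>tets D. \<Sum>\<alpha>\<in>multi_indices (deg3 D).
      c K \<alpha> * (indicator (interior K) x * monomial \<alpha> x))"
      using V3_expansion[OF u] by blast
    have eq: "u = (\<Sum>K\<in>tets D. \<Sum>\<alpha>\<in>multi_indices (deg3 D). c K \<alpha> *\<^sub>R b K \<alpha>)"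
      by (simp add: fun_eq_iff sum_fun_apply c b_def)
    have "b K \<alpha> \<in> B" if "K \<in> tets D" "\<alpha> \<in> multi_indices (deg3 D)" for K \<alpha>
      unfolding B_def by (rule image_eqI[of _ _ "(K, \<alpha>)"]) (use that in auto)
    then show ?thesis unfolding eq by (intro span_sum span_scale span_base)
  qed
  moreover have "finite B" unfolding B_def using finite_tets finite_multi_indices by blast
  ultimately show ?thesis unfolding finite_dim_def by blast
qed

text \<open>
  Traces turn a function that is smooth on the interior of each cell into continuous functions on the
  closed cells. All terms of the form on the tetrahedra are integrals of traces.
\<close>

lemma V3_traces:
  assumes K: "K \<in> tets D" and u: "u \<in> V3 D"
  shows "continuous_on K (trace_from K u)" "continuous_on K (trace_from K (grad u))"
    "\<And>x. x \<in> interior K \<Longrightarrow> trace_from K u x = u x"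
    "\<And>x. x \<in> interior K \<Longrightarrow> trace_from K (grad u) x = grad u x"
proof -
  obtain p g where pg: "piece K u p g" using V3_piece[OF u K] .
  have t: "x \<in> K \<Longrightarrow> trace_from K u x = p x" "x \<in> K \<Longrightarrow> trace_from K (grad u) x = g x" for x
    using piece_traces[OF pg, of x] cell_closure_interior[OF K] by auto
  have "continuous_on K p" "continuous_on K g"
    using C1_gradient_continuous[of p g K] pg by (auto simp: piece_def)
  then show "continuous_on K (trace_from K u)" "continuous_on K (trace_from K (grad u))"
    using t continuous_on_cong[of K K "trace_from K u" p]
      continuous_on_cong[of K K "trace_from K (grad u)" g] by auto
  fix x assume "x \<in> interior K"
  then show "trace_from K u x = u x" "trace_from K (grad u) x = grad u x"
    using t[of x] interior_subset[of K] pg piece_grad[OF pg, of x] by (auto simp: piece_def)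
qed

lemma V3_traces_lincomb:
  assumes K: "K \<in> tets D" and u: "u \<in> V3 D" and v: "v \<in> V3 D" and x: "x \<in> K"
  shows "trace_from K (u + c *\<^sub>R v) x = trace_from K u x + c * trace_from K v x"
    "trace_from K (grad (u + c *\<^sub>R v)) x = trace_from K (grad u) x + c *\<^sub>R trace_from K (grad v) x"
proof -
  obtain p g where pg: "piece K u p g" using V3_piece[OF u K] .
  obtain q h where qh: "piece K v q h" using V3_piece[OF v K] .
  have x': "x \<in> closure (interior K)" using x cell_closure_interior[OF K] by simp
  show "trace_from K (u + c *\<^sub>R v) x = trace_from K u x + c * trace_from K v x"
    "trace_from K (grad (u + c *\<^sub>R v)) x = trace_from K (grad u) x + c *\<^sub>R trace_from K (grad v) x"
    using piece_traces[OF pg x'] piece_traces[OF qh x'] piece_traces[OF piece_lincomb[OF pg qh] x', of c]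
    by simp_all
qed

lemma linear_trace: "K \<in> tets D \<Longrightarrow> x \<in> K \<Longrightarrow> linear_form_on (V3 D) (\<lambda>u. trace_from K u x)"
  unfolding linear_form_on_def using V3_traces_lincomb by blast

definition dirichlet :: "(real^3 \<Rightarrow> real) \<Rightarrow> (real^3 \<Rightarrow> real) \<Rightarrow> real" where
  "dirichlet u v = (\<Sum>K\<in>tets D. LINT x|lebesgue_on K. grad u x \<bullet> grad v x)"

lemma cell_integral_traces:
  assumes K: "K \<in> tets D" and u: "u \<in> V3 D" and v: "v \<in> V3 D"
  shows "integrable (lebesgue_on K) (\<lambda>x. grad u x \<bullet> grad v x)"
    and "(LINT x|lebesgue_on K. grad u x \<bullet> grad v x) =
      (LINT x|lebesgue_on K. trace_from K (grad u) x \<bullet> trace_from K (grad v) x)"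
    and "integrable (lebesgue_on K) (\<lambda>x. trace_from K (grad u) x \<bullet> trace_from K (grad v) x)"
proof -
  show i: "integrable (lebesgue_on K) (\<lambda>x. trace_from K (grad u) x \<bullet> trace_from K (grad v) x)"
    by (intro integrable_lebesgue_on_compact compact_cell[OF K] continuous_on_inner
        V3_traces(2)[OF K u] V3_traces(2)[OF K v])
  have S: "K \<in> sets lebesgue" using borel_compact[OF compact_cell[OF K]] by simp
  have N: "negligible (frontier K)"
    using negligible_convex_frontier convex_simplex[OF simplex_cell[OF K]] by blast
  have "grad u x \<bullet> grad v x = trace_from K (grad u) x \<bullet> trace_from K (grad v) x"
    if "x \<in> K - frontier K" for x
  proof -
    have "x \<in> interior K" using that closure_subset[of K] by (auto simp: frontier_def)
    then show ?thesis using V3_traces(4)[OF K u, of x] V3_traces(4)[OF K v, of x] by simp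
  qed
  from integral_lebesgue_on_spike[OF S N this i]
  show "integrable (lebesgue_on K) (\<lambda>x. grad u x \<bullet> grad v x)"
    "(LINT x|lebesgue_on K. grad u x \<bullet> grad v x) =
      (LINT x|lebesgue_on K. trace_from K (grad u) x \<bullet> trace_from K (grad v) x)" by auto
qed

lemma psd_dirichlet: "psd_form_on (V3 D) dirichlet"
proof -
  have lin: "dirichlet (u + c *\<^sub>R v) w = dirichlet u w + c * dirichlet v w"
    if S: "u \<in> V3 D" "v \<in> V3 D" "w \<in> V3 D" for u v w c
  proof -
    have uv: "u + c *\<^sub>R v \<in> V3 D" using S subspace_V3 by (meson subspace_add subspace_scale)
    have "(LINT x|lebesgue_on K. grad (u + c *\<^sub>R v) x \<bullet> grad w x) =
        (LINT x|lebesgue_on K. grad u x \<bullet> grad w x) + c * (LINT x|lebesgue_on K. grad v x \<bullet> grad w x)"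
      if K: "K \<in> tets D" for K
    proof -
      have "(LINT x|lebesgue_on K. grad (u + c *\<^sub>R v) x \<bullet> grad w x) =
        (LINT x|lebesgue_on K. trace_from K (grad u) x \<bullet> trace_from K (grad w) x
           + c * (trace_from K (grad v) x \<bullet> trace_from K (grad w) x))"
        unfolding cell_integral_traces(2)[OF K uv S(3)]
        by (intro Bochner_Integration.integral_cong refl)
          (simp add: V3_traces_lincomb(2)[OF K S(1,2)] inner_add_left)
      also have "\<dots> = (LINT x|lebesgue_on K. grad u x \<bullet> grad w x) + c * (LINT x|lebesgue_on K. grad v x \<bullet> grad w x)"
        unfolding cell_integral_traces(2)[OF K S(1,3)] cell_integral_traces(2)[OF K S(2,3)]
        using cell_integral_traces(3)[OF K S(1,3)] cell_integral_traces(3)[OF K S(2,3)] by simp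
      finally show ?thesis .
    qed
    then show ?thesis by (simp add: dirichlet_def sum.distrib sum_distrib_left)
  qed
  show ?thesis
    by (rule psd_form_onI) (use lin in \<open>auto simp: dirichlet_def inner_commute intro!: sum_nonneg\<close>)
qed

text \<open>
  A continuous nonnegative function with zero integral vanishes, so the gradient vanishes up to the
  boundary of the cell, which is convex.
\<close>

lemma dirichlet_zero:
  assumes u: "u \<in> V3 D" and z: "dirichlet u u = 0" and K: "K \<in> tets D"
  shows "\<exists>c. \<forall>x\<in>interior K. u x = c" "\<And>x. x \<in> K \<Longrightarrow> trace_from K (grad u) x = 0"
proof -
  have zK: "(LINT x|lebesgue_on K. grad u x \<bullet> grad u x) = 0"
    using z K finite_tets by (simp add: dirichlet_def sum_nonneg_eq_0_iff)
  have S: "K \<in> sets lebesgue" using borel_compact[OF compact_cell[OF K]] by simp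
  obtain p g where pg: "piece K u p g" using V3_piece[OF u K] .
  have cont: "continuous_on (interior K) (\<lambda>x. g x \<bullet> g x)"
    using C1_gradient_continuous(2)[of p g] pg by (intro continuous_on_inner) (auto simp: piece_def)
  have "g x \<bullet> g x = 0" if "x \<in> interior K" for x
    by (rule integral_zero_imp_zero[OF S cell_integral_traces(1)[OF K u u] _ zK open_interior interior_subset _ cont that])
      (use piece_grad[OF pg] in auto)
  then have g0: "g x = 0" if "x \<in> interior K" for x using that by simp
  have "g x = 0" if "x \<in> K" for x
  proof -
    have "continuous_on (closure (interior K)) g"
      using C1_gradient_continuous(2)[of p g] pg by (simp add: piece_def)
    then show ?thesis
      using continuous_constant_on_closure[of "interior K" g 0 x] g0 that cell_closure_interior[OF K] by simp
  qed
  then show "trace_from K (grad u) x = 0" if "x \<in> K" for x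
    using piece_traces(2)[OF pg, of x] cell_closure_interior[OF K] that by simp
  have "(p has_derivative (\<lambda>h. 0)) (at x within interior K)" if "x \<in> interior K" for x
  proof -
    have "(p has_derivative (\<lambda>h. h \<bullet> g x)) (at x)"
      using pg by (simp add: piece_def C1_gradient_def gderiv_def)
    then have "(p has_derivative (\<lambda>h. 0)) (at x)" using g0[OF that] by simp
    then show ?thesis by (rule has_derivative_at_withinI)
  qed
  then have "\<exists>c. \<forall>x\<in>interior K. p x = c"
    by (intro has_derivative_zero_constant) (use convex_simplex[OF simplex_cell[OF K]] in auto)
  then show "\<exists>c. \<forall>x\<in>interior K. u x = c" using pg by (auto simp: piece_def)
qed


section \<open>Coercivity on the tetrahedra\<close>

definition face_flux :: "(real^3) set \<Rightarrow> (real^3 \<Rightarrow> real) \<Rightarrow> real^3 \<Rightarrow> real" where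
  "face_flux F u x = face_mean D F (grad u) x \<bullet> face_normal D F"

lemma face_sides:
  assumes "F \<in> faces D"
  shows "side1 D F \<in> tets D" "F \<subseteq> side1 D F"
    "interior_face D F \<Longrightarrow> side2 D F \<in> tets D" "interior_face D F \<Longrightarrow> F \<subseteq> side2 D F"
  using face_side1[OF assms] face_side2[of F] facet_of_imp_subset by blast+

lemma face_flux_linear:
  assumes F: "F \<in> faces D" and x: "x \<in> F"
  shows "linear_form_on (V3 D) (\<lambda>u. face_flux F u x)"
proof -
  note s = face_sides[OF F]
  have 1: "trace_from (side1 D F) (grad (u + c *\<^sub>R v)) x =
      trace_from (side1 D F) (grad u) x + c *\<^sub>R trace_from (side1 D F) (grad v) x"
    if "u \<in> V3 D" "v \<in> V3 D" for u v c
    using V3_traces_lincomb(2)[OF s(1) that] s(2) x by blast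
  have 2: "trace_from (side2 D F) (grad (u + c *\<^sub>R v)) x =
      trace_from (side2 D F) (grad u) x + c *\<^sub>R trace_from (side2 D F) (grad v) x"
    if "u \<in> V3 D" "v \<in> V3 D" "interior_face D F" for u v c
    using V3_traces_lincomb(2)[OF s(3)[OF that(3)] that(1,2)] s(4)[OF that(3)] x by blast
  show ?thesis
    unfolding linear_form_on_def face_flux_def face_mean_def
    by (auto simp: 1 2 algebra_simps inner_add_left)
qed

lemma face_flux_continuous:
  assumes F: "F \<in> faces D" and u: "u \<in> V3 D"
  shows "continuous_on F (face_flux F u)"
proof -
  note s = face_sides[OF F]
  have 1: "continuous_on F (trace_from (side1 D F) (grad u))"
    using continuous_on_subset[OF V3_traces(2)[OF s(1) u] s(2)] .
  have 2: "continuous_on F (trace_from (side2 D F) (grad u))" if "interior_face D F"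
    using continuous_on_subset[OF V3_traces(2)[OF s(3)[OF that] u] s(4)[OF that]] .
  show ?thesis
    unfolding face_flux_def[abs_def] face_mean_def using 1 2
    by (cases "interior_face D F") (auto intro!: continuous_intros)
qed

lemma face_jump_linear:
  assumes F: "F \<in> faces D" and x: "x \<in> F"
  shows "linear_form_on (V3 D) (\<lambda>u. face_jump D F u x)"
proof (cases "interior_face D F")
  case True
  then show ?thesis
    unfolding face_jump_def using face_sides[OF F] x
    by (auto intro!: linear_form_on_diff linear_trace)
next
  case False
  then show ?thesis
    unfolding face_jump_def using face_sides[OF F] x by (auto intro!: linear_trace)
qed

lemma face_jump_continuous:
  assumes F: "F \<in> faces D" and u: "u \<in> V3 D"
  shows "continuous_on F (face_jump D F u)"
proof -
  note s = face_sides[OF F]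
  have 1: "continuous_on F (trace_from (side1 D F) u)"
    using continuous_on_subset[OF V3_traces(1)[OF s(1) u] s(2)] .
  have 2: "continuous_on F (trace_from (side2 D F) u)" if "interior_face D F"
    using continuous_on_subset[OF V3_traces(1)[OF s(3)[OF that] u] s(4)[OF that]] .
  show ?thesis
    unfolding face_jump_def[abs_def] using 1 2
    by (cases "interior_face D F") (auto intro!: continuous_intros)
qed

lemma a_form_eq:
  "a_form D \<epsilon> \<sigma> u v = dirichlet u v
     - (\<Sum>F\<in>faces D. face_integral F (\<lambda>x. face_flux F u x * face_jump D F v x))
     + \<epsilon> * (\<Sum>F\<in>faces D. face_integral F (\<lambda>x. face_flux F v x * face_jump D F u x))
     + (\<Sum>F\<in>faces D. \<sigma> / sqrt (face_area F) * face_integral F (\<lambda>x. face_jump D F u x * face_jump D F v x))"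
  by (simp add: a_form_def dirichlet_def face_flux_def)

lemma bilinear_a_form: "bilinear_form_on (V3 D) (a_form D \<epsilon> \<sigma>)"
proof -
  note bf = bilinear_face_integral[OF triangular_faces subspace_V3]
  note ff = face_flux_linear face_flux_continuous face_jump_linear face_jump_continuous
  have 1: "bilinear_form_on (V3 D) (\<lambda>u v. face_integral F (\<lambda>x. face_flux F u x * face_jump D F v x))"
    if "F \<in> faces D" for F
    by (rule bf[OF that]) (use ff[OF that] in auto)
  have 2: "bilinear_form_on (V3 D) (\<lambda>u v. face_integral F (\<lambda>x. face_jump D F u x * face_jump D F v x))"
    if "F \<in> faces D" for F
    by (rule bf[OF that]) (use ff[OF that] in auto)
  have "bilinear_form_on (V3 D) dirichlet" using psd_dirichlet by (simp add: psd_form_on_def)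
  then show ?thesis
    unfolding a_form_eq[abs_def]
    by (intro bilinear_form_on_add bilinear_form_on_diff bilinear_form_on_cmult bilinear_form_on_sum
        1 2 bilinear_form_on_swap[OF 1])
qed

definition jump_norm :: "(real^3) set \<Rightarrow> (real^3 \<Rightarrow> real) \<Rightarrow> real" where
  "jump_norm F u = face_integral F (\<lambda>x. face_jump D F u x * face_jump D F u x)"

definition flux_form :: "(real^3 \<Rightarrow> real) \<Rightarrow> (real^3 \<Rightarrow> real) \<Rightarrow> real" where
  "flux_form u v = (\<Sum>F\<in>faces D. face_integral F (\<lambda>x. face_flux F u x * face_flux F v x))"

lemma face_integral_nonneg:
  assumes "F \<in> faces D" "continuous_on F f" "\<And>x. x \<in> F \<Longrightarrow> 0 \<le> f x"
  shows "0 \<le> face_integral F f"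
  using face_integral_mono[OF triangular_faces[OF assms(1)] continuous_on_const assms(2,3)]
    face_integral_const(1)[OF triangular_faces[OF assms(1)], of 0] by simp

lemma jump_norm_nonneg: "F \<in> faces D \<Longrightarrow> u \<in> V3 D \<Longrightarrow> 0 \<le> jump_norm F u"
  unfolding jump_norm_def
  by (rule face_integral_nonneg) (auto intro!: continuous_on_mult face_jump_continuous)

lemma psd_flux_form: "psd_form_on (V3 D) flux_form"
  unfolding psd_form_on_def
proof (intro conjI ballI)
  show "bilinear_form_on (V3 D) flux_form"
    unfolding flux_form_def[abs_def]
    by (intro bilinear_form_on_sum bilinear_face_integral triangular_faces subspace_V3
        face_flux_linear face_flux_continuous)
  show "flux_form u v = flux_form v u" for u v by (simp add: flux_form_def mult.commute)
  show "0 \<le> flux_form u u" if "u \<in> V3 D" for u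
    unfolding flux_form_def using that
    by (intro sum_nonneg face_integral_nonneg) (auto intro!: continuous_on_mult face_flux_continuous)
qed

text \<open>
  This replaces the inverse trace inequality: a function without gradient has no flux through the
  faces. The constant depends on the mesh and the degree.
\<close>

lemma flux_form_dominated: "\<exists>C>0. \<forall>u\<in>V3 D. flux_form u u \<le> C * dirichlet u u"
proof (rule psd_form_dominated[OF finite_dim_V3 subspace_V3 psd_dirichlet psd_flux_form])
  fix u assume u: "u \<in> V3 D" and z: "dirichlet u u = 0"
  have "face_flux F u x = 0" if F: "F \<in> faces D" and x: "x \<in> F" for F x
    using face_sides[OF F] x dirichlet_zero(2)[OF u z, of _ x]
    by (auto simp: face_flux_def face_mean_def subset_eq)
  then have "face_integral F (\<lambda>x. face_flux F u x * face_flux F u x) = 0" if F: "F \<in> faces D" for F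
    using face_integral_cong[OF triangular_faces[OF F], of "\<lambda>x. face_flux F u x * face_flux F u x" "\<lambda>x. 0"]
      face_integral_const(1)[OF triangular_faces[OF F], of 0] F by simp
  then show "flux_form u u = 0" by (simp add: flux_form_def)
qed

lemma face_young:
  assumes F: "F \<in> faces D" and u: "u \<in> V3 D" and l: "l > 0"
  shows "2 * \<bar>face_integral F (\<lambda>x. face_flux F u x * face_jump D F u x)\<bar> \<le>
    l * face_integral F (\<lambda>x. face_flux F u x * face_flux F u x) + (1/l) * jump_norm F u"
proof -
  note T = triangular_faces[OF F]
  note c = face_flux_continuous[OF F u] face_jump_continuous[OF F u]
  let ?f = "face_flux F u" and ?j = "face_jump D F u"
  have cont: "continuous_on F (\<lambda>x. ?f x * ?j x)" "continuous_on F (\<lambda>x. ?f x * ?f x)"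
    "continuous_on F (\<lambda>x. ?j x * ?j x)"
    using c by (auto intro!: continuous_on_mult)
  have z: "continuous_on F (\<lambda>x. 0 :: real)" by simp
  have lin: "face_integral F (\<lambda>x. l * (?f x * ?f x) + (1/l) * (?j x * ?j x)) =
      l * face_integral F (\<lambda>x. ?f x * ?f x) + (1/l) * jump_norm F u"
    using face_integral_lincomb[OF T _ cont(3), of "\<lambda>x. l * (?f x * ?f x)" "1/l"]
      face_integral_lincomb[OF T z cont(2), of l] cont
      face_integral_const(1)[OF T, of 0] by (simp add: jump_norm_def continuous_on_mult)
  have pt: "2 * s * (?f x * ?j x) \<le> l * (?f x * ?f x) + (1/l) * (?j x * ?j x)" if "s = 1 \<or> s = -1" for s x
  proof -
    have "0 \<le> (l * ?f x - s * ?j x)\<^sup>2 / l" using l by simp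
    also have "\<dots> = l * (?f x * ?f x) - 2 * s * (?f x * ?j x) + (1/l) * (?j x * ?j x)"
      using l that by (auto simp: power2_eq_square field_simps)
    finally show ?thesis by simp
  qed
  have "2 * s * face_integral F (\<lambda>x. ?f x * ?j x) \<le> l * face_integral F (\<lambda>x. ?f x * ?f x) + (1/l) * jump_norm F u"
    if "s = 1 \<or> s = -1" for s
  proof -
    have "2 * s * face_integral F (\<lambda>x. ?f x * ?j x) = face_integral F (\<lambda>x. 0 + 2 * s * (?f x * ?j x))"
      using face_integral_lincomb[OF T z cont(1), of "2 * s"] face_integral_const(1)[OF T, of 0] by simp
    also have "\<dots> \<le> face_integral F (\<lambda>x. l * (?f x * ?f x) + (1/l) * (?j x * ?j x))"
    proof (rule face_integral_mono[OF T])
      show "continuous_on F (\<lambda>x. 0 + 2 * s * (?f x * ?j x))"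
        "continuous_on F (\<lambda>x. l * (?f x * ?f x) + (1/l) * (?j x * ?j x))"
        by (intro continuous_on_add continuous_on_mult_left continuous_on_const cont)+
      show "0 + 2 * s * (?f x * ?j x) \<le> l * (?f x * ?f x) + (1/l) * (?j x * ?j x)" for x
        using pt[OF that, of x] by simp
    qed
    finally show ?thesis unfolding lin .
  qed
  from this[of 1] this[of "-1"] show ?thesis by (simp add: abs_if)
qed

text \<open>
  Such a function is constant on each cell. Vanishing jumps make the constants agree across
  interior faces and vanish at boundary faces.
\<close>

lemma zero_if_no_gradient_no_jump:
  assumes u: "u \<in> V3 D" and d: "dirichlet u u = 0" and j: "\<And>F. F \<in> faces D \<Longrightarrow> jump_norm F u = 0"
  shows "u = 0"
proof -
  obtain c where c: "\<And>K x. K \<in> tets D \<Longrightarrow> x \<in> interior K \<Longrightarrow> u x = c K"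
    using dirichlet_zero(1)[OF u d] by metis
  have tr: "trace_from K u x = c K" if K: "K \<in> tets D" and x: "x \<in> K" for K x
    using trace_from_eq[of K u "\<lambda>_. c K" x] c[OF K] cell_closure_interior[OF K] x by simp
  define J where "J F = (if interior_face D F then c (side1 D F) - c (side2 D F) else c (side1 D F))" for F
  have J: "J F = 0" if F: "F \<in> faces D" for F
  proof -
    note T = triangular_faces[OF F]
    have "face_jump D F u x = J F" if "x \<in> F" for x
      using tr face_sides[OF F] that unfolding face_jump_def J_def by (auto simp: subset_eq)
    then have "jump_norm F u = J F * J F * face_area F"
      unfolding jump_norm_def face_integral_const(1)[OF T, symmetric]
      by (intro face_integral_cong[OF T]) simp
    then show ?thesis using j[OF F] face_integral_const(2)[OF T] by simp
  qed
  have c0: "c K = 0" if K: "K \<in> tets D" for K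
  proof (rule cell_values_vanish[OF _ _ K])
    fix K L F assume KL: "K \<in> tets D" "L \<in> tets D" "F facet_of K" "F facet_of L"
    show "c K = c L"
    proof (cases "K = L")
      case False
      then have i: "interior_face D F" using KL by (auto simp: interior_face_def)
      have F: "F \<in> faces D" using KL by (auto simp: faces_def)
      note s = face_side1[OF F] face_side2[OF i]
      have M: "M = side1 D F \<or> M = side2 D F" if "M \<in> tets D" "F facet_of M" for M
        using at_most_two_cells_at_facet[OF that, of "side1 D F" "side2 D F"] s by metis
      have "c (side1 D F) = c (side2 D F)" using J[OF F] i by (simp add: J_def)
      then show ?thesis using M[OF KL(1,3)] M[OF KL(2,4)] by auto
    qed simp
  next
    fix K F assume KF: "K \<in> tets D" "F facet_of K"
      and only: "\<And>L. L \<in> tets D \<Longrightarrow> F facet_of L \<Longrightarrow> L = K"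
    then have F: "F \<in> faces D" by (auto simp: faces_def)
    have "side1 D F = K" using only face_side1[OF F] by blast
    moreover have "\<not> interior_face D F" using only unfolding interior_face_def by metis
    ultimately show "c K = 0" using J[OF F] by (simp add: J_def)
  qed
  show "u = 0"
  proof (rule ext)
    fix x
    show "u x = 0 x"
    proof (cases "\<exists>K\<in>tets D. x \<in> interior K")
      case True
      then show ?thesis using c c0 by auto
    next
      case False
      then show ?thesis using u unfolding V3_def by auto
    qed
  qed
qed

text \<open>
  For \<open>\<epsilon> = 1\<close> the two flux terms cancel on the diagonal and every positive penalty will do. Otherwise
  Young's inequality absorbs them, half of the Dirichlet form paying for the fluxes and the penalty
  for the jumps.
\<close>

lemma a_form_lower_bound:
  obtains \<sigma>0 where "\<sigma>0 > 0"
    "\<And>\<epsilon> \<sigma>. \<epsilon> \<in> {-1, 0, 1} \<Longrightarrow> \<sigma> > 0 \<Longrightarrow> (\<epsilon> \<noteq> 1 \<Longrightarrow> \<sigma> \<ge> \<sigma>0) \<Longrightarrow>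
       \<exists>w. (\<forall>F\<in>faces D. w F > 0) \<and> (\<forall>u\<in>V3 D.
         a_form D \<epsilon> \<sigma> u u \<ge> dirichlet u u / 2 + (\<Sum>F\<in>faces D. w F * jump_norm F u))"
proof -
  obtain C where C: "C > 0" "\<And>u. u \<in> V3 D \<Longrightarrow> flux_form u u \<le> C * dirichlet u u"
    using flux_form_dominated by blast
  \<comment> \<open>the sum bounds each term, and makes \<open>\<sigma> / sqrt (face_area F) \<ge> 2 * C + 1\<close> for every face\<close>
  define \<sigma>0 where "\<sigma>0 = 1 + (\<Sum>F\<in>faces D. (2 * C + 1) * sqrt (face_area F))"
  have area: "face_area F > 0" if "F \<in> faces D" for F
    using face_integral_const(2)[OF triangular_faces[OF that]] .
  have "\<sigma>0 > 0" unfolding \<sigma>0_def using C area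
    by (intro add_pos_nonneg sum_nonneg mult_nonneg_nonneg) (auto simp: less_imp_le)
  moreover have "\<exists>w. (\<forall>F\<in>faces D. w F > 0) \<and> (\<forall>u\<in>V3 D.
         a_form D \<epsilon> \<sigma> u u \<ge> dirichlet u u / 2 + (\<Sum>F\<in>faces D. w F * jump_norm F u))"
    if \<epsilon>: "\<epsilon> \<in> {-1, 0, 1}" and \<sigma>: "\<sigma> > 0" "\<epsilon> \<noteq> 1 \<Longrightarrow> \<sigma> \<ge> \<sigma>0" for \<epsilon> \<sigma>
  proof (cases "\<epsilon> = 1")
    case True
    have "0 \<le> dirichlet u u" if "u \<in> V3 D" for u using psd_dirichlet that by (simp add: psd_form_on_def)
    then show ?thesis using \<sigma>(1) area True
      by (intro exI[of _ "\<lambda>F. \<sigma> / sqrt (face_area F)"]) (auto simp: a_form_eq jump_norm_def)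
  next
    case False
    have pen: "\<sigma> / sqrt (face_area F) \<ge> 2 * C + 1" if F: "F \<in> faces D" for F
    proof -
      have "(2 * C + 1) * sqrt (face_area F) \<le> (\<Sum>F\<in>faces D. (2 * C + 1) * sqrt (face_area F))"
        using C area by (intro member_le_sum[OF F] finite_faces) (auto simp: less_imp_le)
      then have "(2 * C + 1) * sqrt (face_area F) \<le> \<sigma>" using \<sigma>(2)[OF False] by (simp add: \<sigma>0_def)
      then show ?thesis using area[OF F] by (simp add: pos_le_divide_eq)
    qed
    have "a_form D \<epsilon> \<sigma> u u \<ge> dirichlet u u / 2 + (\<Sum>F\<in>faces D. 1 * jump_norm F u)" if u: "u \<in> V3 D" for u
    proof -
      define m where "m F = face_integral F (\<lambda>x. face_flux F u x * face_jump D F u x)" for F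
      define t where "t F = face_integral F (\<lambda>x. face_flux F u x * face_flux F u x)" for F
      have t: "(\<Sum>F\<in>faces D. t F) \<le> C * dirichlet u u"
        using C(2)[OF u] by (simp add: t_def flux_form_def)
      have e: "\<bar>\<epsilon> - 1\<bar> \<le> 2" using \<epsilon> by auto
      have "\<bar>(\<epsilon> - 1) * (\<Sum>F\<in>faces D. m F)\<bar> \<le> 2 * (\<Sum>F\<in>faces D. \<bar>m F\<bar>)"
        unfolding abs_mult using e by (intro mult_mono sum_abs) auto
      also have "\<dots> = (\<Sum>F\<in>faces D. 2 * \<bar>m F\<bar>)" by (simp add: sum_distrib_left)
      also have "\<dots> \<le> (\<Sum>F\<in>faces D. (1 / (2 * C)) * t F + 2 * C * jump_norm F u)"
        unfolding m_def t_def using face_young[OF _ u, of _ "1 / (2 * C)"] C(1)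
        by (intro sum_mono) simp
      also have "\<dots> = (1 / (2 * C)) * (\<Sum>F\<in>faces D. t F) + (\<Sum>F\<in>faces D. 2 * C * jump_norm F u)"
        by (simp only: sum.distrib sum_distrib_left)
      also have "\<dots> \<le> (1 / (2 * C)) * (C * dirichlet u u) + (\<Sum>F\<in>faces D. 2 * C * jump_norm F u)"
        using t C(1) by (intro add_mono mult_left_mono) auto
      also have "\<dots> = dirichlet u u / 2 + (\<Sum>F\<in>faces D. 2 * C * jump_norm F u)" using C(1) by simp
      finally have b: "\<bar>(\<epsilon> - 1) * (\<Sum>F\<in>faces D. m F)\<bar> \<le>
        dirichlet u u / 2 + (\<Sum>F\<in>faces D. 2 * C * jump_norm F u)" .
      have "(\<Sum>F\<in>faces D. (2 * C + 1) * jump_norm F u) \<le>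
          (\<Sum>F\<in>faces D. \<sigma> / sqrt (face_area F) * jump_norm F u)"
        using pen jump_norm_nonneg[OF _ u] by (intro sum_mono mult_right_mono)
      moreover have "(\<Sum>F\<in>faces D. (2 * C + 1) * jump_norm F u) =
          (\<Sum>F\<in>faces D. 2 * C * jump_norm F u) + (\<Sum>F\<in>faces D. 1 * jump_norm F u)"
        by (simp only: sum.distrib distrib_right)
      moreover have "a_form D \<epsilon> \<sigma> u u = dirichlet u u + (\<epsilon> - 1) * (\<Sum>F\<in>faces D. m F)
          + (\<Sum>F\<in>faces D. \<sigma> / sqrt (face_area F) * jump_norm F u)"
        by (simp add: a_form_eq m_def jump_norm_def algebra_simps)
      ultimately show ?thesis using b by linarith
    qed
    then show ?thesis by (intro exI[of _ "\<lambda>F. 1"]) auto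
  qed
  ultimately show ?thesis using that by blast
qed

lemma a_form_coercive:
  obtains \<sigma>0 where "\<sigma>0 > 0"
    "\<And>\<epsilon> \<sigma> u. \<epsilon> \<in> {-1, 0, 1} \<Longrightarrow> \<sigma> > 0 \<Longrightarrow> (\<epsilon> \<noteq> 1 \<Longrightarrow> \<sigma> \<ge> \<sigma>0) \<Longrightarrow> u \<in> V3 D \<Longrightarrow>
       a_form D \<epsilon> \<sigma> u u \<ge> 0 \<and> (a_form D \<epsilon> \<sigma> u u = 0 \<longrightarrow> u = 0)"
proof -
  obtain \<sigma>0 where \<sigma>0: "\<sigma>0 > 0"
    "\<And>\<epsilon> \<sigma>. \<epsilon> \<in> {-1, 0, 1} \<Longrightarrow> \<sigma> > 0 \<Longrightarrow> (\<epsilon> \<noteq> 1 \<Longrightarrow> \<sigma> \<ge> \<sigma>0) \<Longrightarrow>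
       \<exists>w. (\<forall>F\<in>faces D. w F > 0) \<and> (\<forall>u\<in>V3 D.
         a_form D \<epsilon> \<sigma> u u \<ge> dirichlet u u / 2 + (\<Sum>F\<in>faces D. w F * jump_norm F u))"
    using a_form_lower_bound by blast
  have "a_form D \<epsilon> \<sigma> u u \<ge> 0 \<and> (a_form D \<epsilon> \<sigma> u u = 0 \<longrightarrow> u = 0)"
    if h: "\<epsilon> \<in> {-1, 0, 1}" "\<sigma> > 0" "\<epsilon> \<noteq> 1 \<Longrightarrow> \<sigma> \<ge> \<sigma>0" and u: "u \<in> V3 D" for \<epsilon> \<sigma> u
  proof -
    obtain w where w: "\<And>F. F \<in> faces D \<Longrightarrow> w F > 0"
      "a_form D \<epsilon> \<sigma> u u \<ge> dirichlet u u / 2 + (\<Sum>F\<in>faces D. w F * jump_norm F u)"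
      using \<sigma>0(2)[OF h] u by blast
    have d: "0 \<le> dirichlet u u" using psd_dirichlet u by (simp add: psd_form_on_def)
    have nn: "0 \<le> w F * jump_norm F u" if "F \<in> faces D" for F
      using w(1)[OF that] jump_norm_nonneg[OF that u] by simp
    then have s: "0 \<le> (\<Sum>F\<in>faces D. w F * jump_norm F u)" by (rule sum_nonneg)
    have "u = 0" if "a_form D \<epsilon> \<sigma> u u = 0"
    proof (rule zero_if_no_gradient_no_jump[OF u])
      show "dirichlet u u = 0" using w(2) d s that by linarith
      have "(\<Sum>F\<in>faces D. w F * jump_norm F u) = 0" using w(2) d s that by linarith
      then show "jump_norm F u = 0" if "F \<in> faces D" for F
        using sum_nonneg_eq_0_iff[OF finite_faces nn] w(1)[OF that] that by auto
    qed
    moreover have "a_form D \<epsilon> \<sigma> u u \<ge> 0" using w(2) d s by linarith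
    ultimately show ?thesis by blast
  qed
  then show ?thesis using that \<sigma>0(1) by blast
qed

end

section \<open>Piecewise polynomials on the edges\<close>

lemma linear_form_on_Lim:
  fixes \<phi> :: "'v::real_vector \<Rightarrow> 'b \<Rightarrow> real"
  assumes F: "F \<noteq> bot"
    and lim: "\<And>u. u \<in> S \<Longrightarrow> \<exists>l. (\<phi> u \<longlongrightarrow> l) F"
    and lin: "\<And>u v c. u \<in> S \<Longrightarrow> v \<in> S \<Longrightarrow> eventually (\<lambda>x. \<phi> (u + c *\<^sub>R v) x = \<phi> u x + c * \<phi> v x) F"
  shows "linear_form_on S (\<lambda>u. Lim F (\<phi> u))"
  unfolding linear_form_on_def
proof (intro ballI allI)
  fix u v c assume S: "u \<in> S" "v \<in> S"
  obtain l m where lm: "(\<phi> u \<longlongrightarrow> l) F" "(\<phi> v \<longlongrightarrow> m) F" using lim S by metis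
  have "((\<lambda>x. \<phi> u x + c * \<phi> v x) \<longlongrightarrow> l + c * m) F" using lm by (intro tendsto_intros)
  then have "(\<phi> (u + c *\<^sub>R v) \<longlongrightarrow> l + c * m) F"
    by (rule Lim_transform_eventually) (use lin[OF S, of c] in \<open>simp add: eq_commute\<close>)
  then show "Lim F (\<phi> (u + c *\<^sub>R v)) = Lim F (\<phi> u) + c * Lim F (\<phi> v)"
    using lm tendsto_Lim[OF F] by metis
qed

lemma linear_form_on_compose:
  assumes "linear_form_on S l" "\<And>x. x \<in> T \<Longrightarrow> f x \<in> S"
    "\<And>x y c. x \<in> T \<Longrightarrow> y \<in> T \<Longrightarrow> f (x + c *\<^sub>R y) = f x + c *\<^sub>R f y"
  shows "linear_form_on T (\<lambda>x. l (f x))"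
  using assms by (simp add: linear_form_on_def)

lemma bilinear_form_on_compose:
  assumes "bilinear_form_on S B" "\<And>x. x \<in> T \<Longrightarrow> f x \<in> S"
    "\<And>x y c. x \<in> T \<Longrightarrow> y \<in> T \<Longrightarrow> f (x + c *\<^sub>R y) = f x + c *\<^sub>R f y"
  shows "bilinear_form_on T (\<lambda>x y. B (f x) (f y))"
  using assms by (simp add: bilinear_form_on_def linear_form_on_def)

lemma psd_form_on_sum:
  assumes "\<And>i. i \<in> I \<Longrightarrow> psd_form_on S (B i)"
  shows "psd_form_on S (\<lambda>x y. \<Sum>i\<in>I. B i x y)"
  unfolding psd_form_on_def
proof (intro conjI ballI)
  show "bilinear_form_on S (\<lambda>x y. \<Sum>i\<in>I. B i x y)"
    using assms by (intro bilinear_form_on_sum) (simp add: psd_form_on_def)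
  show "(\<Sum>i\<in>I. B i x y) = (\<Sum>i\<in>I. B i y x)" if "x \<in> S" "y \<in> S" for x y
    using assms that by (intro sum.cong) (auto simp: psd_form_on_def)
  show "0 \<le> (\<Sum>i\<in>I. B i x x)" if "x \<in> S" for x
    using assms that by (intro sum_nonneg) (auto simp: psd_form_on_def)
qed

lemma psd_form_on_add:
  assumes "psd_form_on S A" "psd_form_on S B"
  shows "psd_form_on S (\<lambda>x y. A x y + B x y)"
  using assms by (simp add: psd_form_on_def bilinear_form_on_add)

lemma psd_form_on_square: "linear_form_on S l \<Longrightarrow> psd_form_on S (\<lambda>x y. l x * l y)"
  by (simp add: psd_form_on_def bilinear_form_on_mult)

lemma psd_form_on_compose:
  assumes "psd_form_on S B" "\<And>x. x \<in> T \<Longrightarrow> f x \<in> S"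
    "\<And>x y c. x \<in> T \<Longrightarrow> y \<in> T \<Longrightarrow> f (x + c *\<^sub>R y) = f x + c *\<^sub>R f y"
  shows "psd_form_on T (\<lambda>x y. B (f x) (f y))"
  using assms(1,2) bilinear_form_on_compose[OF _ assms(2,3), of B] by (simp add: psd_form_on_def)

locale network_mesh = tet_mesh \<Omega> N D
  for \<Omega> :: "(real^3) set" and N :: "'e network" and D :: "'e discretization" +
  assumes graph: "embedded_graph \<Omega> N" and cylinders: "surrounding_cylinders \<Omega> N"
    and cells: "\<And>e. e \<in> arcs (net N) \<Longrightarrow> cells D e \<ge> 1"
begin

lemma finite_arcs: "finite (arcs (net N))" and finite_verts: "finite (verts (net N))"
  using graph fin_digraph.finite_arcs fin_digraph.finite_verts by (auto simp: embedded_graph_def)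

lemma finite_bifurcations: "finite (bifurcations N)"
  using finite_verts by (simp add: bifurcations_def)

lemma edges_at_arcs: "edges_at N v \<subseteq> arcs (net N)"
  by (auto simp: edges_at_def)

lemma finite_edges_at: "finite (edges_at N v)"
  using finite_subset[OF edges_at_arcs finite_arcs] .

lemma edge_len_pos: "e \<in> arcs (net N) \<Longrightarrow> edge_len N e > 0"
  using graph by (simp add: embedded_graph_def)

lemma cell_size_pos: "e \<in> arcs (net N) \<Longrightarrow> cell_size N D e > 0"
  using edge_len_pos[of e] cells[of e] by (simp add: cell_size_def)

lemma area_continuous:
  assumes "e \<in> arcs (net N)"
  shows "continuous_on {0..edge_len N e} (area N e)"
proof -
  have "C1_on_interval (area N e) 0 (edge_len N e)"
    using cylinders assms by (simp add: surrounding_cylinders_def)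
  then show ?thesis
    unfolding C1_on_interval_def
    by (meson continuous_on_eq_continuous_within has_vector_derivative_continuous)
qed

lemma area_pos: "e \<in> arcs (net N) \<Longrightarrow> s \<in> {0..edge_len N e} \<Longrightarrow> area N e s > 0"
  using cylinders by (simp add: surrounding_cylinders_def)

lemma node_0: "node N D e 0 = 0" by (simp add: node_def)

lemma node_cells: "e \<in> arcs (net N) \<Longrightarrow> node N D e (cells D e) = edge_len N e"
  using cells[of e] by (simp add: node_def cell_size_def)

lemma node_less: "e \<in> arcs (net N) \<Longrightarrow> i \<in> {1..cells D e} \<Longrightarrow> node N D e (i-1) < node N D e i"
  using cell_size_pos[of e] by (simp add: node_def)

lemma node_mono: "e \<in> arcs (net N) \<Longrightarrow> i \<le> j \<Longrightarrow> node N D e i \<le> node N D e j"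
  using cell_size_pos[of e] by (simp add: node_def mult_right_mono)

definition cell :: "'e \<Rightarrow> nat \<Rightarrow> real set" where
  "cell e i = {node N D e (i-1)<..<node N D e i}"

abbreviation closed_cell :: "'e \<Rightarrow> nat \<Rightarrow> real set" where
  "closed_cell e i \<equiv> {node N D e (i-1)..node N D e i}"

lemma cell_subset:
  assumes "e \<in> arcs (net N)" "i \<in> {1..cells D e}"
  shows "closed_cell e i \<subseteq> {0..edge_len N e}" "cell e i \<subseteq> {0..edge_len N e}"
proof -
  show "closed_cell e i \<subseteq> {0..edge_len N e}"
    using node_mono[OF assms(1), of 0 "i-1"] node_mono[OF assms(1), of i "cells D e"] assms
      node_cells[OF assms(1)] node_0[of e] by auto
  then show "cell e i \<subseteq> {0..edge_len N e}" by (auto simp: cell_def)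
qed

lemma cells_disjoint:
  assumes e: "e \<in> arcs (net N)" and "s \<in> cell e i" "s \<in> cell e j" "1 \<le> i" "1 \<le> j"
  shows "i = j"
proof (rule ccontr)
  assume "i \<noteq> j"
  then have "i \<le> j - 1 \<or> j \<le> i - 1" by auto
  then have "node N D e i \<le> node N D e (j-1) \<or> node N D e j \<le> node N D e (i-1)"
    using node_mono[OF e] by blast
  then show False using assms by (auto simp: cell_def)
qed

lemma V1_iff: "v \<in> V1 N D e \<longleftrightarrow>
     (\<forall>i\<in>{1..cells D e}. \<exists>p. degree p \<le> deg1 D e \<and> (\<forall>s\<in>cell e i. v s = poly p s)) \<and>
     (\<forall>s. s \<notin> (\<Union>i\<in>{1..cells D e}. cell e i) \<longrightarrow> v s = 0)"
  by (simp add: V1_def cell_def)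

lemma V1_poly:
  assumes "v \<in> V1 N D e" "i \<in> {1..cells D e}"
  obtains p where "degree p \<le> deg1 D e" "\<And>s. s \<in> cell e i \<Longrightarrow> v s = poly p s"
  using assms unfolding V1_iff by blast

lemma V1_deriv:
  assumes p: "\<And>s. s \<in> cell e i \<Longrightarrow> v s = poly p s" and s: "s \<in> cell e i"
  shows "deriv v s = poly (pderiv p) s"
proof (rule DERIV_imp_deriv)
  have "(poly p has_field_derivative poly (pderiv p) s) (at s)" by (rule poly_DERIV)
  then show "(v has_field_derivative poly (pderiv p) s) (at s)"
    by (rule has_field_derivative_transform_within_open[of _ _ _ "cell e i"])
      (use s p in \<open>auto simp: cell_def\<close>)
qed

lemma subspace_V1: "subspace (V1 N D e)"
proof (rule subspaceI)
  show 0: "0 \<in> V1 N D e" unfolding V1_iff by (auto intro!: exI[of _ 0])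
  have lc: "u + c *\<^sub>R v \<in> V1 N D e" if u: "u \<in> V1 N D e" and v: "v \<in> V1 N D e" for u v c
  proof -
    have "\<exists>r. degree r \<le> deg1 D e \<and> (\<forall>s\<in>cell e i. (u + c *\<^sub>R v) s = poly r s)"
      if i: "i \<in> {1..cells D e}" for i
    proof -
      obtain p where p: "degree p \<le> deg1 D e" "\<And>s. s \<in> cell e i \<Longrightarrow> u s = poly p s"
        using V1_poly[OF u i] by blast
      obtain q where q: "degree q \<le> deg1 D e" "\<And>s. s \<in> cell e i \<Longrightarrow> v s = poly q s"
        using V1_poly[OF v i] by blast
      have "degree (p + smult c q) \<le> deg1 D e"
        using p(1) q(1) degree_smult_le[of c q] by (intro degree_add_le) auto
      then show ?thesis using p(2) q(2) by (intro exI[of _ "p + smult c q"]) auto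
    qed
    then show ?thesis using u v unfolding V1_iff by auto
  qed
  show "u + v \<in> V1 N D e" if "u \<in> V1 N D e" "v \<in> V1 N D e" for u v using lc[OF that, of 1] by simp
  show "c *\<^sub>R u \<in> V1 N D e" if "u \<in> V1 N D e" for c u using lc[OF 0 that, of c] by simp
qed

lemma V1_expansion:
  assumes e: "e \<in> arcs (net N)" and v: "v \<in> V1 N D e"
  obtains c where "\<And>s. v s = (\<Sum>i\<in>{1..cells D e}. \<Sum>j\<le>deg1 D e. c i j * (indicator (cell e i) s * s ^ j))"
proof -
  have "\<forall>i\<in>{1..cells D e}. \<exists>a. \<forall>s\<in>cell e i. v s = (\<Sum>j\<le>deg1 D e. a j * s ^ j)"
  proof
    fix i assume i: "i \<in> {1..cells D e}"
    obtain p where p: "degree p \<le> deg1 D e" "\<And>s. s \<in> cell e i \<Longrightarrow> v s = poly p s"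
      using V1_poly[OF v i] by blast
    have "poly p s = (\<Sum>j\<le>deg1 D e. coeff p j * s ^ j)" for s
    proof -
      have "poly p s = (\<Sum>j\<le>degree p. coeff p j * s ^ j)" by (rule poly_altdef)
      also have "\<dots> = (\<Sum>j\<le>deg1 D e. coeff p j * s ^ j)"
        using p(1) by (intro sum.mono_neutral_left) (auto simp: coeff_eq_0)
      finally show ?thesis .
    qed
    then show "\<exists>a. \<forall>s\<in>cell e i. v s = (\<Sum>j\<le>deg1 D e. a j * s ^ j)" using p(2) by metis
  qed
  then obtain c where c: "\<And>i s. i \<in> {1..cells D e} \<Longrightarrow> s \<in> cell e i \<Longrightarrow>
      v s = (\<Sum>j\<le>deg1 D e. c i j * s ^ j)"
    by metis
  have "v s = (\<Sum>i\<in>{1..cells D e}. \<Sum>j\<le>deg1 D e. c i j * (indicator (cell e i) s * s ^ j))"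
    (is "_ = (\<Sum>i\<in>_. ?f i)") for s
  proof (cases "\<exists>i\<in>{1..cells D e}. s \<in> cell e i")
    case True
    then obtain i where i: "i \<in> {1..cells D e}" "s \<in> cell e i" by blast
    have "?f j = 0" if "j \<in> {1..cells D e} - {i}" for j
    proof -
      have "s \<notin> cell e j" using cells_disjoint[OF e i(2), of j] i(1) that by auto
      then show ?thesis by simp
    qed
    then have "(\<Sum>i\<in>{1..cells D e}. ?f i) = ?f i"
      using sum.mono_neutral_right[of "{1..cells D e}" "{i}" ?f] i(1) by simp
    then show ?thesis using c[OF i] i(2) by simp
  next
    case False
    then have "v s = 0" using v unfolding V1_iff by blast
    moreover have "?f i = 0" if "i \<in> {1..cells D e}" for i using False that by simp
    ultimately show ?thesis by simp
  qed
  then show ?thesis using that by blast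
qed

lemma finite_dim_V1:
  assumes e: "e \<in> arcs (net N)"
  shows "finite_dim (V1 N D e)"
proof -
  define b where "b = (\<lambda>i j s. indicator (cell e i) s * s ^ j :: real)"
  define B where "B = (\<lambda>(i, j). b i j) ` ({1..cells D e} \<times> {..deg1 D e})"
  have "v \<in> span B" if v: "v \<in> V1 N D e" for v
  proof -
    obtain c where c: "\<And>s. v s = (\<Sum>i\<in>{1..cells D e}. \<Sum>j\<le>deg1 D e. c i j * (indicator (cell e i) s * s ^ j))"
      using V1_expansion[OF e v] by blast
    have eq: "v = (\<Sum>i\<in>{1..cells D e}. \<Sum>j\<le>deg1 D e. c i j *\<^sub>R b i j)"
      by (simp add: fun_eq_iff sum_fun_apply c b_def)
    have "b i j \<in> B" if "i \<in> {1..cells D e}" "j \<in> {..deg1 D e}" for i j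
      unfolding B_def by (rule image_eqI[of _ _ "(i, j)"]) (use that in auto)
    then show ?thesis unfolding eq by (intro span_sum span_scale span_base)
  qed
  moreover have "finite B" unfolding B_def by blast
  ultimately show ?thesis unfolding finite_dim_def by blast
qed

lemma V1_deriv_lincomb:
  assumes "u \<in> V1 N D e" "v \<in> V1 N D e" "i \<in> {1..cells D e}" "s \<in> cell e i"
  shows "deriv (u + c *\<^sub>R v) s = deriv u s + c * deriv v s"
proof -
  obtain p where p: "degree p \<le> deg1 D e" "\<And>s. s \<in> cell e i \<Longrightarrow> u s = poly p s"
    using V1_poly[OF assms(1,3)] by blast
  obtain q where q: "degree q \<le> deg1 D e" "\<And>s. s \<in> cell e i \<Longrightarrow> v s = poly q s"
    using V1_poly[OF assms(2,3)] by blast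
  have "deriv (u + c *\<^sub>R v) s = poly (pderiv (p + smult c q)) s"
    by (rule V1_deriv[OF _ assms(4)]) (simp add: p(2) q(2))
  then show ?thesis
    using V1_deriv[OF p(2) assms(4)] V1_deriv[OF q(2) assms(4)] by (simp add: pderiv_add pderiv_smult)
qed

text \<open>
  At an end of a cell only the one-sided limit from within the cell matters, so an end is represented
  by the corresponding filter. This treats nodes from the left, nodes from the right and the two
  vertices of the edge at once.
\<close>

definition cell_ends :: "'e \<Rightarrow> nat \<Rightarrow> real filter set" where
  "cell_ends e i = {at_right (node N D e (i-1)), at_left (node N D e i)}"

lemma cell_ends_eventually:
  assumes "e \<in> arcs (net N)" "i \<in> {1..cells D e}" "F \<in> cell_ends e i"
  shows "F \<noteq> bot" "eventually (\<lambda>s. s \<in> cell e i) F"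
proof -
  show "F \<noteq> bot" using assms(3) unfolding cell_ends_def
    by (metis insertE singletonD trivial_limit_at_left_real trivial_limit_at_right_real)
  show "eventually (\<lambda>s. s \<in> cell e i) F"
    using assms(3) node_less[OF assms(1,2)] eventually_at_right_real eventually_at_left_real
    unfolding cell_ends_def cell_def by blast
qed

lemma continuous_cell_end:
  fixes f :: "real \<Rightarrow> real"
  assumes e: "e \<in> arcs (net N)" and i: "i \<in> {1..cells D e}" and F: "F \<in> cell_ends e i"
    and f: "continuous_on (closed_cell e i) f"
  shows "\<exists>l. (f \<longlongrightarrow> l) F"
proof -
  have lt: "node N D e (i-1) < node N D e i" using node_less[OF e i] .
  then have "(f \<longlongrightarrow> f (node N D e (i-1))) (at_right (node N D e (i-1)))"
    "(f \<longlongrightarrow> f (node N D e i)) (at_left (node N D e i))"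
    using f by (auto simp: continuous_on_Icc_at_rightD continuous_on_Icc_at_leftD)
  then show ?thesis using F by (auto simp: cell_ends_def)
qed

lemma V1_limits:
  assumes e: "e \<in> arcs (net N)" and i: "i \<in> {1..cells D e}" and F: "F \<in> cell_ends e i" and v: "v \<in> V1 N D e"
  shows "\<exists>l. (v \<longlongrightarrow> l) F" "\<exists>l. (flux N e v \<longlongrightarrow> l) F"
proof -
  obtain p where p: "degree p \<le> deg1 D e" "\<And>s. s \<in> cell e i \<Longrightarrow> v s = poly p s"
    using V1_poly[OF v i] by blast
  let ?I = "closed_cell e i"
  have A: "continuous_on ?I (area N e)"
    using continuous_on_subset[OF area_continuous[OF e] cell_subset(1)[OF e i]] .
  obtain l where l: "(poly p \<longlongrightarrow> l) F"
    using continuous_cell_end[OF e i F, of "poly p"] continuous_on_poly[OF continuous_on_id] by auto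
  obtain m where m: "((\<lambda>s. area N e s * poly (pderiv p) s) \<longlongrightarrow> m) F"
    using continuous_cell_end[OF e i F continuous_on_mult[OF A continuous_on_poly[OF continuous_on_id]]]
    by auto
  have ev: "eventually (\<lambda>s. s \<in> cell e i) F" using cell_ends_eventually[OF e i F] by simp
  have "(v \<longlongrightarrow> l) F"
    by (rule Lim_transform_eventually[OF l]) (use ev in \<open>auto elim: eventually_mono simp: p(2)\<close>)
  moreover have "(flux N e v \<longlongrightarrow> m) F"
    by (rule Lim_transform_eventually[OF m])
      (use ev in \<open>auto elim: eventually_mono simp: flux_def V1_deriv[OF p(2)]\<close>)
  ultimately show "\<exists>l. (v \<longlongrightarrow> l) F" "\<exists>l. (flux N e v \<longlongrightarrow> l) F" by auto
qed

lemma linear_cell_end: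
  assumes e: "e \<in> arcs (net N)" and i: "i \<in> {1..cells D e}" and F: "F \<in> cell_ends e i"
  shows "linear_form_on (V1 N D e) (\<lambda>v. Lim F v)" "linear_form_on (V1 N D e) (\<lambda>v. Lim F (flux N e v))"
proof -
  note ev = cell_ends_eventually[OF e i F]
  show "linear_form_on (V1 N D e) (\<lambda>v. Lim F v)"
    by (rule linear_form_on_Lim[OF ev(1)]) (use V1_limits[OF e i F] in auto)
  show "linear_form_on (V1 N D e) (\<lambda>v. Lim F (flux N e v))"
  proof (rule linear_form_on_Lim[OF ev(1)])
    show "\<exists>l. (flux N e u \<longlongrightarrow> l) F" if "u \<in> V1 N D e" for u using V1_limits[OF e i F that] by simp
    show "eventually (\<lambda>x. flux N e (u + c *\<^sub>R v) x = flux N e u x + c * flux N e v x) F"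
      if "u \<in> V1 N D e" "v \<in> V1 N D e" for u v c
      using ev(2) by (rule eventually_mono) (simp add: flux_def V1_deriv_lincomb[OF that i] algebra_simps)
  qed
qed

lemma interior_node_ends:
  assumes "i \<in> {1..cells D e - 1}"
  shows "i \<in> {1..cells D e}" "i + 1 \<in> {1..cells D e}"
    "at_left (node N D e i) \<in> cell_ends e i" "at_right (node N D e i) \<in> cell_ends e (i + 1)"
  using assms by (auto simp: cell_ends_def)

lemma linear_node:
  assumes e: "e \<in> arcs (net N)" and i: "i \<in> {1..cells D e - 1}"
  shows "linear_form_on (V1 N D e) (\<lambda>v. node_jump v (node N D e i))"
    "linear_form_on (V1 N D e) (\<lambda>v. node_mean (flux N e v) (node N D e i))"
proof -
  note n = interior_node_ends[OF i]
  show "linear_form_on (V1 N D e) (\<lambda>v. node_jump v (node N D e i))"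
    unfolding node_jump_def
    by (intro linear_form_on_diff linear_cell_end(1)[OF e n(1,3)] linear_cell_end(1)[OF e n(2,4)])
  have "linear_form_on (V1 N D e) (\<lambda>v. (1/2) *
      (Lim (at_left (node N D e i)) (flux N e v) + Lim (at_right (node N D e i)) (flux N e v)))"
    by (intro linear_form_on_cmult linear_form_on_add linear_cell_end(2)[OF e n(1,3)]
        linear_cell_end(2)[OF e n(2,4)])
  then show "linear_form_on (V1 N D e) (\<lambda>v. node_mean (flux N e v) (node N D e i))"
    by (simp add: node_mean_def)
qed

lemma vertex_end:
  assumes e: "e \<in> arcs (net N)"
  obtains i F where "i \<in> {1..cells D e}" "F \<in> cell_ends e i" "\<And>g. at_vertex N e v g = Lim F g"
proof (cases "v = tail (net N) e")
  case True
  then show ?thesis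
    using that[of 1 "at_right 0"] cells[OF e] by (simp add: cell_ends_def node_0 at_vertex_def)
next
  case False
  then show ?thesis
    using that[of "cells D e" "at_left (edge_len N e)"] cells[OF e] node_cells[OF e]
    by (simp add: cell_ends_def at_vertex_def)
qed

lemma linear_vertex:
  assumes e: "e \<in> arcs (net N)"
  shows "linear_form_on (V1 N D e) (at_vertex N e v)"
    "linear_form_on (V1 N D e) (\<lambda>w. at_vertex N e v (flux N e w))"
proof -
  obtain i F where iF: "i \<in> {1..cells D e}" "F \<in> cell_ends e i" "\<And>g. at_vertex N e v g = Lim F g"
    using vertex_end[OF e] by metis
  have "at_vertex N e v = Lim F" using iF(3) by blast
  then show "linear_form_on (V1 N D e) (at_vertex N e v)"
    "linear_form_on (V1 N D e) (\<lambda>w. at_vertex N e v (flux N e w))"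
    using linear_cell_end[OF e iF(1,2)] by auto
qed

definition edge_dirichlet :: "'e \<Rightarrow> (real \<Rightarrow> real) \<Rightarrow> (real \<Rightarrow> real) \<Rightarrow> real" where
  "edge_dirichlet e u v = (\<Sum>i=1..cells D e. LINT s|lebesgue_on (closed_cell e i).
     area N e s * deriv u s * deriv v s)"

lemma integrable_cell_spike:
  assumes e: "e \<in> arcs (net N)" and i: "i \<in> {1..cells D e}"
    and f: "\<And>s. s \<in> cell e i \<Longrightarrow> f s = g s" and g: "continuous_on (closed_cell e i) g"
  shows "integrable (lebesgue_on (closed_cell e i)) f"
    "(LINT s|lebesgue_on (closed_cell e i). f s) =
     (LINT s|lebesgue_on (closed_cell e i). (g s :: real))"
proof -
  let ?I = "closed_cell e i"
  have g': "integrable (lebesgue_on ?I) g" by (rule integrable_lebesgue_on_compact[OF compact_Icc g])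
  have "f s = g s" if "s \<in> ?I - {node N D e (i-1), node N D e i}" for s
    using f that by (auto simp: cell_def)
  then have "integrable (lebesgue_on ?I) f \<and> (LINT s|lebesgue_on ?I. f s) = (LINT s|lebesgue_on ?I. g s)"
    by (intro integral_lebesgue_on_spike[OF _ _ _ g', of "{node N D e (i-1), node N D e i}"]) auto
  then show "integrable (lebesgue_on ?I) f" "(LINT s|lebesgue_on ?I. f s) = (LINT s|lebesgue_on ?I. g s)"
    by auto
qed

lemma edge_integrand:
  assumes e: "e \<in> arcs (net N)" and i: "i \<in> {1..cells D e}" and u: "u \<in> V1 N D e" and v: "v \<in> V1 N D e"
  shows "\<exists>g. continuous_on (closed_cell e i) g \<and>
    (\<forall>s\<in>cell e i. area N e s * deriv u s * deriv v s = g s)"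
proof -
  obtain p where p: "degree p \<le> deg1 D e" "\<And>s. s \<in> cell e i \<Longrightarrow> u s = poly p s"
    using V1_poly[OF u i] by blast
  obtain q where q: "degree q \<le> deg1 D e" "\<And>s. s \<in> cell e i \<Longrightarrow> v s = poly q s"
    using V1_poly[OF v i] by blast
  have A: "continuous_on (closed_cell e i) (area N e)"
    using continuous_on_subset[OF area_continuous[OF e] cell_subset(1)[OF e i]] .
  show ?thesis
    using A by (intro exI[of _ "\<lambda>s. area N e s * poly (pderiv p) s * poly (pderiv q) s"])
      (auto intro!: continuous_intros simp: V1_deriv[OF p(2)] V1_deriv[OF q(2)])
qed

lemma psd_edge_dirichlet:
  assumes e: "e \<in> arcs (net N)"
  shows "psd_form_on (V1 N D e) (edge_dirichlet e)"
proof -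
  have int: "integrable (lebesgue_on (closed_cell e i)) (\<lambda>s. area N e s * deriv u s * deriv v s)"
    if i: "i \<in> {1..cells D e}" and uv: "u \<in> V1 N D e" "v \<in> V1 N D e" for i u v
  proof -
    obtain g where g: "continuous_on (closed_cell e i) g"
      "\<forall>s\<in>cell e i. area N e s * deriv u s * deriv v s = g s"
      using edge_integrand[OF e i uv] by blast
    show ?thesis by (rule integrable_cell_spike(1)[OF e i _ g(1)]) (use g(2) in blast)
  qed
  have lin: "edge_dirichlet e (u + c *\<^sub>R v) w = edge_dirichlet e u w + c * edge_dirichlet e v w"
    if S: "u \<in> V1 N D e" "v \<in> V1 N D e" "w \<in> V1 N D e" for u v w c
  proof -
    have "(LINT s|lebesgue_on (closed_cell e i). area N e s * deriv (u + c *\<^sub>R v) s * deriv w s) =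
        (LINT s|lebesgue_on (closed_cell e i). area N e s * deriv u s * deriv w s) +
        c * (LINT s|lebesgue_on (closed_cell e i). area N e s * deriv v s * deriv w s)"
      (is "(LINT s|?M. ?f s) = _")
      if i: "i \<in> {1..cells D e}" for i
    proof -
      let ?g = "\<lambda>s. area N e s * deriv u s * deriv w s + c * (area N e s * deriv v s * deriv w s)"
      have "(LINT s|?M. ?f s) = (LINT s|?M. ?g s)"
      proof -
        have g: "integrable ?M ?g" using int[OF i S(1,3)] int[OF i S(2,3)] by simp
        have "?f s = ?g s" if "s \<in> closed_cell e i - {node N D e (i-1), node N D e i}" for s
        proof -
          have "s \<in> cell e i" using that by (auto simp: cell_def)
          then show ?thesis using V1_deriv_lincomb[OF S(1,2) i, of s c] by (simp add: algebra_simps)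
        qed
        then have "integrable ?M ?f \<and> (LINT s|?M. ?f s) = (LINT s|?M. ?g s)"
          by (intro integral_lebesgue_on_spike[OF _ _ _ g, of "{node N D e (i-1), node N D e i}"]) auto
        then show ?thesis by simp
      qed
      also have "\<dots> = (LINT s|?M. area N e s * deriv u s * deriv w s) +
        c * (LINT s|?M. area N e s * deriv v s * deriv w s)"
        using int[OF i S(1,3)] int[OF i S(2,3)] by simp
      finally show ?thesis .
    qed
    then show ?thesis by (simp add: edge_dirichlet_def sum.distrib sum_distrib_left)
  qed
  show ?thesis
  proof (rule psd_form_onI, rule lin)
    show "edge_dirichlet e u v = edge_dirichlet e v u" for u v
      by (simp add: edge_dirichlet_def algebra_simps)
    show "0 \<le> edge_dirichlet e u u" for u
      unfolding edge_dirichlet_def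
    proof (intro sum_nonneg Bochner_Integration.integral_nonneg)
      fix i s assume "i \<in> {1..cells D e}" "s \<in> space (lebesgue_on (closed_cell e i))"
      then have "s \<in> {0..edge_len N e}" using cell_subset(1)[OF e, of i] by auto
      then show "0 \<le> area N e s * deriv u s * deriv u s"
        using area_pos[OF e, of s] by (simp add: mult.assoc)
    qed
  qed
qed

text \<open>
  The area is positive, so the derivative vanishes inside the cells and the flux has limit \<open>0\<close> at their
  ends.
\<close>

lemma edge_dirichlet_zero:
  assumes e: "e \<in> arcs (net N)" and i: "i \<in> {1..cells D e}" and F: "F \<in> cell_ends e i"
    and u: "u \<in> V1 N D e" and z: "edge_dirichlet e u u = 0"
  shows "Lim F (flux N e u) = 0"
proof -
  let ?I = "\<lambda>i. (closed_cell e i)"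
  let ?f = "\<lambda>s. area N e s * deriv u s * deriv u s"
  have nn: "0 \<le> ?f s" if "i \<in> {1..cells D e}" "s \<in> ?I i" for i s
    using area_pos[OF e, of s] cell_subset(1)[OF e that(1)] that(2) by (auto simp: mult.assoc)
  have "0 \<le> (LINT s|lebesgue_on (?I i). ?f s)" if "i \<in> {1..cells D e}" for i
    using nn[OF that] by (intro Bochner_Integration.integral_nonneg) simp
  then have zi: "(LINT s|lebesgue_on (?I i). ?f s) = 0"
    using z i unfolding edge_dirichlet_def by (subst (asm) sum_nonneg_eq_0_iff) auto
  obtain g where g: "continuous_on (?I i) g" "\<And>s. s \<in> cell e i \<Longrightarrow> ?f s = g s"
    using edge_integrand[OF e i u u] by metis
  have sub: "cell e i \<subseteq> ?I i" by (auto simp: cell_def)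
  have f0: "?f s = 0" if "s \<in> cell e i" for s
  proof -
    have "g s = 0"
      by (rule integral_zero_imp_zero[OF _ integrable_cell_spike(1)[OF e i g(2,1)] nn[OF i] zi _ sub g(2)
            continuous_on_subset[OF g(1) sub] that]) (auto simp: cell_def)
    then show ?thesis using g(2)[OF that] by simp
  qed
  have "flux N e u s = 0" if "s \<in> cell e i" for s
    using f0[OF that] area_pos[OF e, of s] cell_subset(2)[OF e i] that by (auto simp: flux_def)
  then have "eventually (\<lambda>s. flux N e u s = 0) F"
    using cell_ends_eventually(2)[OF e i F] by (auto elim: eventually_mono)
  then have "(flux N e u \<longlongrightarrow> 0) F" by (rule tendsto_eventually)
  then show ?thesis using tendsto_Lim cell_ends_eventually(1)[OF e i F] by blast
qed

lemma ae_form_eq: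
  "ae_form N D \<epsilon> \<sigma> e u v = edge_dirichlet e u v
     - (\<Sum>i=1..cells D e - 1. node_mean (flux N e u) (node N D e i) * node_jump v (node N D e i))
     + \<epsilon> * (\<Sum>i=1..cells D e - 1. node_mean (flux N e v) (node N D e i) * node_jump u (node N D e i))
     + (\<Sum>i=1..cells D e - 1. \<sigma> e / cell_size N D e * (node_jump u (node N D e i) * node_jump v (node N D e i)))"
  by (simp add: ae_form_def edge_dirichlet_def mult.assoc)

lemma bilinear_ae_form:
  assumes e: "e \<in> arcs (net N)"
  shows "bilinear_form_on (V1 N D e) (ae_form N D \<epsilon> \<sigma> e)"
proof -
  have "bilinear_form_on (V1 N D e) (edge_dirichlet e)"
    using psd_edge_dirichlet[OF e] by (simp add: psd_form_on_def)
  then show ?thesis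
    unfolding ae_form_eq[abs_def]
    by (intro bilinear_form_on_add bilinear_form_on_diff bilinear_form_on_cmult bilinear_form_on_sum
        bilinear_form_on_mult linear_node[OF e]
        bilinear_form_on_swap[OF bilinear_form_on_mult[OF linear_node(2)[OF e] linear_node(1)[OF e]]])
qed

section \<open>Positivity of the network forms\<close>

text \<open>
  The spaces \<open>VG\<close> and \<open>VB\<close> consist of functions that are \<open>undefined\<close> outside the edges and the
  bifurcations, and sums of \<open>undefined\<close> are not controlled. Extension by zero gives vector spaces.
\<close>

definition VG0 :: "('e \<Rightarrow> real \<Rightarrow> real) set" where
  "VG0 = {uh. (\<forall>e\<in>arcs (net N). uh e \<in> V1 N D e) \<and> (\<forall>e. e \<notin> arcs (net N) \<longrightarrow> uh e = 0)}"

definition VB0 :: "(real^3 \<Rightarrow> real) set" where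
  "VB0 = {ut. \<forall>v. v \<notin> bifurcations N \<longrightarrow> ut v = 0}"

lemma subspace_VG0: "subspace VG0"
  using subspace_V1 by (auto simp: VG0_def subspace_def)

lemma subspace_VB0: "subspace VB0"
  by (auto simp: VB0_def subspace_def)

lemma finite_dim_VG0: "finite_dim VG0"
proof -
  have "\<forall>e\<in>arcs (net N). \<exists>B. finite B \<and> V1 N D e \<subseteq> span B"
    using finite_dim_V1 by (simp add: finite_dim_def)
  then obtain B where B: "\<And>e. e \<in> arcs (net N) \<Longrightarrow> finite (B e) \<and> V1 N D e \<subseteq> span (B e)"
    by metis
  define emb :: "'e \<Rightarrow> (real \<Rightarrow> real) \<Rightarrow> 'e \<Rightarrow> real \<Rightarrow> real" where "emb = (\<lambda>e v e'. if e' = e then v else 0)"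
  have lin: "linear (emb e)" for e
    by (intro linearI) (auto simp: emb_def fun_eq_iff)
  define C where "C = (\<Union>e\<in>arcs (net N). emb e ` B e)"
  have "uh \<in> span C" if uh: "uh \<in> VG0" for uh
  proof -
    have "uh = (\<Sum>e\<in>arcs (net N). emb e (uh e))"
    proof
      fix e'
      have "(\<Sum>e\<in>arcs (net N). emb e (uh e)) e' = (\<Sum>e\<in>arcs (net N). if e = e' then uh e' else 0)"
        unfolding sum_fun_apply[of _ _ e'] by (intro sum.cong) (auto simp: emb_def)
      also have "\<dots> = uh e'" using uh finite_arcs by (simp add: VG0_def)
      finally show "uh e' = (\<Sum>e\<in>arcs (net N). emb e (uh e)) e'" ..
    qed
    moreover have "emb e (uh e) \<in> span C" if e: "e \<in> arcs (net N)" for e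
    proof -
      have "uh e \<in> span (B e)" using B[OF e] uh e by (auto simp: VG0_def)
      then have "emb e (uh e) \<in> span (emb e ` B e)" unfolding linear_span_image[OF lin] by blast
      then show ?thesis using span_mono[of "emb e ` B e" C] e by (auto simp: C_def)
    qed
    ultimately show ?thesis using span_sum[of "arcs (net N)" "\<lambda>e. emb e (uh e)" C] by simp
  qed
  moreover have "finite C" unfolding C_def using B finite_arcs by blast
  ultimately show ?thesis unfolding finite_dim_def by blast
qed

lemma finite_dim_VB0: "finite_dim VB0"
proof -
  define b :: "real^3 \<Rightarrow> real^3 \<Rightarrow> real" where "b = (\<lambda>v x. if x = v then 1 else 0)"
  have "ut \<in> span (b ` bifurcations N)" if ut: "ut \<in> VB0" for ut
  proof -
    have "ut = (\<Sum>v\<in>bifurcations N. ut v *\<^sub>R b v)"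
    proof
      fix x
      have "(\<Sum>v\<in>bifurcations N. ut v *\<^sub>R b v) x = (\<Sum>v\<in>bifurcations N. if v = x then ut x else 0)"
        unfolding sum_fun_apply[of _ _ x] by (intro sum.cong) (auto simp: b_def)
      also have "\<dots> = ut x" using ut finite_bifurcations by (simp add: VB0_def)
      finally show "ut x = (\<Sum>v\<in>bifurcations N. ut v *\<^sub>R b v) x" ..
    qed
    moreover have "(\<Sum>v\<in>bifurcations N. ut v *\<^sub>R b v) \<in> span (b ` bifurcations N)"
      by (intro span_sum span_scale span_base) auto
    ultimately show ?thesis by simp
  qed
  then show ?thesis unfolding finite_dim_def using finite_bifurcations by blast
qed

lemma VG0_edge: "uh \<in> VG0 \<Longrightarrow> e \<in> arcs (net N) \<Longrightarrow> uh e \<in> V1 N D e"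
  by (simp add: VG0_def)

lemma linear_form_on_edge:
  "e \<in> arcs (net N) \<Longrightarrow> linear_form_on (V1 N D e) l \<Longrightarrow> linear_form_on VG0 (\<lambda>uh. l (uh e))"
  by (rule linear_form_on_compose[of "V1 N D e" l]) (auto simp: VG0_edge)

definition network_dirichlet :: "('e \<Rightarrow> real \<Rightarrow> real) \<Rightarrow> ('e \<Rightarrow> real \<Rightarrow> real) \<Rightarrow> real" where
  "network_dirichlet uh vh = (\<Sum>e\<in>arcs (net N). edge_dirichlet e (uh e) (vh e))"

text \<open>
  All fluxes that occur in the consistency terms: the means at the interior nodes and the values at
  the bifurcations.
\<close>

definition network_flux :: "('e \<Rightarrow> real \<Rightarrow> real) \<Rightarrow> ('e \<Rightarrow> real \<Rightarrow> real) \<Rightarrow> real" where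
  "network_flux uh vh =
     (\<Sum>e\<in>arcs (net N). \<Sum>i=1..cells D e - 1.
        node_mean (flux N e (uh e)) (node N D e i) * node_mean (flux N e (vh e)) (node N D e i))
     + (\<Sum>v\<in>bifurcations N. \<Sum>e\<in>edges_at N v.
        at_vertex N e v (flux N e (uh e)) * at_vertex N e v (flux N e (vh e)))"

lemma network_flux_dominated: "\<exists>C>0. \<forall>uh\<in>VG0. network_flux uh uh \<le> C * network_dirichlet uh uh"
proof (rule psd_form_dominated[OF finite_dim_VG0 subspace_VG0, of network_dirichlet network_flux])
  show "psd_form_on VG0 network_dirichlet"
    unfolding network_dirichlet_def[abs_def]
    by (intro psd_form_on_sum psd_form_on_compose[OF psd_edge_dirichlet]) (auto simp: VG0_edge)
  have "linear_form_on VG0 (\<lambda>uh. node_mean (flux N e (uh e)) (node N D e i))"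
    if "e \<in> arcs (net N)" "i \<in> {1..cells D e - 1}" for e i
    using linear_form_on_edge[OF that(1) linear_node(2)[OF that]] .
  moreover have "linear_form_on VG0 (\<lambda>uh. at_vertex N e v (flux N e (uh e)))"
    if "e \<in> edges_at N v" for e v
  proof -
    have e: "e \<in> arcs (net N)" using that edges_at_arcs by blast
    show ?thesis using linear_form_on_edge[OF e linear_vertex(2)[OF e]] .
  qed
  ultimately show "psd_form_on VG0 network_flux"
    unfolding network_flux_def[abs_def]
    by (intro psd_form_on_add psd_form_on_sum psd_form_on_square)
next
  fix uh assume uh: "uh \<in> VG0" and z: "network_dirichlet uh uh = 0"
  have ze: "edge_dirichlet e (uh e) (uh e) = 0" if e: "e \<in> arcs (net N)" for e
  proof -
    have "0 \<le> edge_dirichlet e (uh e) (uh e)" if "e \<in> arcs (net N)" for e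
      using psd_edge_dirichlet[OF that] VG0_edge[OF uh that] by (simp add: psd_form_on_def)
    then show ?thesis
      using z e finite_arcs unfolding network_dirichlet_def by (subst (asm) sum_nonneg_eq_0_iff) auto
  qed
  have "node_mean (flux N e (uh e)) (node N D e i) = 0"
    if e: "e \<in> arcs (net N)" and i: "i \<in> {1..cells D e - 1}" for e i
  proof -
    note n = interior_node_ends[OF i] and z = edge_dirichlet_zero[OF e _ _ VG0_edge[OF uh e] ze[OF e]]
    show ?thesis unfolding node_mean_def z[OF n(1,3)] z[OF n(2,4)] by simp
  qed
  moreover have "at_vertex N e v (flux N e (uh e)) = 0" if e': "e \<in> edges_at N v" for e v
  proof -
    have e: "e \<in> arcs (net N)" using e' edges_at_arcs by blast
    obtain i F where iF: "i \<in> {1..cells D e}" "F \<in> cell_ends e i" "\<And>g. at_vertex N e v g = Lim F g"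
      using vertex_end[OF e] by metis
    show ?thesis unfolding iF(3) using edge_dirichlet_zero[OF e iF(1,2) VG0_edge[OF uh e] ze[OF e]] .
  qed
  ultimately show "network_flux uh uh = 0" by (simp add: network_flux_def)
qed

text \<open>
  \<open>k * m * j\<close> is a consistency term with flux \<open>m\<close> and jump \<open>j\<close>, and \<open>s\<close> the penalty. The flux is paid
  for with weight \<open>1 / C\<close>, so that its total stays below the Dirichlet form.
\<close>

lemma young_product:
  fixes m j :: real
  assumes "C > 0" "\<bar>k\<bar> \<le> 2" "C \<le> s"
  shows "k * m * j + s * (j * j) \<ge> - (m * m) / C"
proof -
  have "\<bar>k * m * j\<bar> \<le> 2 * (\<bar>m\<bar> * \<bar>j\<bar>)"
    using mult_right_mono[OF assms(2), of "\<bar>m\<bar> * \<bar>j\<bar>"] by (simp add: abs_mult mult.assoc)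
  also have "\<dots> \<le> m * m / C + C * (j * j)"
  proof -
    have "0 \<le> (\<bar>m\<bar> - C * \<bar>j\<bar>)\<^sup>2 / C" using assms by simp
    also have "\<dots> = \<bar>m\<bar> * \<bar>m\<bar> / C - 2 * (\<bar>m\<bar> * \<bar>j\<bar>) + C * (\<bar>j\<bar> * \<bar>j\<bar>)"
    proof -
      have "(a - C * b)\<^sup>2 / C = a * a / C - 2 * (a * b) + C * (b * b)" for a b
        using assms(1) by (simp add: power2_eq_square field_simps)
      then show ?thesis .
    qed
    finally show ?thesis by simp
  qed
  finally have "- (k * m * j) \<le> m * m / C + C * (j * j)" by linarith
  moreover have "C * (j * j) \<le> s * (j * j)" using assms(3) by (intro mult_right_mono) auto
  ultimately show ?thesis by simp
qed

text \<open>
  Nonnegativity is all that can be expected: constants along the edges, with the same values at the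
  bifurcations, have zero energy. The exchange with the tissue removes them later. One domination
  over the whole network serves the nodes and the bifurcations, and with \<open>\<epsilon> = 1\<close> it is still
  needed for the latter, whose flux terms do not cancel.
\<close>

lemma network_forms_nonneg:
  obtains \<sigma>0 where "\<sigma>0 > 0"
    "\<And>\<epsilon> \<sigma>E \<sigma>V uh ut. \<epsilon> \<in> {-1, 0, 1} \<Longrightarrow>
       (\<And>e. e \<in> arcs (net N) \<Longrightarrow> \<sigma>E e > 0 \<and> (\<epsilon> \<noteq> 1 \<longrightarrow> \<sigma>E e \<ge> \<sigma>0)) \<Longrightarrow>
       (\<And>v. v \<in> bifurcations N \<Longrightarrow> \<sigma>V v \<ge> \<sigma>0) \<Longrightarrow> uh \<in> VG0 \<Longrightarrow>
       (\<Sum>e\<in>arcs (net N). ae_form N D \<epsilon> \<sigma>E e (uh e) (uh e))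
         + (\<Sum>v\<in>bifurcations N. bv_form N \<sigma>V v uh ut uh ut) \<ge> 0"
proof -
  obtain C where C: "C > 0" "\<And>uh. uh \<in> VG0 \<Longrightarrow> network_flux uh uh \<le> C * network_dirichlet uh uh"
    using network_flux_dominated by blast
  define \<sigma>0 where "\<sigma>0 = 1 + (\<Sum>e\<in>arcs (net N). C * (cell_size N D e + edge_len N e))"
  have nn: "0 \<le> C * (cell_size N D e + edge_len N e)" if "e \<in> arcs (net N)" for e
    using C(1) cell_size_pos[OF that] edge_len_pos[OF that] by simp
  have pos: "\<sigma>0 > 0" unfolding \<sigma>0_def using nn by (intro add_pos_nonneg sum_nonneg) auto
  have big: "C * cell_size N D e \<le> \<sigma>0" "C * edge_len N e \<le> \<sigma>0" if e: "e \<in> arcs (net N)" for e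
  proof -
    have "C * (cell_size N D e + edge_len N e) \<le> \<sigma>0"
    proof -
      have "C * (cell_size N D e + edge_len N e) \<le> (\<Sum>e\<in>arcs (net N). C * (cell_size N D e + edge_len N e))"
        by (rule member_le_sum[OF e _ finite_arcs]) (use nn in blast)
      then show ?thesis by (simp add: \<sigma>0_def)
    qed
    moreover have "C * (cell_size N D e + edge_len N e) = C * cell_size N D e + C * edge_len N e"
      by (rule distrib_left)
    moreover have "0 \<le> C * cell_size N D e" "0 \<le> C * edge_len N e"
      using C(1) cell_size_pos[OF e] edge_len_pos[OF e] by simp_all
    ultimately show "C * cell_size N D e \<le> \<sigma>0" "C * edge_len N e \<le> \<sigma>0" by linarith+
  qed
  have "(\<Sum>e\<in>arcs (net N). ae_form N D \<epsilon> \<sigma>E e (uh e) (uh e))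
         + (\<Sum>v\<in>bifurcations N. bv_form N \<sigma>V v uh ut uh ut) \<ge> 0"
    if \<epsilon>: "\<epsilon> \<in> {-1, 0, 1}" and \<sigma>E: "\<And>e. e \<in> arcs (net N) \<Longrightarrow> \<sigma>E e > 0 \<and> (\<epsilon> \<noteq> 1 \<longrightarrow> \<sigma>E e \<ge> \<sigma>0)"
      and \<sigma>V: "\<And>v. v \<in> bifurcations N \<Longrightarrow> \<sigma>V v \<ge> \<sigma>0" and uh: "uh \<in> VG0" for \<epsilon> \<sigma>E \<sigma>V uh ut
  proof -
    define m where "m e i = node_mean (flux N e (uh e)) (node N D e i)" for e i
    define j where "j e i = node_jump (uh e) (node N D e i)" for e i
    define a where "a e v = at_vertex N e v (flux N e (uh e))" for e v
    define d where "d e v = at_vertex N e v (uh e) - ut v" for e v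
    have ae: "ae_form N D \<epsilon> \<sigma>E e (uh e) (uh e) \<ge>
        edge_dirichlet e (uh e) (uh e) + (\<Sum>i=1..cells D e - 1. - (m e i * m e i) / C)"
      if e: "e \<in> arcs (net N)" for e
    proof -
      have "- (m e i * m e i) / C \<le> (\<epsilon> - 1) * m e i * j e i + \<sigma>E e / cell_size N D e * (j e i * j e i)" for i
      proof (cases "\<epsilon> = 1")
        case True
        have "0 \<le> m e i * m e i / C" "0 \<le> \<sigma>E e / cell_size N D e * (j e i * j e i)"
          using C(1) \<sigma>E[OF e] cell_size_pos[OF e] by simp_all
        then show ?thesis using True by simp
      next
        case False
        then have "C * cell_size N D e \<le> \<sigma>E e" using \<sigma>E[OF e] big(1)[OF e] by simp
        then have "C \<le> \<sigma>E e / cell_size N D e" using cell_size_pos[OF e] by (simp add: pos_le_divide_eq)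
        then show ?thesis using \<epsilon> by (intro young_product C) auto
      qed
      then have "(\<Sum>i=1..cells D e - 1. - (m e i * m e i) / C) \<le>
        (\<Sum>i=1..cells D e - 1. (\<epsilon> - 1) * m e i * j e i + \<sigma>E e / cell_size N D e * (j e i * j e i))"
        by (intro sum_mono)
      also have "\<dots> = (\<epsilon> - 1) * (\<Sum>i=1..cells D e - 1. m e i * j e i)
          + (\<Sum>i=1..cells D e - 1. \<sigma>E e / cell_size N D e * (j e i * j e i))"
        by (simp only: sum.distrib sum_distrib_left mult.assoc)
      finally show ?thesis
        unfolding ae_form_eq m_def[symmetric] j_def[symmetric] by (simp add: algebra_simps)
    qed
    have bv: "bv_form N \<sigma>V v uh ut uh ut \<ge> (\<Sum>e\<in>edges_at N v. - (a e v * a e v) / C)"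
      if v: "v \<in> bifurcations N" for v
    proof -
      have "- (a e v * a e v) / C \<le> (2 * edge_sign N e v) * a e v * d e v + \<sigma>V v / edge_len N e * (d e v * d e v)"
        if e': "e \<in> edges_at N v" for e
      proof -
        have e: "e \<in> arcs (net N)" using e' edges_at_arcs by blast
        have "C * edge_len N e \<le> \<sigma>V v" using \<sigma>V[OF v] big(2)[OF e] by simp
        then have "C \<le> \<sigma>V v / edge_len N e" using edge_len_pos[OF e] by (simp add: pos_le_divide_eq)
        then show ?thesis by (intro young_product C) (auto simp: edge_sign_def)
      qed
      then have "(\<Sum>e\<in>edges_at N v. - (a e v * a e v) / C) \<le>
        (\<Sum>e\<in>edges_at N v. (2 * edge_sign N e v) * a e v * d e v + \<sigma>V v / edge_len N e * (d e v * d e v))"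
        by (intro sum_mono)
      also have "\<dots> = bv_form N \<sigma>V v uh ut uh ut"
        unfolding bv_form_def a_def[symmetric] d_def[symmetric] sum.distrib[symmetric]
        by (intro sum.cong) (auto simp: algebra_simps)
      finally show ?thesis .
    qed
    have "(\<Sum>e\<in>arcs (net N). edge_dirichlet e (uh e) (uh e) + (\<Sum>i=1..cells D e - 1. - (m e i * m e i) / C))
        + (\<Sum>v\<in>bifurcations N. \<Sum>e\<in>edges_at N v. - (a e v * a e v) / C)
      \<le> (\<Sum>e\<in>arcs (net N). ae_form N D \<epsilon> \<sigma>E e (uh e) (uh e))
         + (\<Sum>v\<in>bifurcations N. bv_form N \<sigma>V v uh ut uh ut)"
      using ae bv by (intro add_mono sum_mono)
    moreover have "(\<Sum>e\<in>arcs (net N). edge_dirichlet e (uh e) (uh e) + (\<Sum>i=1..cells D e - 1. - (m e i * m e i) / C))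
        + (\<Sum>v\<in>bifurcations N. \<Sum>e\<in>edges_at N v. - (a e v * a e v) / C)
      = network_dirichlet uh uh - network_flux uh uh / C"
      unfolding network_dirichlet_def network_flux_def m_def[symmetric] a_def[symmetric]
      by (simp add: sum.distrib sum_subtractf sum_negf add_divide_distrib sum_divide_distrib)
    moreover have "network_flux uh uh / C \<le> network_dirichlet uh uh"
      using C(2)[OF uh] C(1) by (simp add: pos_divide_le_eq mult.commute)
    ultimately show ?thesis by linarith
  qed
  then show ?thesis using that pos by blast
qed

lemma at_vertex_zero: "e \<in> arcs (net N) \<Longrightarrow> at_vertex N e v 0 = 0"
  "e \<in> arcs (net N) \<Longrightarrow> at_vertex N e v (flux N e 0) = 0"
  using linear_form_on_zero[OF linear_vertex(1) subspace_V1] linear_form_on_zero[OF linear_vertex(2) subspace_V1]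
  by blast+

text \<open>
  Without network unknowns only the penalty remains, and a bifurcation has at least one edge.
\<close>

lemma bv_form_zero:
  assumes \<sigma>V: "\<And>v. v \<in> bifurcations N \<Longrightarrow> \<sigma>V v > 0" and ut: "ut \<in> VB0"
    and z: "(\<Sum>v\<in>bifurcations N. bv_form N \<sigma>V v 0 ut 0 ut) = 0"
  shows "ut = 0"
proof (rule ext)
  fix v
  have eq: "bv_form N \<sigma>V v 0 ut 0 ut = (\<Sum>e\<in>edges_at N v. \<sigma>V v / edge_len N e * (ut v * ut v))" for v
  proof -
    have "at_vertex N e v 0 = 0" "at_vertex N e v (flux N e 0) = 0" if "e \<in> edges_at N v" for e
      using that edges_at_arcs at_vertex_zero by blast+
    then show ?thesis by (simp add: bv_form_def mult.assoc)
  qed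
  have nn: "0 \<le> \<sigma>V v / edge_len N e * (ut v * ut v)" if "v \<in> bifurcations N" "e \<in> edges_at N v" for e v
  proof -
    have "edge_len N e > 0" using edge_len_pos[of e] edges_at_arcs[of v] that(2) by blast
    then show ?thesis using \<sigma>V[OF that(1)] by simp
  qed
  show "ut v = 0 v"
  proof (cases "v \<in> bifurcations N")
    case True
    have "(\<Sum>e\<in>edges_at N v. \<sigma>V v / edge_len N e * (ut v * ut v)) = 0"
      using z nn True unfolding eq
      by (subst (asm) sum_nonneg_eq_0_iff) (auto intro!: sum_nonneg finite_bifurcations)
    moreover have "edges_at N v \<noteq> {}" using True by (auto simp: bifurcations_def)
    then obtain e where e: "e \<in> edges_at N v" by blast
    ultimately have "\<sigma>V v / edge_len N e * (ut v * ut v) = 0"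
      using nn[OF True] by (subst (asm) sum_nonneg_eq_0_iff) (auto intro!: finite_edges_at)
    then show ?thesis using \<sigma>V[OF True] edge_len_pos[of e] edges_at_arcs[of v] e by auto
  next
    case False
    then show ?thesis using ut by (simp add: VB0_def)
  qed
qed

lemma bilinear_network_forms:
  "bilinear_form_on (VG0 \<times> VB0) (\<lambda>(uh, ut) (wh, wt).
     (\<Sum>e\<in>arcs (net N). ae_form N D \<epsilon> \<sigma>E e (uh e) (wh e))
         + (\<Sum>v\<in>bifurcations N. bv_form N \<sigma>V v uh ut wh wt))"
proof -
  let ?S = "VG0 \<times> VB0"
  have 1: "bilinear_form_on ?S (\<lambda>x y. ae_form N D \<epsilon> \<sigma>E e (fst x e) (fst y e))" if e: "e \<in> arcs (net N)" for e
    by (rule bilinear_form_on_compose[OF bilinear_ae_form[OF e]]) (auto simp: VG0_edge e)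
  have l1: "linear_form_on ?S (\<lambda>x. at_vertex N e v (flux N e (fst x e)))" if e: "e \<in> arcs (net N)" for e v
    by (rule linear_form_on_compose[OF linear_vertex(2)[OF e]]) (auto simp: VG0_edge e)
  have l2: "linear_form_on ?S (\<lambda>x. at_vertex N e v (fst x e) - snd x v)" if e: "e \<in> arcs (net N)" for e v
    by (intro linear_form_on_diff linear_form_on_compose[OF linear_vertex(1)[OF e]])
      (auto simp: VG0_edge e linear_form_on_def)
  have bv: "bv_form N \<sigma>V v uh ut wh wt =
     (\<Sum>e\<in>edges_at N v. edge_sign N e v * (at_vertex N e v (flux N e (uh e)) * (at_vertex N e v (wh e) - wt v)))
     + (\<Sum>e\<in>edges_at N v. edge_sign N e v * (at_vertex N e v (flux N e (wh e)) * (at_vertex N e v (uh e) - ut v)))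
     + (\<Sum>e\<in>edges_at N v. \<sigma>V v / edge_len N e * ((at_vertex N e v (uh e) - ut v) * (at_vertex N e v (wh e) - wt v)))"
    for v uh ut wh wt
    by (simp add: bv_form_def mult.assoc mult.left_commute)
  have 2: "bilinear_form_on ?S (\<lambda>x y. bv_form N \<sigma>V v (fst x) (snd x) (fst y) (snd y))" for v
    unfolding bv using edges_at_arcs[of v]
    by (intro bilinear_form_on_add bilinear_form_on_sum bilinear_form_on_cmult bilinear_form_on_mult l1 l2
        bilinear_form_on_swap[OF bilinear_form_on_mult[OF l1 l2]]) auto
  have "bilinear_form_on ?S (\<lambda>x y. (\<Sum>e\<in>arcs (net N). ae_form N D \<epsilon> \<sigma>E e (fst x e) (fst y e))
         + (\<Sum>v\<in>bifurcations N. bv_form N \<sigma>V v (fst x) (snd x) (fst y) (snd y)))"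
    by (intro bilinear_form_on_add bilinear_form_on_sum 1 2)
  then show ?thesis by (simp add: case_prod_unfold)
qed

end

section \<open>Averages over the rims\<close>

lemma difference_quotients_tendsto:
  fixes f :: "real \<Rightarrow> 'a::real_normed_vector"
  assumes "(f has_vector_derivative D) (at t)"
  shows "(\<lambda>n. real (Suc n) *\<^sub>R (f (t + 1 / real (Suc n)) - f t)) \<longlonglongrightarrow> D"
proof -
  define y where "y n = t + 1 / real (Suc n)" for n
  have lim: "((\<lambda>y. (1 / norm (y - t)) *\<^sub>R (f y - (f t + (y - t) *\<^sub>R D))) \<longlongrightarrow> 0) (at t)"
    using assms unfolding has_vector_derivative_def has_derivative_at2 by blast
  have "y \<longlonglongrightarrow> t + 0"
    unfolding y_def[abs_def] by (intro tendsto_intros LIMSEQ_Suc[OF lim_1_over_n])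
  then have "filterlim y (at t) sequentially"
    unfolding filterlim_at by (auto simp: y_def)
  from filterlim_compose[OF lim this]
  have lim_y: "(\<lambda>n. (1 / norm (y n - t)) *\<^sub>R (f (y n) - (f t + (y n - t) *\<^sub>R D))) \<longlonglongrightarrow> 0" .
  have eq: "(1 / norm (y n - t)) *\<^sub>R (f (y n) - (f t + (y n - t) *\<^sub>R D)) =
      real (Suc n) *\<^sub>R (f (t + 1 / real (Suc n)) - f t) - D" for n
  proof -
    define c where "c = real (Suc n)"
    have c: "c > 0" by (simp add: c_def)
    have y: "y n = t + 1 / c" by (simp add: y_def c_def)
    have "(1 / norm (y n - t)) *\<^sub>R (f (y n) - (f t + (y n - t) *\<^sub>R D)) =
        c *\<^sub>R (f (t + 1 / c) - f t) - D"
    proof -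
      have n1: "1 / norm (y n - t) = c" using c by (simp add: y)
      have n2: "c *\<^sub>R ((y n - t) *\<^sub>R D) = D" using c by (simp add: y)
      show ?thesis
        unfolding n1 scaleR_diff_right scaleR_add_right n2 unfolding y by (simp only: diff_diff_eq)
    qed
    then show ?thesis by (simp add: c_def)
  qed
  have "(\<lambda>n. real (Suc n) *\<^sub>R (f (t + 1 / real (Suc n)) - f t) - D) \<longlonglongrightarrow> 0"
    using lim_y unfolding eq .
  then show ?thesis by (rule LIM_zero_cancel)
qed

definition clamp_to :: "real \<Rightarrow> real \<Rightarrow> real" where
  "clamp_to L s = max 0 (min L s)"

lemma clamp_to_in: "0 \<le> L \<Longrightarrow> clamp_to L s \<in> {0..L}"
  by (simp add: clamp_to_def)

lemma clamp_to_id: "s \<in> {0..L} \<Longrightarrow> clamp_to L s = s"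
  by (simp add: clamp_to_def)

lemma continuous_clamp_to: "continuous_on A f \<Longrightarrow> continuous_on A (\<lambda>x. clamp_to L (f x))"
  unfolding clamp_to_def by (intro continuous_intros)

lemma borel_integral_lebesgue_on:
  fixes f :: "'a::euclidean_space \<Rightarrow> real"
  assumes "f \<in> borel_measurable borel" "S \<in> sets borel"
  shows "(LINT x|lebesgue_on S. f x) = (LINT x|lborel. indicator S x * f x)"
proof -
  have "(LINT x|lebesgue_on S. f x) = (LINT x|lebesgue. indicator S x *\<^sub>R f x)"
    using assms(2) by (intro integral_restrict_space) simp
  also have "\<dots> = (LINT x|lborel. indicator S x *\<^sub>R f x)"
    by (rule integral_completion) (use assms in measurable)
  finally show ?thesis by simp
qed

lemma borel_measurable_lebesgue_on:
  fixes f :: "'a::euclidean_space \<Rightarrow> 'b::euclidean_space"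
  assumes "f \<in> borel_measurable borel"
  shows "f \<in> borel_measurable (lebesgue_on S)"
proof -
  have "f \<in> borel_measurable lborel" using assms by simp
  then have "f \<in> borel_measurable lebesgue" by (rule measurable_completion)
  then show ?thesis by (rule measurable_restrict_space1)
qed

lemma integrable_bounded_mult:
  fixes f g :: "'a \<Rightarrow> real"
  assumes g: "integrable M g" and f: "f \<in> borel_measurable M" "\<And>x. x \<in> space M \<Longrightarrow> \<bar>f x\<bar> \<le> B"
  shows "integrable M (\<lambda>x. f x * g x)"
proof (rule Bochner_Integration.integrable_bound)
  show "integrable M (\<lambda>x. B * g x)" using g by simp
  show "(\<lambda>x. f x * g x) \<in> borel_measurable M"
    using f(1) borel_measurable_integrable[OF g] by (rule borel_measurable_times)
  have "\<bar>f x\<bar> * \<bar>g x\<bar> \<le> \<bar>B\<bar> * \<bar>g x\<bar>" if "x \<in> space M" for x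
    using f(2)[OF that] by (intro mult_right_mono) auto
  then show "AE x in M. norm (f x * g x) \<le> norm (B * g x)"
    by (intro AE_I2) (simp add: abs_mult)
qed

text \<open>
  For an integrable weight, \<open>\<bar>f\<bar> \<le> 1 + f\<^sup>2\<close> replaces the Cauchy-Schwarz inequality.
\<close>

lemma weighted_L2_imp_L1:
  fixes f w :: "'a \<Rightarrow> real"
  assumes f: "f \<in> borel_measurable M" "integrable M (\<lambda>x. w x * (f x)\<^sup>2)"
    and w: "integrable M w" "\<And>x. x \<in> space M \<Longrightarrow> 0 \<le> w x"
  shows "integrable M (\<lambda>x. f x * w x)"
proof (rule Bochner_Integration.integrable_bound)
  show "integrable M (\<lambda>x. w x + w x * (f x)\<^sup>2)" using f(2) w(1) by simp
  show "(\<lambda>x. f x * w x) \<in> borel_measurable M"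
    using f(1) borel_measurable_integrable[OF w(1)] by (rule borel_measurable_times)
  have "\<bar>f x\<bar> * w x \<le> w x + w x * (f x)\<^sup>2" if x: "x \<in> space M" for x
  proof -
    have "0 \<le> (\<bar>f x\<bar> - 1)\<^sup>2" by simp
    then have "\<bar>f x\<bar> \<le> 1 + (f x)\<^sup>2" by (simp add: power2_eq_square algebra_simps)
    from mult_left_mono[OF this w(2)[OF x]] show ?thesis by (simp add: algebra_simps)
  qed
  then show "AE x in M. norm (f x * w x) \<le> norm (w x + w x * (f x)\<^sup>2)"
    using w(2) by (intro AE_I2) (simp add: abs_mult)
qed

context network_mesh
begin

lemma V3_borel:
  assumes "u \<in> V3 D"
  shows "u \<in> borel_measurable borel"
proof -
  obtain c where c: "\<And>x. u x = (\<Sum>K\<in>tets D. \<Sum>\<alpha>\<in>multi_indices (deg3 D).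
      c K \<alpha> * (indicator (interior K) x * monomial \<alpha> x))"
    using V3_expansion[OF assms] by blast
  have m: "monomial \<alpha> \<in> borel_measurable borel" for \<alpha>
    unfolding monomial_def[abs_def] by (intro borel_measurable_continuous_onI continuous_intros)
  show ?thesis unfolding c[abs_def]
    by (intro borel_measurable_sum borel_measurable_times borel_measurable_indicator m) auto
qed

lemma V3_bounded:
  assumes "u \<in> V3 D"
  obtains M where "\<And>x. \<bar>u x\<bar> \<le> M"
proof -
  have "\<forall>K\<in>tets D. \<exists>M\<ge>0. \<forall>x\<in>interior K. \<bar>u x\<bar> \<le> M"
  proof
    fix K assume K: "K \<in> tets D"
    have "compact (trace_from K u ` K)"
      using V3_traces(1)[OF K assms] compact_cell[OF K] by (rule compact_continuous_image)
    then obtain M where "\<forall>y\<in>trace_from K u ` K. norm y \<le> M"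
      using compact_imp_bounded bounded_iff by metis
    then have "\<bar>u x\<bar> \<le> max M 0" if "x \<in> interior K" for x
      using V3_traces(3)[OF K assms that] that interior_subset[of K] by force
    then show "\<exists>M\<ge>0. \<forall>x\<in>interior K. \<bar>u x\<bar> \<le> M" by (intro exI[of _ "max M 0"]) auto
  qed
  then obtain M where M: "\<And>K. K \<in> tets D \<Longrightarrow> 0 \<le> M K"
    "\<And>K x. K \<in> tets D \<Longrightarrow> x \<in> interior K \<Longrightarrow> \<bar>u x\<bar> \<le> M K" by metis
  have "\<bar>u x\<bar> \<le> (\<Sum>K\<in>tets D. M K)" for x
  proof (cases "\<exists>K\<in>tets D. x \<in> interior K")
    case True
    then obtain K where K: "K \<in> tets D" "x \<in> interior K" by blast
    have "\<bar>u x\<bar> \<le> M K" using M(2)[OF K] .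
    also have "\<dots> \<le> (\<Sum>K\<in>tets D. M K)"
      by (rule member_le_sum[OF K(1) _ finite_tets]) (use M(1) in blast)
    finally show ?thesis .
  next
    case False
    then have "u x = 0" using assms unfolding V3_def by blast
    then show ?thesis using M(1) by (simp add: sum_nonneg)
  qed
  then show ?thesis using that by blast
qed

lemma rim_facts:
  assumes "e \<in> arcs (net N)"
  shows "continuous_on {0..edge_len N e} (curve N e)"
    "continuous_on {0..edge_len N e} (frame1 N e)" "continuous_on {0..edge_len N e} (frame2 N e)"
    "continuous_on ({0..edge_len N e} \<times> {0..1}) (\<lambda>(s, t). rim N e s t)"
    "\<And>s. s \<in> {0..edge_len N e} \<Longrightarrow> valid_path (rim N e s)"
    "\<And>s. s \<in> {0..edge_len N e} \<Longrightarrow> perimeter N e s > 0"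
proof -
  have "C1_on_interval (curve N e) 0 (edge_len N e)"
    using graph assms by (simp add: embedded_graph_def)
  then show "continuous_on {0..edge_len N e} (curve N e)"
    unfolding C1_on_interval_def
    by (meson continuous_on_eq_continuous_within has_vector_derivative_continuous)
  have c: "\<forall>e\<in>arcs (net N).
        continuous_on {0..edge_len N e} (frame1 N e) \<and>
        continuous_on {0..edge_len N e} (frame2 N e) \<and>
        continuous_on ({0..edge_len N e} \<times> {0..1}) (\<lambda>(s, t). rim N e s t) \<and>
        (\<forall>s\<in>{0..edge_len N e}. valid_path (rim N e s) \<and> perimeter N e s > 0)"
    using cylinders unfolding surrounding_cylinders_def by meson
  then show "continuous_on {0..edge_len N e} (frame1 N e)" "continuous_on {0..edge_len N e} (frame2 N e)"
    "continuous_on ({0..edge_len N e} \<times> {0..1}) (\<lambda>(s, t). rim N e s t)"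
    "\<And>s. s \<in> {0..edge_len N e} \<Longrightarrow> valid_path (rim N e s)"
    "\<And>s. s \<in> {0..edge_len N e} \<Longrightarrow> perimeter N e s > 0"
    using assms by blast+
qed

lemma perimeter_bounded:
  assumes e: "e \<in> arcs (net N)"
  obtains M where "\<And>s. s \<in> {0..edge_len N e} \<Longrightarrow> \<bar>perimeter N e s\<bar> \<le> M"
proof -
  obtain a1 where "\<And>s. s \<in> {0..edge_len N e} \<Longrightarrow> area N e s + perimeter N e s \<le> a1"
    using cylinders e unfolding surrounding_cylinders_def by meson
  then have "\<bar>perimeter N e s\<bar> \<le> a1" if "s \<in> {0..edge_len N e}" for s
    using area_pos[OF e that] rim_facts(6)[OF e that] that by force
  then show ?thesis using that by blast
qed

text \<open>
  A piecewise \<open>C1\<close> path need not have finite length. But the integral of a function that is not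
  integrable is \<open>0\<close> by convention, and the perimeter is positive.
\<close>

lemma rim_speed_integrable:
  assumes "e \<in> arcs (net N)" "s \<in> {0..edge_len N e}"
  shows "integrable (lebesgue_on {0..1}) (rim_speed N e s)"
proof (rule ccontr)
  assume "\<not> ?thesis"
  then have "perimeter N e s = 0"
    by (simp add: perimeter_def not_integrable_integral_eq)
  then show False using rim_facts(6)[OF assms] by simp
qed

text \<open>
  The average over the rim must be measurable in \<open>s\<close>, which follows from joint measurability in \<open>(s, t)\<close>
  of the integrand. The points of the rims depend continuously on \<open>(s, t)\<close>; the speed is the limit of
  difference quotients, except at finitely many \<open>t\<close> for each \<open>s\<close>. Constant extension beyond the
  parameter rectangle makes the difference quotients continuous on the whole plane.
\<close>

definition rim_ext :: "'e \<Rightarrow> real \<Rightarrow> real \<Rightarrow> real^2" where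
  "rim_ext e s t = rim N e (clamp_to (edge_len N e) s) (clamp_to 1 t)"

definition rim_point :: "'e \<Rightarrow> real \<Rightarrow> real \<Rightarrow> real^3" where
  "rim_point e s t = place N e (clamp_to (edge_len N e) s) (rim_ext e s t)"

definition rim_derivative :: "'e \<Rightarrow> real \<Rightarrow> real \<Rightarrow> real^2" where
  "rim_derivative e s t =
     lim (\<lambda>n. real (Suc n) *\<^sub>R (rim_ext e s (t + 1 / real (Suc n)) - rim_ext e s t))"

lemma rim_ext_continuous:
  assumes "e \<in> arcs (net N)"
  shows "continuous_on A f \<Longrightarrow> continuous_on A g \<Longrightarrow> continuous_on A (\<lambda>x. rim_ext e (f x) (g x))"
proof -
  assume fg: "continuous_on A f" "continuous_on A g"
  have "continuous_on A (\<lambda>x. (clamp_to (edge_len N e) (f x), clamp_to 1 (g x)))"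
    using fg by (intro continuous_intros continuous_clamp_to)
  moreover have "(\<lambda>x. (clamp_to (edge_len N e) (f x), clamp_to 1 (g x))) ` A \<subseteq> {0..edge_len N e} \<times> {0..1}"
    using clamp_to_in[of "edge_len N e"] clamp_to_in[of 1] edge_len_pos[OF assms] by force
  ultimately have "continuous_on A (\<lambda>x. case (clamp_to (edge_len N e) (f x), clamp_to 1 (g x)) of (s, t) \<Rightarrow> rim N e s t)"
    using continuous_on_compose2[OF rim_facts(4)[OF assms]] by blast
  then show ?thesis by (simp add: rim_ext_def)
qed

lemma rim_point_continuous:
  assumes e: "e \<in> arcs (net N)" and fg: "continuous_on A f" "continuous_on A g"
  shows "continuous_on A (\<lambda>x. rim_point e (f x) (g x))"
proof -
  have c: "continuous_on A (\<lambda>x. clamp_to (edge_len N e) (f x))" using continuous_clamp_to[OF fg(1)] .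
  have sub: "(\<lambda>x. clamp_to (edge_len N e) (f x)) ` A \<subseteq> {0..edge_len N e}"
    using clamp_to_in[of "edge_len N e"] edge_len_pos[OF e] by force
  have "continuous_on A (\<lambda>x. h (clamp_to (edge_len N e) (f x)))" if "continuous_on {0..edge_len N e} h"
    for h :: "real \<Rightarrow> real^3"
    using continuous_on_compose2[OF that c sub] .
  then show ?thesis
    unfolding rim_point_def place_def using rim_facts[OF e] rim_ext_continuous[OF e fg]
    by (intro continuous_on_add continuous_on_scaleR continuous_on_component) auto
qed

lemma rim_point_eq:
  "s \<in> {0..edge_len N e} \<Longrightarrow> t \<in> {0..1} \<Longrightarrow> rim_point e s t = place N e s (rim N e s t)"
  by (simp add: rim_point_def rim_ext_def clamp_to_id)

lemma rim_derivative_eq: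
  assumes e: "e \<in> arcs (net N)" and s: "s \<in> {0..edge_len N e}"
  obtains X where "finite X" "\<And>t. t \<in> {0..1} - X \<Longrightarrow> norm (rim_derivative e s t) = rim_speed N e s t"
proof -
  have "rim N e s piecewise_C1_differentiable_on {0..1}"
    using rim_facts(5)[OF e s] by (simp add: valid_path_def)
  then obtain X where X: "finite X" "rim N e s C1_differentiable_on ({0..1} - X)"
    unfolding piecewise_C1_differentiable_on_def by blast
  then obtain d where d: "\<And>t. t \<in> {0..1} - X \<Longrightarrow> (rim N e s has_vector_derivative d t) (at t)"
    unfolding C1_differentiable_on_def by blast
  have "norm (rim_derivative e s t) = rim_speed N e s t" if t: "t \<in> {0..1} - (X \<union> {0, 1})" for t
  proof -
    have dt: "(rim N e s has_vector_derivative d t) (at t)" using d t by blast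
    have "(rim_ext e s has_vector_derivative d t) (at t)"
      by (rule has_vector_derivative_transform_within_open[OF dt, of "{0<..<1}"])
        (use t s in \<open>auto simp: rim_ext_def clamp_to_id\<close>)
    then have "rim_derivative e s t = d t"
      unfolding rim_derivative_def by (intro limI difference_quotients_tendsto)
    then show ?thesis using vector_derivative_at[OF dt] by (simp add: rim_speed_def)
  qed
  then show ?thesis using that[of "X \<union> {0, 1}"] X(1) by blast
qed

lemma rim_derivative_measurable:
  assumes e: "e \<in> arcs (net N)"
  shows "(\<lambda>(s, t). rim_derivative e s t) \<in> borel_measurable borel"
proof -
  have "(\<lambda>x. lim (\<lambda>n. real (Suc n) *\<^sub>R (rim_ext e (fst x) (snd x + 1 / real (Suc n)) - rim_ext e (fst x) (snd x))))
     \<in> borel_measurable borel"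
    by (intro borel_measurable_lim_metric borel_measurable_continuous_onI continuous_on_scaleR
        continuous_on_diff rim_ext_continuous[OF e] continuous_intros)
  then show ?thesis by (simp add: rim_derivative_def[abs_def] case_prod_unfold)
qed

definition rim_integral :: "(real^3 \<Rightarrow> real) \<Rightarrow> 'e \<Rightarrow> real \<Rightarrow> real" where
  "rim_integral w e s = (LINT t|lebesgue_on {0..1}. w (place N e s (rim N e s t)) * rim_speed N e s t)"

lemma rim_integrable:
  assumes e: "e \<in> arcs (net N)" and s: "s \<in> {0..edge_len N e}"
    and w: "w \<in> borel_measurable borel" "\<And>x. \<bar>w x\<bar> \<le> M"
  shows "integrable (lebesgue_on {0..1}) (\<lambda>t. w (place N e s (rim N e s t)) * rim_speed N e s t)"
proof -
  have "(\<lambda>t. w (rim_point e s t)) \<in> borel_measurable borel"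
    by (rule measurable_compose[OF borel_measurable_continuous_onI w(1)])
      (intro rim_point_continuous[OF e] continuous_intros)
  then have "(\<lambda>t. w (rim_point e s t)) \<in> borel_measurable (lebesgue_on {0..1})"
    by (rule borel_measurable_lebesgue_on)
  then have m: "(\<lambda>t. w (place N e s (rim N e s t))) \<in> borel_measurable (lebesgue_on {0..1})"
    using rim_point_eq[OF s] measurable_cong[of "lebesgue_on {0..1}" "\<lambda>t. w (rim_point e s t)"
        "\<lambda>t. w (place N e s (rim N e s t))" borel] by simp
  show ?thesis by (rule integrable_bounded_mult[OF rim_speed_integrable[OF e s] m w(2)])
qed

lemma rim_integral_measurable:
  assumes e: "e \<in> arcs (net N)" and w: "w \<in> borel_measurable borel" "\<And>x. \<bar>w x\<bar> \<le> M"
  shows "rim_integral w e \<in> borel_measurable (lebesgue_on {0..edge_len N e})"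
proof -
  define f where "f s t = w (rim_point e s t) * norm (rim_derivative e s t)" for s t
  have "(\<lambda>x. rim_point e (fst x) (snd x)) \<in> borel_measurable borel"
    by (intro borel_measurable_continuous_onI rim_point_continuous[OF e] continuous_intros)
  from measurable_compose[OF this w(1)]
  have f: "(\<lambda>x. f (fst x) (snd x)) \<in> borel_measurable borel"
    unfolding f_def using rim_derivative_measurable[OF e]
    by (intro borel_measurable_times borel_measurable_norm) (auto simp: case_prod_unfold)
  have ft: "f s \<in> borel_measurable borel" for s
  proof -
    have "(\<lambda>t. (s, t)) \<in> borel \<rightarrow>\<^sub>M (borel :: (real \<times> real) measure)"
      by (intro borel_measurable_continuous_onI continuous_intros)
    from measurable_compose[OF this f] show ?thesis by simp
  qed
  have eq: "rim_integral w e s = (LINT t|lborel. indicator {0..1} t * f s t)"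
    if s: "s \<in> {0..edge_len N e}" for s
  proof -
    obtain X where X: "finite X" "\<And>t. t \<in> {0..1} - X \<Longrightarrow> norm (rim_derivative e s t) = rim_speed N e s t"
      using rim_derivative_eq[OF e s] by blast
    have "f s t = w (place N e s (rim N e s t)) * rim_speed N e s t" if "t \<in> {0..1} - X" for t
      using X(2)[OF that] rim_point_eq[OF s, of t] that by (simp add: f_def)
    then have "(LINT t|lebesgue_on {0..1}. f s t) = rim_integral w e s"
      unfolding rim_integral_def
      using integral_lebesgue_on_spike[of "{0..1}" X "f s", OF _ _ _ rim_integrable[OF e s w]]
        negligible_finite[OF X(1)] by simp
    then show ?thesis using borel_integral_lebesgue_on[OF ft, of "{0..1}" s] by simp
  qed
  have "(\<lambda>x. indicator {0..1} (snd x) * f (fst x) (snd x)) \<in> borel_measurable (borel :: (real \<times> real) measure)"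
  proof (intro borel_measurable_times f)
    have "(snd :: real \<times> real \<Rightarrow> real) \<in> borel_measurable borel"
      by (intro borel_measurable_continuous_onI continuous_intros)
    from measurable_compose[OF this, of "indicator {0..1}" borel]
    show "(\<lambda>x. indicator {0..1} (snd x) :: real) \<in> borel_measurable (borel :: (real \<times> real) measure)" by simp
  qed
  then have "(\<lambda>(s, t). indicator {0..1} t * f s t) \<in> borel_measurable (borel \<Otimes>\<^sub>M lborel)"
    using measurable_cong_sets[of "borel \<Otimes>\<^sub>M lborel" "borel :: (real \<times> real) measure" borel borel]
    by (simp add: case_prod_unfold borel_prod[symmetric] cong: sets_pair_measure_cong)
  then have "(\<lambda>s. LINT t|lborel. indicator {0..1} t * f s t) \<in> borel_measurable borel"
    by (rule lborel.borel_measurable_lebesgue_integral)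
  then have "(\<lambda>s. LINT t|lborel. indicator {0..1} t * f s t) \<in> borel_measurable (lebesgue_on {0..edge_len N e})"
    by (rule borel_measurable_lebesgue_on)
  then show ?thesis
    using eq measurable_cong[of "lebesgue_on {0..edge_len N e}" "rim_integral w e"
        "\<lambda>s. LINT t|lborel. indicator {0..1} t * f s t" borel] by simp
qed

lemma perimeter_measurable:
  assumes e: "e \<in> arcs (net N)"
  shows "perimeter N e \<in> borel_measurable (lebesgue_on {0..edge_len N e})"
proof -
  have "perimeter N e = rim_integral (\<lambda>x. 1) e" by (simp add: fun_eq_iff perimeter_def rim_integral_def)
  then show ?thesis using rim_integral_measurable[OF e, of "\<lambda>x. 1" 1] by simp
qed

text \<open>
  The functions on an edge for which the exchange term is a convergent integral.
\<close>

definition bounded_measurable :: "'e \<Rightarrow> (real \<Rightarrow> real) set" where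
  "bounded_measurable e = {f. f \<in> borel_measurable (lebesgue_on {0..edge_len N e}) \<and>
     (\<exists>M. \<forall>s\<in>{0..edge_len N e}. \<bar>f s\<bar> \<le> M)}"

lemma subspace_bounded_measurable: "subspace (bounded_measurable e)"
proof (rule subspaceI)
  show 0: "0 \<in> bounded_measurable e" by (auto simp: bounded_measurable_def zero_fun_def)
  show "f + g \<in> bounded_measurable e" if fg: "f \<in> bounded_measurable e" "g \<in> bounded_measurable e" for f g
  proof -
    obtain A B where "\<forall>s\<in>{0..edge_len N e}. \<bar>f s\<bar> \<le> A" "\<forall>s\<in>{0..edge_len N e}. \<bar>g s\<bar> \<le> B"
      using fg unfolding bounded_measurable_def by blast
    then have "\<forall>s\<in>{0..edge_len N e}. \<bar>(f + g) s\<bar> \<le> A + B" by force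
    then show ?thesis
      using fg unfolding bounded_measurable_def by (auto simp: plus_fun_def intro!: borel_measurable_add)
  qed
  show "c *\<^sub>R f \<in> bounded_measurable e" if f: "f \<in> bounded_measurable e" for c f
  proof -
    obtain A where "\<forall>s\<in>{0..edge_len N e}. \<bar>f s\<bar> \<le> A" using f unfolding bounded_measurable_def by blast
    then have "\<forall>s\<in>{0..edge_len N e}. \<bar>(c *\<^sub>R f) s\<bar> \<le> \<bar>c\<bar> * A" by (auto simp: abs_mult intro!: mult_left_mono)
    then show ?thesis
      using f unfolding bounded_measurable_def by (auto simp: scaleR_fun_def intro!: borel_measurable_times)
  qed
qed

lemma rim_average_bounded_measurable:
  assumes e: "e \<in> arcs (net N)" and u: "u \<in> V3 D"
  shows "rim_average N u e \<in> bounded_measurable e"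
proof -
  obtain M where M: "\<And>x. \<bar>u x\<bar> \<le> M" using V3_bounded[OF u] by blast
  have eq: "rim_average N u e s = (1 / perimeter N e s) * rim_integral u e s" for s
    by (simp add: rim_average_def rim_integral_def)
  have "rim_average N u e \<in> borel_measurable (lebesgue_on {0..edge_len N e})"
    unfolding eq[abs_def]
    using perimeter_measurable[OF e] rim_integral_measurable[OF e V3_borel[OF u] M]
    by (intro borel_measurable_times borel_measurable_divide) auto
  moreover have "\<bar>rim_average N u e s\<bar> \<le> M" if s: "s \<in> {0..edge_len N e}" for s
  proof -
    have P: "perimeter N e s > 0" using rim_facts(6)[OF e s] .
    have "\<bar>rim_integral u e s\<bar> \<le> (LINT t|lebesgue_on {0..1}. M * rim_speed N e s t)"
      unfolding rim_integral_def
    proof (rule integral_abs_bound_integral)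
      show "integrable (lebesgue_on {0..1}) (\<lambda>t. u (place N e s (rim N e s t)) * rim_speed N e s t)"
        using rim_integrable[OF e s V3_borel[OF u] M] .
      show "integrable (lebesgue_on {0..1}) (\<lambda>t. M * rim_speed N e s t)"
        using rim_speed_integrable[OF e s] by simp
      show "\<bar>u (place N e s (rim N e s t)) * rim_speed N e s t\<bar> \<le> M * rim_speed N e s t" for t
        using mult_right_mono[OF M, of "rim_speed N e s t" "place N e s (rim N e s t)"]
        by (simp add: abs_mult rim_speed_def)
    qed
    also have "\<dots> = M * perimeter N e s" by (simp add: perimeter_def)
    finally show ?thesis unfolding eq using P by (simp add: abs_mult field_simps)
  qed
  ultimately show ?thesis unfolding bounded_measurable_def by blast
qed

lemma rim_average_lincomb:
  assumes e: "e \<in> arcs (net N)" and s: "s \<in> {0..edge_len N e}" and u: "u \<in> V3 D" and v: "v \<in> V3 D"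
  shows "rim_average N (u + c *\<^sub>R v) e s = rim_average N u e s + c * rim_average N v e s"
proof -
  obtain M M' where M: "\<And>x. \<bar>u x\<bar> \<le> M" "\<And>x. \<bar>v x\<bar> \<le> M'" using V3_bounded u v by metis
  show ?thesis
    unfolding rim_average_def
    using rim_integrable[OF e s V3_borel[OF u] M(1)] rim_integrable[OF e s V3_borel[OF v] M(2)]
    by (simp add: algebra_simps)
qed

lemma V1_bounded_measurable:
  assumes e: "e \<in> arcs (net N)" and v: "v \<in> V1 N D e"
  shows "v \<in> bounded_measurable e"
proof -
  obtain c where c: "\<And>s. v s = (\<Sum>i\<in>{1..cells D e}. \<Sum>j\<le>deg1 D e. c i j * (indicator (cell e i) s * s ^ j))"
    using V1_expansion[OF e v] by blast
  have "v \<in> borel_measurable borel" unfolding c[abs_def] cell_def by measurable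
  then have "v \<in> borel_measurable (lebesgue_on {0..edge_len N e})" by (rule borel_measurable_lebesgue_on)
  moreover have "\<bar>v s\<bar> \<le> (\<Sum>i\<in>{1..cells D e}. \<Sum>j\<le>deg1 D e. \<bar>c i j\<bar> * edge_len N e ^ j)"
    if s: "s \<in> {0..edge_len N e}" for s
  proof -
    have "\<bar>c i j * (indicator (cell e i) s * s ^ j)\<bar> \<le> \<bar>c i j\<bar> * edge_len N e ^ j" for i j
    proof -
      have "\<bar>indicator (cell e i) s * s ^ j\<bar> \<le> 1 * edge_len N e ^ j"
        unfolding abs_mult using s by (intro mult_mono) (auto simp: indicator_def power_abs intro!: power_mono)
      then show ?thesis by (simp add: abs_mult mult_left_mono)
    qed
    then show ?thesis unfolding c by (intro order_trans[OF sum_abs] sum_mono)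
  qed
  ultimately show ?thesis unfolding bounded_measurable_def by blast
qed

lemma be_integrable:
  assumes e: "e \<in> arcs (net N)" and ab: "a \<in> bounded_measurable e" "b \<in> bounded_measurable e"
  shows "integrable (lebesgue_on {0..edge_len N e}) (\<lambda>s. \<xi> * a s * (perimeter N e s * b s))"
proof -
  let ?L = "edge_len N e"
  obtain A where A: "\<And>s. s \<in> {0..?L} \<Longrightarrow> \<bar>a s\<bar> \<le> A" using ab(1) unfolding bounded_measurable_def by blast
  obtain B where B: "\<And>s. s \<in> {0..?L} \<Longrightarrow> \<bar>b s\<bar> \<le> B" using ab(2) unfolding bounded_measurable_def by blast
  obtain P where P: "\<And>s. s \<in> {0..?L} \<Longrightarrow> \<bar>perimeter N e s\<bar> \<le> P" using perimeter_bounded[OF e] by blast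
  let ?M = "lebesgue_on {0..?L}"
  have "integrable ?M (\<lambda>s. \<xi>)" by (rule integrable_lebesgue_on_compact) auto
  then have "integrable ?M (\<lambda>s. perimeter N e s * \<xi>)"
    by (rule integrable_bounded_mult[OF _ perimeter_measurable[OF e]]) (use P in simp)
  then have "integrable ?M (\<lambda>s. b s * (perimeter N e s * \<xi>))"
    by (rule integrable_bounded_mult) (use ab(2) B in \<open>auto simp: bounded_measurable_def\<close>)
  then have "integrable ?M (\<lambda>s. a s * (b s * (perimeter N e s * \<xi>)))"
    by (rule integrable_bounded_mult) (use ab(1) A in \<open>auto simp: bounded_measurable_def\<close>)
  then show ?thesis by (simp only: ac_simps)
qed

lemma bilinear_be_form:
  assumes e: "e \<in> arcs (net N)"
  shows "bilinear_form_on (bounded_measurable e) (be_form N \<xi> e)"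
proof (rule bilinear_form_onI)
  fix a b d c assume S: "a \<in> bounded_measurable e" "b \<in> bounded_measurable e" "d \<in> bounded_measurable e"
  note i = be_integrable[OF e, of _ _ "\<xi> e"]
  show "be_form N \<xi> e (a + c *\<^sub>R b) d = be_form N \<xi> e a d + c * be_form N \<xi> e b d"
    unfolding be_form_def weighted_inner_def using i[OF S(1,3)] i[OF S(2,3)]
    by (simp add: algebra_simps)
  show "be_form N \<xi> e d (a + c *\<^sub>R b) = be_form N \<xi> e d a + c * be_form N \<xi> e d b"
    unfolding be_form_def weighted_inner_def using i[OF S(3,1)] i[OF S(3,2)]
    by (simp add: algebra_simps)
qed

lemma be_form_cong:
  assumes "\<And>s. s \<in> {0..edge_len N e} \<Longrightarrow> a s = a' s" "\<And>s. s \<in> {0..edge_len N e} \<Longrightarrow> b s = b' s"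
  shows "be_form N \<xi> e a b = be_form N \<xi> e a' b'"
  unfolding be_form_def weighted_inner_def
  by (intro Bochner_Integration.integral_cong) (use assms in auto)

lemma be_form_nonneg:
  assumes e: "e \<in> arcs (net N)" and \<xi>: "\<xi> e > 0"
  shows "be_form N \<xi> e a a \<ge> 0"
  unfolding be_form_def weighted_inner_def
proof (rule Bochner_Integration.integral_nonneg)
  fix s assume "s \<in> space (lebesgue_on {0..edge_len N e})"
  then have "perimeter N e s > 0" using rim_facts(6)[OF e] by simp
  then have "0 \<le> (\<xi> e * perimeter N e s) * (a s * a s)" using \<xi> by simp
  then show "0 \<le> \<xi> e * a s * (perimeter N e s * a s)" by (simp only: ac_simps)
qed

text \<open>
  The perimeter is positive, so \<open>v\<close> vanishes almost everywhere, hence on the open cells, where it is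
  continuous; at the nodes it is \<open>0\<close> as a member of \<open>V1\<close>.
\<close>

lemma be_form_zero:
  assumes e: "e \<in> arcs (net N)" and \<xi>: "\<xi> e > 0" and v: "v \<in> V1 N D e" and z: "be_form N \<xi> e v v = 0"
  shows "v = 0"
proof (rule ext)
  fix s
  let ?L = "edge_len N e"
  have nn: "0 \<le> \<xi> e * v s * (perimeter N e s * v s)" if "s \<in> {0..?L}" for s
  proof -
    have "0 \<le> (\<xi> e * perimeter N e s) * (v s * v s)" using rim_facts(6)[OF e that] \<xi> by simp
    then show ?thesis by (simp only: ac_simps)
  qed
  note i = be_integrable[OF e V1_bounded_measurable[OF e v] V1_bounded_measurable[OF e v], of "\<xi> e"]
  have "AE s in lebesgue_on {0..?L}. \<xi> e * v s * (perimeter N e s * v s) = 0"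
    using integral_nonneg_eq_0_iff_AE[OF i] nn z
    by (auto simp: be_form_def weighted_inner_def AE_restrict_space_iff)
  moreover have "\<xi> e * v s * (perimeter N e s * v s) = 0 \<longleftrightarrow> v s * v s = 0" if "s \<in> {0..?L}" for s
    using rim_facts(6)[OF e that] \<xi> by auto
  ultimately have "AE s in lebesgue_on {0..?L}. v s * v s = 0"
    by (auto simp: AE_restrict_space_iff)
  then have z2: "(LINT s|lebesgue_on {0..?L}. v s * v s) = 0"
    by (rule integral_eq_zero_AE)
  obtain A where A: "\<And>s. s \<in> {0..?L} \<Longrightarrow> \<bar>v s\<bar> \<le> A" and vm: "v \<in> borel_measurable (lebesgue_on {0..?L})"
    using V1_bounded_measurable[OF e v] unfolding bounded_measurable_def by blast
  have vA: "\<bar>v s\<bar> \<le> A" if "s \<in> space (lebesgue_on {0..?L})" for s using A that by simp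
  have "integrable (lebesgue_on {0..?L}) (\<lambda>s. 1 :: real)"
    by (rule integrable_lebesgue_on_compact) auto
  from integrable_bounded_mult[OF this vm vA] have "integrable (lebesgue_on {0..?L}) v" by simp
  from integrable_bounded_mult[OF this vm vA] have i2: "integrable (lebesgue_on {0..?L}) (\<lambda>s. v s * v s)" .
  show "v s = 0 s"
  proof (cases "\<exists>i\<in>{1..cells D e}. s \<in> cell e i")
    case True
    then obtain i where i: "i \<in> {1..cells D e}" "s \<in> cell e i" by blast
    obtain p where p: "\<And>s. s \<in> cell e i \<Longrightarrow> v s = poly p s" using V1_poly[OF v i(1)] by blast
    have "poly p s * poly p s = 0"
    proof (rule integral_zero_imp_zero[OF _ i2 _ z2 _ cell_subset(2)[OF e i(1)], of "\<lambda>s. poly p s * poly p s"])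
      show "open (cell e i)" by (simp add: cell_def)
      show "continuous_on (cell e i) (\<lambda>s. poly p s * poly p s)" by (intro continuous_intros)
    qed (use p i in auto)
    then show ?thesis using p[OF i(2)] by simp
  next
    case False
    then have "v s = 0" using v unfolding V1_iff by blast
    then show ?thesis by simp
  qed
qed

section \<open>The data as linear forms\<close>

lemma bounded_domain: "bounded \<Omega>" "\<Omega> \<in> sets lebesgue"
proof -
  have "\<Omega> = interior (\<Union>(tets D))" using mesh by (simp add: tetrahedral_mesh_def)
  moreover have "bounded (\<Union>(tets D))"
    using finite_tets compact_cell compact_imp_bounded by (intro bounded_Union) auto
  ultimately show "bounded \<Omega>" "\<Omega> \<in> sets lebesgue"
    using bounded_interior[of "\<Union>(tets D)"] by auto
qed

lemma linear_source:
  assumes f: "f \<in> weighted_L2 \<Omega> (\<lambda>x. 1)"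
  shows "linear_form_on (V3 D) (weighted_inner \<Omega> (\<lambda>x. 1) f)"
proof -
  have fm: "f \<in> borel_measurable (lebesgue_on \<Omega>)" and f2: "integrable (lebesgue_on \<Omega>) (\<lambda>x. (f x)\<^sup>2)"
    using f by (auto simp: weighted_L2_def)
  have "\<Omega> \<in> lmeasurable" using bounded_domain bounded_set_imp_lmeasurable by blast
  then have i1: "integrable (lebesgue_on \<Omega>) (\<lambda>x. 1 :: real)"
    using integrable_on_const lmeasurable_iff_integrable[of \<Omega>] integrable_restrict_space[of \<Omega> lebesgue "\<lambda>x. 1 :: real"]
      bounded_domain(2) by simp
  have fi: "integrable (lebesgue_on \<Omega>) f" using weighted_L2_imp_L1[OF fm, of "\<lambda>x. 1"] f2 i1 by simp
  have i: "integrable (lebesgue_on \<Omega>) (\<lambda>x. f x * u x)" if u: "u \<in> V3 D" for u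
  proof -
    obtain M where M: "\<And>x. \<bar>u x\<bar> \<le> M" using V3_bounded[OF u] by blast
    show ?thesis
      using integrable_bounded_mult[OF fi borel_measurable_lebesgue_on[OF V3_borel[OF u]] M]
      by (simp only: mult.commute)
  qed
  show ?thesis
    unfolding linear_form_on_def weighted_inner_def using i by (simp add: algebra_simps)
qed

lemma linear_edge_source:
  assumes e: "e \<in> arcs (net N)" and f: "f \<in> weighted_L2 {0..edge_len N e} (area N e)"
  shows "linear_form_on (V1 N D e) (weighted_inner {0..edge_len N e} (area N e) f)"
proof -
  let ?M = "lebesgue_on {0..edge_len N e}"
  have fm: "f \<in> borel_measurable ?M" and f2: "integrable ?M (\<lambda>s. area N e s * (f s)\<^sup>2)"
    using f by (auto simp: weighted_L2_def)
  have iA: "integrable ?M (area N e)"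
    by (rule integrable_lebesgue_on_compact[OF compact_Icc area_continuous[OF e]])
  have fi: "integrable ?M (\<lambda>s. f s * area N e s)"
    by (rule weighted_L2_imp_L1[OF fm f2 iA]) (use area_pos[OF e] in \<open>force simp: less_imp_le\<close>)
  have i: "integrable ?M (\<lambda>s. f s * (area N e s * v s))" if v: "v \<in> V1 N D e" for v
  proof -
    obtain M where M: "\<And>s. s \<in> {0..edge_len N e} \<Longrightarrow> \<bar>v s\<bar> \<le> M"
      and vm: "v \<in> borel_measurable ?M"
      using V1_bounded_measurable[OF e v] unfolding bounded_measurable_def by blast
    have "integrable ?M (\<lambda>s. v s * (f s * area N e s))"
      by (rule integrable_bounded_mult[OF fi vm]) (use M in simp)
    then show ?thesis by (simp only: ac_simps)
  qed
  show ?thesis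
    unfolding linear_form_on_def weighted_inner_def using i by (simp add: algebra_simps)
qed

end

section \<open>The coupled system\<close>

type_synonym 'e unknowns = "(real^3 \<Rightarrow> real) \<times> ('e \<Rightarrow> real \<Rightarrow> real) \<times> (real^3 \<Rightarrow> real)"

context network_mesh
begin

definition solution_space :: "'e unknowns set" where
  "solution_space = V3 D \<times> (VG0 \<times> VB0)"

lemma subspace_solution_space: "subspace solution_space"
  unfolding solution_space_def by (intro subspace_Times subspace_V3 subspace_VG0 subspace_VB0)

lemma finite_dim_solution_space: "finite_dim solution_space"
  unfolding solution_space_def by (intro finite_dim_Times finite_dim_V3 finite_dim_VG0 finite_dim_VB0)

text \<open>
  The two exchange terms of the scheme are the two halves of
  \<open>be_form N \<xi> e (exchange e u uh) (exchange e w wh)\<close>, a square on the diagonal.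
\<close>

definition exchange :: "'e \<Rightarrow> (real^3 \<Rightarrow> real) \<Rightarrow> ('e \<Rightarrow> real \<Rightarrow> real) \<Rightarrow> real \<Rightarrow> real" where
  "exchange e u uh s = rim_average N u e s - uh e s"

lemma exchange_bounded_measurable:
  assumes e: "e \<in> arcs (net N)" and "u \<in> V3 D" "uh \<in> VG0"
  shows "exchange e u uh \<in> bounded_measurable e"
proof -
  have "exchange e u uh = rim_average N u e - uh e" by (simp add: exchange_def fun_eq_iff)
  then show ?thesis
    using subspace_diff[OF subspace_bounded_measurable rim_average_bounded_measurable[OF e assms(2)]
        V1_bounded_measurable[OF e VG0_edge[OF assms(3) e]]] by simp
qed

lemma bilinear_exchange:
  assumes e: "e \<in> arcs (net N)"
  shows "bilinear_form_on solution_space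
     (\<lambda>x y. be_form N \<xi> e (exchange e (fst x) (fst (snd x))) (exchange e (fst y) (fst (snd y))))"
proof -
  let ?T = "\<lambda>x :: 'e unknowns. exchange e (fst x) (fst (snd x))"
  have T: "?T x \<in> bounded_measurable e" if "x \<in> solution_space" for x
    using that exchange_bounded_measurable[OF e] by (auto simp: solution_space_def)
  have lc: "?T (x + c *\<^sub>R y) s = (?T x + c *\<^sub>R ?T y) s"
    if "x \<in> solution_space" "y \<in> solution_space" "s \<in> {0..edge_len N e}" for x y c s
    using that rim_average_lincomb[OF e that(3), of "fst x" "fst y" c]
    by (auto simp: exchange_def solution_space_def algebra_simps)
  show ?thesis
  proof (rule bilinear_form_onI)
    fix x y z c assume S: "x \<in> solution_space" "y \<in> solution_space" "z \<in> solution_space"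
    have "be_form N \<xi> e (?T (x + c *\<^sub>R y)) (?T z) = be_form N \<xi> e (?T x + c *\<^sub>R ?T y) (?T z)"
      by (rule be_form_cong[OF lc[OF S(1,2)] refl])
    then show "be_form N \<xi> e (?T (x + c *\<^sub>R y)) (?T z) = be_form N \<xi> e (?T x) (?T z) + c * be_form N \<xi> e (?T y) (?T z)"
      using bilinear_form_onD(1)[OF bilinear_be_form[OF e] T[OF S(1)] T[OF S(2)] T[OF S(3)]] by simp
    have "be_form N \<xi> e (?T z) (?T (x + c *\<^sub>R y)) = be_form N \<xi> e (?T z) (?T x + c *\<^sub>R ?T y)"
      by (rule be_form_cong[OF refl lc[OF S(1,2)]])
    then show "be_form N \<xi> e (?T z) (?T (x + c *\<^sub>R y)) = be_form N \<xi> e (?T z) (?T x) + c * be_form N \<xi> e (?T z) (?T y)"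
      using bilinear_form_onD(2)[OF bilinear_be_form[OF e] T[OF S(1)] T[OF S(2)] T[OF S(3)]] by simp
  qed
qed

context
  fixes \<epsilon>1 \<epsilon>2 \<sigma>\<Omega> :: real and \<sigma>E :: "'e \<Rightarrow> real" and \<sigma>V :: "real^3 \<Rightarrow> real" and \<xi> :: "'e \<Rightarrow> real"
begin

text \<open>
  The sum of the two left-hand sides. Both equations follow from it because the test functions
  vary independently.
\<close>

definition total_form :: "'e unknowns \<Rightarrow> 'e unknowns \<Rightarrow> real" where
  "total_form = (\<lambda>(u, uh, ut) (w, wh, wt).
     a_form D \<epsilon>1 \<sigma>\<Omega> u w
     + (\<Sum>e\<in>arcs (net N). be_form N \<xi> e (exchange e u uh) (exchange e w wh))
     + ((\<Sum>e\<in>arcs (net N). ae_form N D \<epsilon>2 \<sigma>E e (uh e) (wh e))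
         + (\<Sum>v\<in>bifurcations N. bv_form N \<sigma>V v uh ut wh wt)))"

lemma bilinear_total_form: "bilinear_form_on solution_space total_form"
proof -
  have 1: "bilinear_form_on solution_space (\<lambda>x y. a_form D \<epsilon>1 \<sigma>\<Omega> (fst x) (fst y))"
    by (rule bilinear_form_on_compose[OF bilinear_a_form]) (auto simp: solution_space_def)
  have 2: "bilinear_form_on solution_space (\<lambda>x y. (\<lambda>(uh, ut) (wh, wt).
     (\<Sum>e\<in>arcs (net N). ae_form N D \<epsilon>2 \<sigma>E e (uh e) (wh e))
         + (\<Sum>v\<in>bifurcations N. bv_form N \<sigma>V v uh ut wh wt)) (snd x) (snd y))"
    by (rule bilinear_form_on_compose[OF bilinear_network_forms]) (auto simp: solution_space_def)
  have "bilinear_form_on solution_space (\<lambda>x y. a_form D \<epsilon>1 \<sigma>\<Omega> (fst x) (fst y)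
     + (\<Sum>e\<in>arcs (net N). be_form N \<xi> e (exchange e (fst x) (fst (snd x))) (exchange e (fst y) (fst (snd y))))
     + (\<lambda>(uh, ut) (wh, wt). (\<Sum>e\<in>arcs (net N). ae_form N D \<epsilon>2 \<sigma>E e (uh e) (wh e))
         + (\<Sum>v\<in>bifurcations N. bv_form N \<sigma>V v uh ut wh wt)) (snd x) (snd y))"
    by (intro bilinear_form_on_add bilinear_form_on_sum 1 2 bilinear_exchange)
  then show ?thesis by (simp add: total_form_def case_prod_unfold)
qed

context
  fixes f :: "real^3 \<Rightarrow> real" and fh :: "'e \<Rightarrow> real \<Rightarrow> real"
begin

definition solves :: "'e unknowns \<Rightarrow> 'e unknowns \<Rightarrow> bool" where
  "solves = (\<lambda>(u, uh, ut) (w, wh, wt).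
     a_form D \<epsilon>1 \<sigma>\<Omega> u w
       + (\<Sum>e\<in>arcs (net N). be_form N \<xi> e (\<lambda>s. rim_average N u e s - uh e s) (rim_average N w e))
       = weighted_inner \<Omega> (\<lambda>x. 1) f w \<and>
     (\<Sum>e\<in>arcs (net N). ae_form N D \<epsilon>2 \<sigma>E e (uh e) (wh e))
       + (\<Sum>e\<in>arcs (net N). be_form N \<xi> e (\<lambda>s. uh e s - rim_average N u e s) (wh e))
       + (\<Sum>v\<in>bifurcations N. bv_form N \<sigma>V v uh ut wh wt)
       = (\<Sum>e\<in>arcs (net N). weighted_inner {0..edge_len N e} (area N e) (fh e) (wh e)))"

definition total_load :: "'e unknowns \<Rightarrow> real" where
  "total_load = (\<lambda>(w, wh, wt). weighted_inner \<Omega> (\<lambda>x. 1) f w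
     + (\<Sum>e\<in>arcs (net N). weighted_inner {0..edge_len N e} (area N e) (fh e) (wh e)))"

lemma linear_total_load:
  assumes "f \<in> weighted_L2 \<Omega> (\<lambda>x. 1)"
    "\<And>e. e \<in> arcs (net N) \<Longrightarrow> fh e \<in> weighted_L2 {0..edge_len N e} (area N e)"
  shows "linear_form_on solution_space total_load"
proof -
  have 1: "linear_form_on solution_space (\<lambda>x. weighted_inner \<Omega> (\<lambda>x. 1) f (fst x))"
    by (rule linear_form_on_compose[OF linear_source[OF assms(1)]]) (auto simp: solution_space_def)
  have 2: "linear_form_on solution_space (\<lambda>x. weighted_inner {0..edge_len N e} (area N e) (fh e) (fst (snd x) e))"
    if e: "e \<in> arcs (net N)" for e
    by (rule linear_form_on_compose[OF linear_edge_source[OF e assms(2)[OF e]]])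
      (auto simp: solution_space_def VG0_edge e)
  have "linear_form_on solution_space (\<lambda>x. weighted_inner \<Omega> (\<lambda>x. 1) f (fst x)
     + (\<Sum>e\<in>arcs (net N). weighted_inner {0..edge_len N e} (area N e) (fh e) (fst (snd x) e)))"
    by (intro linear_form_on_add linear_form_on_sum 1 2)
  then show ?thesis by (simp add: total_load_def case_prod_unfold)
qed

text \<open>
  Conversely to adding the equations, the test functions with \<open>w = 0\<close> isolate the second equation,
  and subtracting it leaves the first.
\<close>

lemma solves_iff_total:
  assumes U: "U \<in> solution_space"
    and f: "f \<in> weighted_L2 \<Omega> (\<lambda>x. 1)"
    and fh: "\<And>e. e \<in> arcs (net N) \<Longrightarrow> fh e \<in> weighted_L2 {0..edge_len N e} (area N e)"
  shows "(\<forall>W\<in>solution_space. solves U W) \<longleftrightarrow>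
    (\<forall>W\<in>solution_space. total_form U W = total_load W)"
proof -
  obtain u uh ut where U_eq: "U = (u, uh, ut)" by (cases U)
  have S: "u \<in> V3 D" "uh \<in> VG0" "ut \<in> VB0" using U U_eq by (auto simp: solution_space_def)
  have bm: "exchange e u uh \<in> bounded_measurable e" if "e \<in> arcs (net N)" for e
    using exchange_bounded_measurable[OF that S(1,2)] .
  have split: "be_form N \<xi> e (exchange e u uh) (exchange e w wh) =
      be_form N \<xi> e (\<lambda>s. rim_average N u e s - uh e s) (rim_average N w e)
      + be_form N \<xi> e (\<lambda>s. uh e s - rim_average N u e s) (wh e)"
    if e: "e \<in> arcs (net N)" and w: "w \<in> V3 D" "wh \<in> VG0" for e w wh
  proof -
    have "exchange e w wh = rim_average N w e + (-1) *\<^sub>R wh e" by (simp add: exchange_def fun_eq_iff)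
    then have "be_form N \<xi> e (exchange e u uh) (exchange e w wh) =
        be_form N \<xi> e (exchange e u uh) (rim_average N w e) + (-1) * be_form N \<xi> e (exchange e u uh) (wh e)"
      using bilinear_form_onD(2)[OF bilinear_be_form[OF e] rim_average_bounded_measurable[OF e w(1)]
          V1_bounded_measurable[OF e VG0_edge[OF w(2) e]] bm[OF e], of \<xi> "-1"] by simp
    moreover have "be_form N \<xi> e (\<lambda>s. uh e s - rim_average N u e s) (wh e) = (-1) * be_form N \<xi> e (exchange e u uh) (wh e)"
      unfolding be_form_def weighted_inner_def exchange_def
      by (subst integral_mult_right_zero[symmetric]) (simp add: algebra_simps)
    moreover have "exchange e u uh = (\<lambda>s. rim_average N u e s - uh e s)" by (simp add: exchange_def fun_eq_iff)
    ultimately show ?thesis by simp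
  qed
  have sum: "total_form U (w, wh, wt) =
     (a_form D \<epsilon>1 \<sigma>\<Omega> u w
       + (\<Sum>e\<in>arcs (net N). be_form N \<xi> e (\<lambda>s. rim_average N u e s - uh e s) (rim_average N w e)))
     + ((\<Sum>e\<in>arcs (net N). ae_form N D \<epsilon>2 \<sigma>E e (uh e) (wh e))
       + (\<Sum>e\<in>arcs (net N). be_form N \<xi> e (\<lambda>s. uh e s - rim_average N u e s) (wh e))
       + (\<Sum>v\<in>bifurcations N. bv_form N \<sigma>V v uh ut wh wt))"
    if "w \<in> V3 D" "wh \<in> VG0" for w wh wt
    using split[OF _ that] by (simp add: total_form_def U_eq sum.distrib)
  show ?thesis
  proof
    assume h: "\<forall>W\<in>solution_space. solves U W"
    show "\<forall>W\<in>solution_space. total_form U W = total_load W"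
    proof
      fix W assume W: "W \<in> solution_space"
      obtain w wh wt where W_eq: "W = (w, wh, wt)" by (cases W)
      have w: "w \<in> V3 D" "wh \<in> VG0" using W W_eq by (auto simp: solution_space_def)
      show "total_form U W = total_load W"
        unfolding W_eq sum[OF w] using bspec[OF h W]
        by (simp add: solves_def U_eq W_eq total_load_def)
    qed
  next
    assume h: "\<forall>W\<in>solution_space. total_form U W = total_load W"
    have z: "0 \<in> V3 D" "0 \<in> VG0" "0 \<in> VB0"
      using subspace_0 subspace_V3 subspace_VG0 subspace_VB0 by blast+
    show "\<forall>W\<in>solution_space. solves U W"
    proof
      fix W assume W: "W \<in> solution_space"
      obtain w wh wt where W_eq: "W = (w, wh, wt)" by (cases W)
      have w: "w \<in> V3 D" "wh \<in> VG0" "wt \<in> VB0" using W W_eq by (auto simp: solution_space_def)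
      define E1 where "E1 w = a_form D \<epsilon>1 \<sigma>\<Omega> u w
       + (\<Sum>e\<in>arcs (net N). be_form N \<xi> e (\<lambda>s. rim_average N u e s - uh e s) (rim_average N w e))" for w
      define E2 where "E2 wh wt = (\<Sum>e\<in>arcs (net N). ae_form N D \<epsilon>2 \<sigma>E e (uh e) (wh e))
       + (\<Sum>e\<in>arcs (net N). be_form N \<xi> e (\<lambda>s. uh e s - rim_average N u e s) (wh e))
       + (\<Sum>v\<in>bifurcations N. bv_form N \<sigma>V v uh ut wh wt)" for wh wt
      define l1 where "l1 w = weighted_inner \<Omega> (\<lambda>x. 1) f w" for w
      define l2 where "l2 wh = (\<Sum>e\<in>arcs (net N). weighted_inner {0..edge_len N e} (area N e) (fh e) (wh e))" for wh
      have e: "E1 w + E2 wh wt = l1 w + l2 wh" if "w \<in> V3 D" "wh \<in> VG0" "wt \<in> VB0" for w wh wt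
        using bspec[OF h, of "(w, wh, wt)"] sum[OF that(1,2), of wt] that
        by (simp add: solution_space_def total_load_def E1_def E2_def l1_def l2_def)
      have "E1 0 = 0"
      proof -
        have "a_form D \<epsilon>1 \<sigma>\<Omega> u 0 = 0"
          using linear_form_on_zero[OF _ subspace_V3] bilinear_a_form S(1) unfolding bilinear_form_on_def by blast
        moreover have "be_form N \<xi> e a (rim_average N 0 e) = 0" for e a
          by (simp add: be_form_def weighted_inner_def rim_average_def)
        ultimately show ?thesis by (simp add: E1_def)
      qed
      moreover have "l1 0 = 0" by (simp add: l1_def weighted_inner_def)
      ultimately have "E2 wh wt = l2 wh" using e[OF z(1) w(2,3)] by simp
      moreover from this have "E1 w = l1 w" using e[OF w] by simp
      ultimately show "solves U W"
        by (simp add: solves_def U_eq W_eq E1_def E2_def l1_def l2_def)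
    qed
  qed
qed

text \<open>
  These two maps pass between the vector spaces used here and the extensional function spaces of the
  scheme; the equations see only the values on edges and bifurcations.
\<close>

definition extend_zero ::
  "'e unknowns \<Rightarrow>
   'e unknowns" where
  "extend_zero = (\<lambda>(u, uh, ut). (u, \<lambda>e. if e \<in> arcs (net N) then uh e else 0,
     \<lambda>v. if v \<in> bifurcations N then ut v else 0))"

definition extend_undefined ::
  "'e unknowns \<Rightarrow>
   'e unknowns" where
  "extend_undefined = (\<lambda>(u, uh, ut). (u, restrict uh (arcs (net N)), restrict ut (bifurcations N)))"

lemma bv_form_cong:
  assumes "\<And>e. e \<in> arcs (net N) \<Longrightarrow> uh e = uh' e" "ut v = ut' v"
    "\<And>e. e \<in> arcs (net N) \<Longrightarrow> wh e = wh' e" "wt v = wt' v"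
  shows "bv_form N \<sigma>V v uh ut wh wt = bv_form N \<sigma>V v uh' ut' wh' wt'"
proof -
  have "uh e = uh' e" "wh e = wh' e" if "e \<in> edges_at N v" for e
    using that edges_at_arcs assms by blast+
  then show ?thesis unfolding bv_form_def using assms(2,4) by simp
qed

lemma solves_cong:
  assumes "\<And>e. e \<in> arcs (net N) \<Longrightarrow> uh e = uh' e" "\<And>v. v \<in> bifurcations N \<Longrightarrow> ut v = ut' v"
    "\<And>e. e \<in> arcs (net N) \<Longrightarrow> wh e = wh' e" "\<And>v. v \<in> bifurcations N \<Longrightarrow> wt v = wt' v"
  shows "solves (u, uh, ut) (w, wh, wt) = solves (u, uh', ut') (w, wh', wt')"
  unfolding solves_def using assms bv_form_cong[of uh uh' ut _ ut' wh wh' wt wt'] by simp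

lemma solves_extend:
  "solves (extend_zero U) W = solves U W"
  "solves U (extend_zero W) = solves U W"
  "solves (extend_undefined U) W = solves U W"
  "solves U (extend_undefined W) = solves U W"
  by (cases U; cases W; simp add: extend_zero_def extend_undefined_def; intro solves_cong; simp)+

lemma extend_zero_in: "U \<in> V3 D \<times> VG N D \<times> VB N \<Longrightarrow> extend_zero U \<in> solution_space"
  by (auto simp: extend_zero_def solution_space_def VG0_def VB0_def VG_def)

lemma extend_undefined_in: "U \<in> solution_space \<Longrightarrow> extend_undefined U \<in> V3 D \<times> VG N D \<times> VB N"
  by (auto simp: extend_undefined_def solution_space_def VG0_def VG_def VB_def finite_bifurcations)

lemma extend_undefined_zero: "U \<in> V3 D \<times> VG N D \<times> VB N \<Longrightarrow> extend_undefined (extend_zero U) = U"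
  by (auto simp: extend_zero_def extend_undefined_def VG_def VB_def restrict_def fun_eq_iff
      PiE_def extensional_def)

lemma unique_solution_extensional:
  assumes "\<exists>!U. U \<in> solution_space \<and> (\<forall>W\<in>solution_space. solves U W)"
  shows "\<exists>!U. U \<in> V3 D \<times> VG N D \<times> VB N \<and>
    (\<forall>W\<in>V3 D \<times> VG N D \<times> VB N. solves U W)" (is "\<exists>!U. ?P U")
proof -
  obtain U where U: "U \<in> solution_space" "\<forall>W\<in>solution_space. solves U W"
    and unique: "\<And>U'. U' \<in> solution_space \<Longrightarrow> \<forall>W\<in>solution_space. solves U' W \<Longrightarrow> U' = U"
    using assms by (rule ex1E) blast
  show ?thesis
  proof (rule ex1I[of _ "extend_undefined U"])
    show "?P (extend_undefined U)"
    proof (intro conjI ballI)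
      show "extend_undefined U \<in> V3 D \<times> VG N D \<times> VB N" using extend_undefined_in[OF U(1)] .
      fix W assume "W \<in> V3 D \<times> VG N D \<times> VB N"
      then have "solves U (extend_zero W)" using U(2) extend_zero_in by blast
      then show "solves (extend_undefined U) W" by (simp add: solves_extend)
    qed
    fix U' assume U': "?P U'"
    have "extend_zero U' = U"
    proof (rule unique)
      show "extend_zero U' \<in> solution_space" using U' extend_zero_in by blast
      show "\<forall>W\<in>solution_space. solves (extend_zero U') W"
      proof
        fix W assume "W \<in> solution_space"
        then have "solves U' (extend_undefined W)" using U' extend_undefined_in by blast
        then show "solves (extend_zero U') W" by (simp add: solves_extend)
      qed
    qed
    then show "U' = extend_undefined U" using extend_undefined_zero[of U'] U' by metis
  qed
qed

end

end

definition admissible ::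
  "real \<Rightarrow> real \<Rightarrow> real \<Rightarrow> real \<Rightarrow> ('e \<Rightarrow> real) \<Rightarrow> (real^3 \<Rightarrow> real) \<Rightarrow> ('e \<Rightarrow> real) \<Rightarrow> bool" where
  "admissible \<sigma>0 \<epsilon>1 \<epsilon>2 \<sigma>\<Omega> \<sigma>E \<sigma>V \<xi> \<longleftrightarrow>
     \<epsilon>1 \<in> {-1, 0, 1} \<and> \<epsilon>2 \<in> {-1, 0, 1} \<and> \<sigma>\<Omega> > 0 \<and> (\<epsilon>1 \<noteq> 1 \<longrightarrow> \<sigma>\<Omega> \<ge> \<sigma>0) \<and>
     (\<forall>e\<in>arcs (net N). \<sigma>E e > 0 \<and> (\<epsilon>2 \<noteq> 1 \<longrightarrow> \<sigma>E e \<ge> \<sigma>0)) \<and>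
     (\<forall>v\<in>bifurcations N. \<sigma>V v \<ge> \<sigma>0) \<and> (\<forall>e\<in>arcs (net N). \<xi> e > 0)"

text \<open>
  The three parts are nonnegative, so all vanish with the total. The first gives \<open>u = 0\<close>; the
  exchange then reduces to the norm of \<open>uh\<close>, so \<open>uh = 0\<close>; what is left of the network form is the
  penalty at the bifurcations, so \<open>ut = 0\<close>.
\<close>

lemma total_form_definite:
  obtains \<sigma>0 where "\<sigma>0 > 0"
    "\<And>\<epsilon>1 \<epsilon>2 \<sigma>\<Omega> \<sigma>E \<sigma>V \<xi> U. admissible \<sigma>0 \<epsilon>1 \<epsilon>2 \<sigma>\<Omega> \<sigma>E \<sigma>V \<xi> \<Longrightarrow> U \<in> solution_space \<Longrightarrow>
       total_form \<epsilon>1 \<epsilon>2 \<sigma>\<Omega> \<sigma>E \<sigma>V \<xi> U U \<ge> 0 \<and>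
       (total_form \<epsilon>1 \<epsilon>2 \<sigma>\<Omega> \<sigma>E \<sigma>V \<xi> U U = 0 \<longrightarrow> U = 0)"
proof -
  obtain \<sigma>1 where \<sigma>1: "\<sigma>1 > 0"
    "\<And>\<epsilon> \<sigma> u. \<epsilon> \<in> {-1, 0, 1} \<Longrightarrow> \<sigma> > 0 \<Longrightarrow> (\<epsilon> \<noteq> 1 \<Longrightarrow> \<sigma> \<ge> \<sigma>1) \<Longrightarrow> u \<in> V3 D \<Longrightarrow>
       a_form D \<epsilon> \<sigma> u u \<ge> 0 \<and> (a_form D \<epsilon> \<sigma> u u = 0 \<longrightarrow> u = 0)"
    using a_form_coercive by blast
  obtain \<sigma>2 where \<sigma>2: "\<sigma>2 > 0"
    "\<And>\<epsilon> \<sigma>E \<sigma>V uh ut. \<epsilon> \<in> {-1, 0, 1} \<Longrightarrow>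
       (\<And>e. e \<in> arcs (net N) \<Longrightarrow> \<sigma>E e > 0 \<and> (\<epsilon> \<noteq> 1 \<longrightarrow> \<sigma>E e \<ge> \<sigma>2)) \<Longrightarrow>
       (\<And>v. v \<in> bifurcations N \<Longrightarrow> \<sigma>V v \<ge> \<sigma>2) \<Longrightarrow> uh \<in> VG0 \<Longrightarrow>
       (\<Sum>e\<in>arcs (net N). ae_form N D \<epsilon> \<sigma>E e (uh e) (uh e))
         + (\<Sum>v\<in>bifurcations N. bv_form N \<sigma>V v uh ut uh ut) \<ge> 0"
    using network_forms_nonneg by blast
  define \<sigma>0 where "\<sigma>0 = max \<sigma>1 \<sigma>2"
  have "total_form \<epsilon>1 \<epsilon>2 \<sigma>\<Omega> \<sigma>E \<sigma>V \<xi> U U \<ge> 0 \<and>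
       (total_form \<epsilon>1 \<epsilon>2 \<sigma>\<Omega> \<sigma>E \<sigma>V \<xi> U U = 0 \<longrightarrow> U = 0)"
    if adm: "admissible \<sigma>0 \<epsilon>1 \<epsilon>2 \<sigma>\<Omega> \<sigma>E \<sigma>V \<xi>" and U: "U \<in> solution_space"
    for \<epsilon>1 \<epsilon>2 \<sigma>\<Omega> \<sigma>E \<sigma>V \<xi> U
  proof -
    have \<epsilon>: "\<epsilon>1 \<in> {-1, 0, 1}" "\<epsilon>2 \<in> {-1, 0, 1}" and \<sigma>\<Omega>: "\<sigma>\<Omega> > 0" "\<epsilon>1 \<noteq> 1 \<longrightarrow> \<sigma>\<Omega> \<ge> \<sigma>0"
      and \<sigma>E: "\<And>e. e \<in> arcs (net N) \<Longrightarrow> \<sigma>E e > 0 \<and> (\<epsilon>2 \<noteq> 1 \<longrightarrow> \<sigma>E e \<ge> \<sigma>0)"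
      and \<sigma>V: "\<And>v. v \<in> bifurcations N \<Longrightarrow> \<sigma>V v \<ge> \<sigma>0"
      and \<xi>: "\<And>e. e \<in> arcs (net N) \<Longrightarrow> \<xi> e > 0"
      using adm unfolding admissible_def by blast+
    obtain u uh ut where U_eq: "U = (u, uh, ut)" by (cases U)
    have S: "u \<in> V3 D" "uh \<in> VG0" "ut \<in> VB0" using U U_eq by (auto simp: solution_space_def)
    define A where "A = a_form D \<epsilon>1 \<sigma>\<Omega> u u"
    define B where "B = (\<Sum>e\<in>arcs (net N). be_form N \<xi> e (exchange e u uh) (exchange e u uh))"
    define R where "R = (\<Sum>e\<in>arcs (net N). ae_form N D \<epsilon>2 \<sigma>E e (uh e) (uh e))
         + (\<Sum>v\<in>bifurcations N. bv_form N \<sigma>V v uh ut uh ut)"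
    have tot: "total_form \<epsilon>1 \<epsilon>2 \<sigma>\<Omega> \<sigma>E \<sigma>V \<xi> U U = A + B + R"
      by (simp add: total_form_def U_eq A_def B_def R_def)
    have A: "A \<ge> 0" "A = 0 \<Longrightarrow> u = 0"
      using \<sigma>1(2)[OF \<epsilon>(1) \<sigma>\<Omega>(1) _ S(1)] \<sigma>\<Omega>(2) by (auto simp: A_def \<sigma>0_def)
    have Be: "be_form N \<xi> e (exchange e u uh) (exchange e u uh) \<ge> 0" if "e \<in> arcs (net N)" for e
      using be_form_nonneg[OF that, of \<xi>] \<xi>[OF that] by blast
    then have B: "B \<ge> 0" unfolding B_def by (rule sum_nonneg)
    have R: "R \<ge> 0"
      unfolding R_def
    proof (rule \<sigma>2(2)[OF \<epsilon>(2) _ _ S(2)])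
      show "\<sigma>E e > 0 \<and> (\<epsilon>2 \<noteq> 1 \<longrightarrow> \<sigma>E e \<ge> \<sigma>2)" if "e \<in> arcs (net N)" for e
        using \<sigma>E[OF that] by (auto simp: \<sigma>0_def)
      show "\<sigma>V v \<ge> \<sigma>2" if "v \<in> bifurcations N" for v using \<sigma>V[OF that] by (simp add: \<sigma>0_def)
    qed
    have "U = 0" if z: "A + B + R = 0"
    proof -
      have AB: "A = 0" "B = 0" "R = 0" using A(1) B R z by linarith+
      have u0: "u = 0" using A(2)[OF AB(1)] .
      have uhe: "uh e = 0" if e: "e \<in> arcs (net N)" for e
      proof -
        have v: "uh e \<in> V1 N D e" using VG0_edge[OF S(2) e] .
        have "be_form N \<xi> e (exchange e u uh) (exchange e u uh) = 0"
          using AB(2) Be e finite_arcs unfolding B_def by (subst (asm) sum_nonneg_eq_0_iff) auto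
        moreover have "be_form N \<xi> e (exchange e u uh) (exchange e u uh) = be_form N \<xi> e (uh e) (uh e)"
          by (simp add: be_form_def weighted_inner_def exchange_def u0 rim_average_def)
        ultimately show ?thesis using be_form_zero[OF e, of \<xi>] \<xi>[OF e] v by simp
      qed
      then have uh0: "uh = 0" using S(2) by (auto simp: VG0_def fun_eq_iff)
      have "ae_form N D \<epsilon>2 \<sigma>E e 0 0 = 0" if "e \<in> arcs (net N)" for e
        using linear_form_on_zero[OF _ subspace_V1, of e "ae_form N D \<epsilon>2 \<sigma>E e 0"]
          bilinear_ae_form[OF that, of \<epsilon>2 \<sigma>E] subspace_0[OF subspace_V1] by (simp add: bilinear_form_on_def)
      then have "(\<Sum>v\<in>bifurcations N. bv_form N \<sigma>V v 0 ut 0 ut) = 0"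
        using AB(3) by (simp add: R_def uh0)
      then have "ut = 0"
        using bv_form_zero[of \<sigma>V ut] \<sigma>V \<sigma>2(1) S(3) by (force simp: \<sigma>0_def)
      then show ?thesis by (simp add: U_eq u0 uh0 zero_prod_def)
    qed
    then show ?thesis using tot A(1) B R by simp
  qed
  moreover have "\<sigma>0 > 0" using \<sigma>1(1) by (simp add: \<sigma>0_def)
  ultimately show ?thesis using that by blast
qed

lemma unique_solution:
  "\<exists>\<sigma>0>0. \<forall>\<epsilon>1\<in>{-1,0,1}. \<forall>\<epsilon>2\<in>{-1,0,1}. \<forall>\<sigma>\<Omega> \<sigma>E \<sigma>V \<xi> f fh.
    \<sigma>\<Omega> > 0 \<and> (\<epsilon>1 \<noteq> 1 \<longrightarrow> \<sigma>\<Omega> \<ge> \<sigma>0) \<and>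
    (\<forall>e\<in>arcs (net N). \<sigma>E e > 0 \<and> (\<epsilon>2 \<noteq> 1 \<longrightarrow> \<sigma>E e \<ge> \<sigma>0)) \<and>
    (\<forall>v\<in>bifurcations N. \<sigma>V v \<ge> \<sigma>0) \<and>
    (\<forall>e\<in>arcs (net N). \<xi> e > 0) \<and>
    f \<in> weighted_L2 \<Omega> (\<lambda>x. 1) \<and>
    (\<forall>e\<in>arcs (net N). fh e \<in> weighted_L2 {0..edge_len N e} (area N e))
    \<longrightarrow>
    (\<exists>!U. U \<in> V3 D \<times> VG N D \<times> VB N \<and>
      (\<forall>W\<in>V3 D \<times> VG N D \<times> VB N. solves \<epsilon>1 \<epsilon>2 \<sigma>\<Omega> \<sigma>E \<sigma>V \<xi> f fh U W))"
proof -
  obtain \<sigma>0 where \<sigma>0: "\<sigma>0 > 0"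
    "\<And>\<epsilon>1 \<epsilon>2 \<sigma>\<Omega> \<sigma>E \<sigma>V \<xi> U. admissible \<sigma>0 \<epsilon>1 \<epsilon>2 \<sigma>\<Omega> \<sigma>E \<sigma>V \<xi> \<Longrightarrow> U \<in> solution_space \<Longrightarrow>
       total_form \<epsilon>1 \<epsilon>2 \<sigma>\<Omega> \<sigma>E \<sigma>V \<xi> U U \<ge> 0 \<and>
       (total_form \<epsilon>1 \<epsilon>2 \<sigma>\<Omega> \<sigma>E \<sigma>V \<xi> U U = 0 \<longrightarrow> U = 0)"
    using total_form_definite by blast
  have "\<exists>!U. U \<in> V3 D \<times> VG N D \<times> VB N \<and>
      (\<forall>W\<in>V3 D \<times> VG N D \<times> VB N. solves \<epsilon>1 \<epsilon>2 \<sigma>\<Omega> \<sigma>E \<sigma>V \<xi> f fh U W)"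
    if adm: "admissible \<sigma>0 \<epsilon>1 \<epsilon>2 \<sigma>\<Omega> \<sigma>E \<sigma>V \<xi>" and f: "f \<in> weighted_L2 \<Omega> (\<lambda>x. 1)"
      and fh: "\<And>e. e \<in> arcs (net N) \<Longrightarrow> fh e \<in> weighted_L2 {0..edge_len N e} (area N e)"
    for \<epsilon>1 \<epsilon>2 \<sigma>\<Omega> \<sigma>E \<sigma>V \<xi> f fh
  proof (rule unique_solution_extensional)
    have "\<exists>!U. U \<in> solution_space \<and>
        (\<forall>W\<in>solution_space. total_form \<epsilon>1 \<epsilon>2 \<sigma>\<Omega> \<sigma>E \<sigma>V \<xi> U W = total_load f fh W)"
      by (rule positive_definite_unique_solution[OF finite_dim_solution_space subspace_solution_space
            bilinear_total_form linear_total_load[OF f fh]]) (use \<sigma>0(2)[OF adm] in auto)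
    then show "\<exists>!U. U \<in> solution_space \<and> (\<forall>W\<in>solution_space. solves \<epsilon>1 \<epsilon>2 \<sigma>\<Omega> \<sigma>E \<sigma>V \<xi> f fh U W)"
      using solves_iff_total[OF _ f fh] by (simp cong: conj_cong)
  qed
  then show ?thesis
    by (intro exI[of _ \<sigma>0] conjI[OF \<sigma>0(1)] ballI allI impI) (simp add: admissible_def)
qed

end

theorem lemma6p1:
  fixes \<Omega> :: "(real^3) set" and N :: "'e network" and D :: "'e discretization"
  assumes domain: "open \<Omega>" "Topological_Spaces.connected \<Omega>" "bounded \<Omega>" "\<Omega> \<noteq> {}"
    and network: "embedded_graph \<Omega> N" "surrounding_cylinders \<Omega> N"
    and mesh3: "tetrahedral_mesh \<Omega> N D"
    and mesh1: "\<And>e. e \<in> arcs (net N) \<Longrightarrow> cells D e \<ge> 1"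
  shows "\<exists>\<sigma>0>0. \<forall>\<epsilon>1\<in>{-1,0,1}. \<forall>\<epsilon>2\<in>{-1,0,1}. \<forall>\<sigma>\<Omega> \<sigma>E \<sigma>V \<xi> f fh.
    \<sigma>\<Omega> > 0 \<and> (\<epsilon>1 \<noteq> 1 \<longrightarrow> \<sigma>\<Omega> \<ge> \<sigma>0) \<and>
    (\<forall>e\<in>arcs (net N). \<sigma>E e > 0 \<and> (\<epsilon>2 \<noteq> 1 \<longrightarrow> \<sigma>E e \<ge> \<sigma>0)) \<and>
    (\<forall>v\<in>bifurcations N. \<sigma>V v \<ge> \<sigma>0) \<and>
    (\<forall>e\<in>arcs (net N). \<xi> e > 0) \<and>
    f \<in> weighted_L2 \<Omega> (\<lambda>x. 1) \<and>
    (\<forall>e\<in>arcs (net N). fh e \<in> weighted_L2 {0..edge_len N e} (area N e))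
    \<longrightarrow>
    (\<exists>!U. U \<in> V3 D \<times> VG N D \<times> VB N \<and>
      (case U of (u, uh, ut) \<Rightarrow>
        \<forall>w\<in>V3 D. \<forall>wh\<in>VG N D. \<forall>wt\<in>VB N.
          a_form D \<epsilon>1 \<sigma>\<Omega> u w
            + (\<Sum>e\<in>arcs (net N).
                 be_form N \<xi> e (\<lambda>s. rim_average N u e s - uh e s) (rim_average N w e))
            = weighted_inner \<Omega> (\<lambda>x. 1) f w \<and>
          (\<Sum>e\<in>arcs (net N). ae_form N D \<epsilon>2 \<sigma>E e (uh e) (wh e))
            + (\<Sum>e\<in>arcs (net N).
                 be_form N \<xi> e (\<lambda>s. uh e s - rim_average N u e s) (wh e))
            + (\<Sum>v\<in>bifurcations N. bv_form N \<sigma>V v uh ut wh wt)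
            = (\<Sum>e\<in>arcs (net N). weighted_inner {0..edge_len N e} (area N e) (fh e) (wh e))))"
proof -
  interpret network_mesh \<Omega> N D
    by unfold_locales (use network mesh3 mesh1 in auto)
  have eq: "(\<forall>W\<in>V3 D \<times> VG N D \<times> VB N. solves \<epsilon>1 \<epsilon>2 \<sigma>\<Omega> \<sigma>E \<sigma>V \<xi> f fh U W) \<longleftrightarrow>
      (case U of (u, uh, ut) \<Rightarrow>
        \<forall>w\<in>V3 D. \<forall>wh\<in>VG N D. \<forall>wt\<in>VB N.
          a_form D \<epsilon>1 \<sigma>\<Omega> u w
            + (\<Sum>e\<in>arcs (net N).
                 be_form N \<xi> e (\<lambda>s. rim_average N u e s - uh e s) (rim_average N w e))
            = weighted_inner \<Omega> (\<lambda>x. 1) f w \<and>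
          (\<Sum>e\<in>arcs (net N). ae_form N D \<epsilon>2 \<sigma>E e (uh e) (wh e))
            + (\<Sum>e\<in>arcs (net N).
                 be_form N \<xi> e (\<lambda>s. uh e s - rim_average N u e s) (wh e))
            + (\<Sum>v\<in>bifurcations N. bv_form N \<sigma>V v uh ut wh wt)
            = (\<Sum>e\<in>arcs (net N). weighted_inner {0..edge_len N e} (area N e) (fh e) (wh e)))"
    for \<epsilon>1 \<epsilon>2 \<sigma>\<Omega> \<sigma>E \<sigma>V \<xi> f fh U
    by (cases U) (auto simp: solves_def)
  show ?thesis using unique_solution unfolding eq .
qed

end
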